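(* Let $A\subset\mathcal{B}(\mathcal{H})$ be a unital $C^*$-algebra of operators on a Hilbert space $\mathcal{H}$, and $L$ a left line module over $A$ with a star operation $\star:L\to\overline L$ and a star compatible non-degenerate Hermitian metric $G:\overline L\to L^\circ$ whose inner product $\langle\,,\,\rangle:L\otimes_A\overline L\to A$ is positive, making $L$ a Hilbert $C^*$-module. Let $e^i\in L$, $e_i\in L^\circ$ $(1\le i\le n)$ be a dual basis; assume that the matrix $g^{ij}=\langle e^i,\overline{e^j}\rangle$ has a Hermitian square root $(r^{ij})\in M_n(A)$, i.e. $\sum_p r^{ip}r^{pj}=g^{ij}$, and that there is a constant $M\ge0$ such that $|e_i(e^j.a)|_A\le M|a|_A$ for all $i,j$ and all $a\in A$ (where $|\cdot|_A$ is the norm of $A$). Consider pairs $(f_0,f_1)$ where $f_1:\mathbb{R}\to L$ has the form $f_1(x)=\sum_i f_{1,i}(x).e^i$ with each $f_{1,i}:\mathbb{R}\to A$ continuous of compact support, and $f_0:\mathbb{R}\to A$ is as specified below. These act on the Hilbert space $\mathcal{H}_{0,1}$ by bounded operators, and taking the $C^*$-completion (norm closure) as operators on $\mathcal{H}_{0,1}$ gives three $C^*$-algebras: (a) the non-unital algebra of functions vanishing at infinity on the fibres, given by taking $f_0\in C_0(\mathbb{R},A)$; (b) the unital Thom algebra, given by adjoining $\mathbb{C}$ (i.e. the scalar multiples of the identity) to case (a), i.e. the one point compactification; (c) the unital associated circle bundle algebra, given by taking $f_0\in C(\mathbb{R}_\infty,A)$.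
   Context: Modules. For an $A$-bimodule $E$, $E^\circ={}_A\mathrm{Hom}(E,A)$ (left module maps), a bimodule with $(\alpha.a)(e)=\alpha(e)a$, $(a.\alpha)(e)=\alpha(e.a)$. If $E$ is finitely generated projective as a left module, a dual basis is $e^i\in E$, $e_i\in E^\circ$ with $f=\sum_i e_i(f).e^i$ for all $f$; $\mathrm{ev}:E\otimes_A E^\circ\to A$, $\mathrm{ev}(e\otimes\alpha)=\alpha(e)$, and $\mathrm{coev}:A\to E^\circ\otimes_A E$, $\mathrm{coev}(1)=\sum_i e_i\otimes e^i$ are bimodule maps. A left line module is an $A$-bimodule $L$, finitely generated projective as a left module, with $\mathrm{coev}$ and $\mathrm{ev}$ isomorphisms. The conjugate bimodule $\overline E$ is the conjugate vector space with $a.\overline e=\overline{e.a^*}$, $\overline e.a=\overline{a^*.e}$. A star operation on $L$ is a bimodule map $\star:L\to\overline L$, $\star(e)=\overline{e^*}$, with $e^{**}=e$. A non-degenerate Hermitian metric is an invertible bimodule map $G:\overline L\to L^\circ$ with $\langle e,\overline f\rangle=\mathrm{ev}(e\otimes G(\overline f))$ satisfying $\langle e,\overline f\rangle=\langle f,\overline e\rangle^*$. Write $G\star:L\to L^\circ$, $e\mapsto G(\overline{e^*})$; $G$ is star compatible if $\mathrm{ev}\circ((G\star)^{-1}\otimes G\star)\circ\mathrm{coev}(1_A)=1_A$. Algebra. Pairs $(f_0,f_1)$ of functions $f_0:\mathbb{R}\to A$, $f_1:\mathbb{R}\to L$ are multiplied by $(f_0,f_1)(g_0,g_1)=(h_0,h_1)$,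 $h_0(x)=f_0(x)g_0(x)+x^2\langle f_1(x),\overline{g_1(x)^*}\rangle$, $h_1(x)=f_0(x)g_1(x)+f_1(x)g_0(x)$, with star $(f_0,f_1)^*(x)=(f_0(x)^*,f_1(x)^* )$. Hilbert space. $\mathbb{R}_\infty$ is the one point compactification of $\mathbb{R}$. Let $\mathcal{H}_0=C(\mathbb{R}_\infty,\mathcal{H})$ and $\mathcal{H}_1=C_c(\mathbb{R},\overline L\otimes_A\mathcal{H})$, meaning functions $\sum_i\overline{e^i}\otimes k_i(x)$ with $k_i:\mathbb{R}\to\mathcal{H}$ continuous of compact support. Write the inner product of $\mathcal{H}$ as $\langle\overline u,w\rangle_{\mathcal{H}}$, conjugate linear in $u$ and linear in $w$. Set $\langle\overline{v_0},w_0\rangle_0(x)=\langle\overline{v_0(x)},w_0(x)\rangle_{\mathcal{H}}$ on $\mathcal{H}_0$, and on $\mathcal{H}_1$ define $\langle\ ,\ \rangle_1(x)$ by sesquilinear extension from: $\langle\overline{v_1},w_1\rangle_1(x)=\langle\overline u,\langle e,\overline{e'}\rangle u'\rangle_{\mathcal{H}}$ if $v_1(x)=\overline e\otimes u$, $w_1(x)=\overline{e'}\otimes u'$. Then $\mathcal{H}_{0,1}$ is the Hilbert space completion of $\mathcal{H}_0\oplus\mathcal{H}_1$ for $$\langle\overline{(v_0,v_1)},(w_0,w_1)\rangle_{0,1}=\int_{\mathbb{R}}\frac{\langle\overline{v_0},w_0\rangle_0+x^2\langle\overline{v_1},w_1\rangle_1}{1+x^2}\,dx .$$ Action. $(f_0,f_1)$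 sends $(v_0,v_1)$ to $(w_0,w_1)$, $w_0(x)=f_0(x)v_0(x)+x^2\langle f_1(x),\overline e\rangle u$ and $w_1(x)=\overline{f_1(x)^*}\otimes v_0(x)+\overline{e.f_0(x)^*}\otimes u$ when $v_1(x)=\overline e\otimes u$ (extended linearly to sums), and is extended by continuity to $\mathcal{H}_{0,1}$. *)

theory Defs
  imports
    "HOL-Analysis.Analysis"
    "HOL-Algebra.Generated_Groups"
    "HOL-Algebra.Free_Abelian_Groups"
    "HOL-Library.Function_Algebras"
begin

section \<open>Complex vector spaces and Hilbert spaces\<close>

class complex_vector = real_vector +
  fixes scaleC :: "complex \<Rightarrow> 'a \<Rightarrow> 'a"  (infixr \<open>*\<^sub>C\<close> 75)
  assumes scaleC_add_right: "c *\<^sub>C (x + y) = c *\<^sub>C x + c *\<^sub>C y"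
    and scaleC_add_left: "(c + d) *\<^sub>C x = c *\<^sub>C x + d *\<^sub>C x"
    and scaleC_scaleC: "c *\<^sub>C d *\<^sub>C x = (c * d) *\<^sub>C x"
    and scaleC_one: "1 *\<^sub>C x = x"
    and scaleR_scaleC: "s *\<^sub>R x = complex_of_real s *\<^sub>C x"

class complex_normed_vector = complex_vector + real_normed_vector +
  assumes norm_scaleC: "norm (c *\<^sub>C x) = cmod c * norm x"

text \<open>The inner product is conjugate linear in the first argument.\<close>

class complex_hilbert = complex_normed_vector + complete_space +
  fixes cinner :: "'a \<Rightarrow> 'a \<Rightarrow> complex"
  assumes cinner_commute: "cinner x y = cnj (cinner y x)"
    and cinner_add_right: "cinner x (y + z) = cinner x y + cinner x z"
    and cinner_scaleC_right: "cinner x (c *\<^sub>C y) = c * cinner x y"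
    and cinner_self: "cinner x x = complex_of_real ((norm x)\<^sup>2)"

instantiation "fun" :: (type, real_vector) real_vector
begin
definition scaleR_fun :: "real \<Rightarrow> ('a \<Rightarrow> 'b) \<Rightarrow> 'a \<Rightarrow> 'b"
  where "s *\<^sub>R f = (\<lambda>x. s *\<^sub>R f x)"
instance
  by standard (auto simp: scaleR_fun_def fun_eq_iff scaleR_add_right scaleR_add_left)
end

instantiation "fun" :: (type, complex_vector) complex_vector
begin
definition scaleC_fun :: "complex \<Rightarrow> ('a \<Rightarrow> 'b) \<Rightarrow> 'a \<Rightarrow> 'b"
  where "c *\<^sub>C f = (\<lambda>x. c *\<^sub>C f x)"
instance
  by standard
    (auto simp: scaleC_fun_def scaleR_fun_def fun_eq_iff scaleC_add_right scaleC_add_left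
      scaleC_scaleC scaleC_one scaleR_scaleC)
end

instantiation blinfun :: (real_normed_vector, complex_normed_vector) complex_vector
begin
lift_definition scaleC_blinfun :: "complex \<Rightarrow> 'a \<Rightarrow>\<^sub>L 'b \<Rightarrow> 'a \<Rightarrow>\<^sub>L 'b"
  is "\<lambda>c f x. c *\<^sub>C f x"
proof -
  fix c :: complex and f :: "'a \<Rightarrow> 'b"
  assume f: "bounded_linear f"
  have "bounded_linear (\<lambda>y::'b. c *\<^sub>C y)"
    by (rule bounded_linear_intro[where K = "cmod c"])
      (simp_all add: scaleC_add_right scaleR_scaleC scaleC_scaleC norm_scaleC mult.commute)
  from bounded_linear_compose[OF this f] show "bounded_linear (\<lambda>x. c *\<^sub>C f x)" .
qed
instance
  by standard
    (transfer; auto simp: fun_eq_iff scaleC_add_right scaleC_add_left scaleC_scaleC scaleC_one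
      scaleR_scaleC)+
end

text \<open>The conjugate vector space: \<open>Conj e\<close> is the element usually written $\overline e$.\<close>

datatype 'a conj = Conj (unConj: 'a)

instantiation conj :: (complex_vector) complex_vector
begin
definition zero_conj :: "'a conj" where "0 = Conj 0"
definition plus_conj :: "'a conj \<Rightarrow> 'a conj \<Rightarrow> 'a conj"
  where "x + y = Conj (unConj x + unConj y)"
definition minus_conj :: "'a conj \<Rightarrow> 'a conj \<Rightarrow> 'a conj"
  where "x - y = Conj (unConj x - unConj y)"
definition uminus_conj :: "'a conj \<Rightarrow> 'a conj" where "- x = Conj (- unConj x)"
definition scaleR_conj :: "real \<Rightarrow> 'a conj \<Rightarrow> 'a conj" where "s *\<^sub>R x = Conj (s *\<^sub>R unConj x)"
definition scaleC_conj :: "complex \<Rightarrow> 'a conj \<Rightarrow> 'a conj"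
  where "c *\<^sub>C x = Conj (cnj c *\<^sub>C unConj x)"
instance
  by standard
    (auto simp: zero_conj_def plus_conj_def minus_conj_def uminus_conj_def scaleR_conj_def
      scaleC_conj_def conj.expand scaleC_add_right scaleC_add_left scaleC_scaleC scaleC_one
      scaleR_scaleC add.assoc scaleR_add_right scaleR_add_left intro: add.commute)
end


section \<open>C*-algebras of operators\<close>

text \<open>The library's \<open>'h \<Rightarrow>\<^sub>L 'h\<close> consists of the bounded real-linear operators with the operator
  norm; bounded operators on a complex Hilbert space are those that are moreover complex
  linear.\<close>

type_synonym 'h op = "'h \<Rightarrow>\<^sub>L 'h"

definition clinear_op :: "'h::complex_hilbert op \<Rightarrow> bool" where
  "clinear_op T \<longleftrightarrow> (\<forall>c x. blinfun_apply T (c *\<^sub>C x) = c *\<^sub>C blinfun_apply T x)"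

definition is_adjoint :: "'h::complex_hilbert op \<Rightarrow> 'h op \<Rightarrow> bool" where
  "is_adjoint S T \<longleftrightarrow>
     (\<forall>x y. cinner (blinfun_apply S x) y = cinner x (blinfun_apply T y))"

definition adj :: "'h::complex_hilbert op \<Rightarrow> 'h op" where
  "adj T = (THE S. is_adjoint S T)"

definition op_cstar_algebra :: "'h::complex_hilbert op set \<Rightarrow> bool" where
  "op_cstar_algebra B \<longleftrightarrow>
     (\<forall>T\<in>B. clinear_op T) \<and> 0 \<in> B \<and> (\<forall>S\<in>B. \<forall>T\<in>B. S + T \<in> B) \<and>
     (\<forall>c. \<forall>T\<in>B. c *\<^sub>C T \<in> B) \<and> (\<forall>S\<in>B. \<forall>T\<in>B. S o\<^sub>L T \<in> B) \<and>
     (\<forall>T\<in>B. \<exists>S\<in>B. is_adjoint S T) \<and> closed B"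

definition has_unit :: "'h::complex_hilbert op set \<Rightarrow> bool" where
  "has_unit B \<longleftrightarrow> (\<exists>P\<in>B. \<forall>T\<in>B. P o\<^sub>L T = T \<and> T o\<^sub>L P = T)"

definition positive_in :: "'h::complex_hilbert op set \<Rightarrow> 'h op \<Rightarrow> bool" where
  "positive_in A T \<longleftrightarrow> (\<exists>b\<in>A. T = adj b o\<^sub>L b)"


section \<open>Modules and bimodules\<close>

record ('s, 'm) lmodule =
  mcar :: "'m set"
  lact :: "'s \<Rightarrow> 'm \<Rightarrow> 'm"

record ('s, 'm) bimodule = "('s, 'm) lmodule" +
  ract :: "'m \<Rightarrow> 's \<Rightarrow> 'm"

definition left_module ::
    "'h::complex_hilbert op set \<Rightarrow> ('h op, 'm::complex_vector, 'x) lmodule_scheme \<Rightarrow> bool" where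
  "left_module A E \<longleftrightarrow>
     0 \<in> mcar E \<and> (\<forall>x\<in>mcar E. \<forall>y\<in>mcar E. x + y \<in> mcar E) \<and>
     (\<forall>c. \<forall>x\<in>mcar E. c *\<^sub>C x \<in> mcar E) \<and>
     (\<forall>a\<in>A. \<forall>x\<in>mcar E. lact E a x \<in> mcar E) \<and>
     (\<forall>a\<in>A. \<forall>x\<in>mcar E. \<forall>y\<in>mcar E. lact E a (x + y) = lact E a x + lact E a y) \<and>
     (\<forall>a\<in>A. \<forall>b\<in>A. \<forall>x\<in>mcar E. lact E (a + b) x = lact E a x + lact E b x) \<and>
     (\<forall>c. \<forall>a\<in>A. \<forall>x\<in>mcar E. lact E (c *\<^sub>C a) x = c *\<^sub>C lact E a x \<and>
        lact E a (c *\<^sub>C x) = c *\<^sub>C lact E a x) \<and>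
     (\<forall>a\<in>A. \<forall>b\<in>A. \<forall>x\<in>mcar E. lact E (a o\<^sub>L b) x = lact E a (lact E b x)) \<and>
     (\<forall>x\<in>mcar E. lact E id_blinfun x = x)"

definition bimodule ::
    "'h::complex_hilbert op set \<Rightarrow> ('h op, 'm::complex_vector) bimodule \<Rightarrow> bool" where
  "bimodule A E \<longleftrightarrow> left_module A E \<and>
     (\<forall>a\<in>A. \<forall>x\<in>mcar E. ract E x a \<in> mcar E) \<and>
     (\<forall>a\<in>A. \<forall>x\<in>mcar E. \<forall>y\<in>mcar E. ract E (x + y) a = ract E x a + ract E y a) \<and>
     (\<forall>a\<in>A. \<forall>b\<in>A. \<forall>x\<in>mcar E. ract E x (a + b) = ract E x a + ract E x b) \<and>
     (\<forall>c. \<forall>a\<in>A. \<forall>x\<in>mcar E. ract E x (c *\<^sub>C a) = c *\<^sub>C ract E x a \<and>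
        ract E (c *\<^sub>C x) a = c *\<^sub>C ract E x a) \<and>
     (\<forall>a\<in>A. \<forall>b\<in>A. \<forall>x\<in>mcar E. ract E x (a o\<^sub>L b) = ract E (ract E x a) b) \<and>
     (\<forall>x\<in>mcar E. ract E x id_blinfun = x) \<and>
     (\<forall>a\<in>A. \<forall>b\<in>A. \<forall>x\<in>mcar E. ract E (lact E a x) b = lact E a (ract E x b))"

definition left_module_map ::
    "'h::complex_hilbert op set \<Rightarrow> ('h op, 'm::complex_vector, 'x) lmodule_scheme \<Rightarrow>
     ('h op, 'p::complex_vector, 'y) lmodule_scheme \<Rightarrow> ('m \<Rightarrow> 'p) \<Rightarrow> bool" where
  "left_module_map A E F \<phi> \<longleftrightarrow> \<phi> \<in> mcar E \<rightarrow> mcar F \<and>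
     (\<forall>x\<in>mcar E. \<forall>y\<in>mcar E. \<phi> (x + y) = \<phi> x + \<phi> y) \<and>
     (\<forall>c. \<forall>x\<in>mcar E. \<phi> (c *\<^sub>C x) = c *\<^sub>C \<phi> x) \<and>
     (\<forall>a\<in>A. \<forall>x\<in>mcar E. \<phi> (lact E a x) = lact F a (\<phi> x))"

definition bimodule_map ::
    "'h::complex_hilbert op set \<Rightarrow> ('h op, 'm::complex_vector) bimodule \<Rightarrow>
     ('h op, 'p::complex_vector) bimodule \<Rightarrow> ('m \<Rightarrow> 'p) \<Rightarrow> bool" where
  "bimodule_map A E F \<phi> \<longleftrightarrow> left_module_map A E F \<phi> \<and>
     (\<forall>a\<in>A. \<forall>x\<in>mcar E. \<phi> (ract E x a) = ract F (\<phi> x) a)"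

definition alg_bimodule :: "'h::complex_hilbert op set \<Rightarrow> ('h op, 'h op) bimodule" where
  "alg_bimodule A = \<lparr>mcar = A, lact = (o\<^sub>L), ract = (o\<^sub>L)\<rparr>"

definition free_lmodule :: "'h::complex_hilbert op set \<Rightarrow> nat \<Rightarrow> ('h op, nat \<Rightarrow> 'h op) lmodule" where
  "free_lmodule A m = \<lparr>mcar = {x. (\<forall>i<m. x i \<in> A) \<and> (\<forall>i\<ge>m. x i = 0)},
     lact = (\<lambda>a x i. a o\<^sub>L x i)\<rparr>"

definition hilb_lmodule :: "('h::complex_hilbert op, 'h) lmodule" where
  "hilb_lmodule = \<lparr>mcar = UNIV, lact = blinfun_apply\<rparr>"

text \<open>Finitely generated projective: a direct summand (retract) of some \<open>A\<^sup>m\<close>.\<close>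

definition fg_projective ::
    "'h::complex_hilbert op set \<Rightarrow> ('h op, 'm::complex_vector, 'x) lmodule_scheme \<Rightarrow> bool" where
  "fg_projective A E \<longleftrightarrow> (\<exists>m s p. left_module_map A E (free_lmodule A m) s \<and>
     left_module_map A (free_lmodule A m) E p \<and> (\<forall>x\<in>mcar E. p (s x) = x))"

text \<open>From here on \<open>L\<close> is a bimodule whose underlying set is a whole type, so that left module
  maps \<open>L \<rightarrow> A\<close> are honest functions.\<close>

definition dual_bimodule ::
    "'h::complex_hilbert op set \<Rightarrow> ('h op, 'l::complex_vector) bimodule \<Rightarrow>
     ('h op, 'l \<Rightarrow> 'h op) bimodule" where
  "dual_bimodule A L = \<lparr>mcar = {\<alpha>. left_module_map A L (alg_bimodule A) \<alpha>},
     lact = (\<lambda>a \<alpha> e. \<alpha> (ract L e a)), ract = (\<lambda>\<alpha> a e. \<alpha> e o\<^sub>L a)\<rparr>"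

definition conj_bimodule ::
    "('h::complex_hilbert op, 'l::complex_vector) bimodule \<Rightarrow> ('h op, 'l conj) bimodule" where
  "conj_bimodule L = \<lparr>mcar = Conj ` mcar L,
     lact = (\<lambda>a x. Conj (ract L (unConj x) (adj a))),
     ract = (\<lambda>x a. Conj (lact L (adj a) (unConj x)))\<rparr>"

definition dual_basis ::
    "'h::complex_hilbert op set \<Rightarrow> ('h op, 'l::complex_vector) bimodule \<Rightarrow>
     nat \<Rightarrow> (nat \<Rightarrow> 'l) \<Rightarrow> (nat \<Rightarrow> 'l \<Rightarrow> 'h op) \<Rightarrow> bool" where
  "dual_basis A L n e \<epsilon> \<longleftrightarrow>
     (\<forall>i<n. e i \<in> mcar L \<and> \<epsilon> i \<in> mcar (dual_bimodule A L)) \<and>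
     (\<forall>f\<in>mcar L. f = (\<Sum>i<n. lact L (\<epsilon> i f) (e i)))"


section \<open>Tensor products over the algebra\<close>

text \<open>The tensor product \<open>E \<otimes>\<^sub>A F\<close> is the free abelian group on the pairs modulo the usual
  relations, so its elements are cosets of formal integer combinations of pairs.  Complex
  homogeneity follows from \<open>A\<close>-balancedness because \<open>A\<close> contains the scalars.\<close>

type_synonym ('e, 'f) tens = "('e \<times> 'f \<Rightarrow>\<^sub>0 int) set"

definition tensor_rel ::
    "'s set \<Rightarrow> ('s, 'e::plus) bimodule \<Rightarrow> ('s, 'f::plus, 'y) lmodule_scheme \<Rightarrow>
     ('e \<times> 'f \<Rightarrow>\<^sub>0 int) set" where
  "tensor_rel A E F =
     {frag_of (x + x', y) - frag_of (x, y) - frag_of (x', y) | x x' y.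
        x \<in> mcar E \<and> x' \<in> mcar E \<and> y \<in> mcar F} \<union>
     {frag_of (x, y + y') - frag_of (x, y) - frag_of (x, y') | x y y'.
        x \<in> mcar E \<and> y \<in> mcar F \<and> y' \<in> mcar F} \<union>
     {frag_of (ract E x a, y) - frag_of (x, lact F a y) | x a y.
        x \<in> mcar E \<and> a \<in> A \<and> y \<in> mcar F}"

definition tensor_null ::
    "'s set \<Rightarrow> ('s, 'e::plus) bimodule \<Rightarrow> ('s, 'f::plus, 'y) lmodule_scheme \<Rightarrow> ('e, 'f) tens" where
  "tensor_null A E F = generate (free_Abelian_group (mcar E \<times> mcar F)) (tensor_rel A E F)"

definition tensor_group ::
    "'s set \<Rightarrow> ('s, 'e::plus) bimodule \<Rightarrow> ('s, 'f::plus, 'y) lmodule_scheme \<Rightarrow>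
     ('e, 'f) tens monoid" where
  "tensor_group A E F = free_Abelian_group (mcar E \<times> mcar F) Mod tensor_null A E F"

text \<open>\<open>tensor_sum A E F n x y\<close> is \<open>\<Sum>i<n. x i \<otimes> y i\<close>.\<close>

definition tensor_sum ::
    "'s set \<Rightarrow> ('s, 'e::plus) bimodule \<Rightarrow> ('s, 'f::plus, 'y) lmodule_scheme \<Rightarrow>
     nat \<Rightarrow> (nat \<Rightarrow> 'e) \<Rightarrow> (nat \<Rightarrow> 'f) \<Rightarrow> ('e, 'f) tens" where
  "tensor_sum A E F n x y = tensor_null A E F
     #>\<^bsub>free_Abelian_group (mcar E \<times> mcar F)\<^esub> (\<Sum>i<n. frag_of (x i, y i))"

definition tensor_elem ::
    "'s set \<Rightarrow> ('s, 'e::plus) bimodule \<Rightarrow> ('s, 'f::plus, 'y) lmodule_scheme \<Rightarrow>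
     'e \<Rightarrow> 'f \<Rightarrow> ('e, 'f) tens" where
  "tensor_elem A E F x y = tensor_null A E F
     #>\<^bsub>free_Abelian_group (mcar E \<times> mcar F)\<^esub> frag_of (x, y)"

text \<open>\<open>frag_lift f\<close> is the additive extension of \<open>f\<close> to formal integer combinations, and
  \<open>tensor_lift f\<close> the map it induces on a tensor product when \<open>f\<close> is biadditive and balanced
  (all representatives of a coset then have the same image).\<close>

definition frag_lift :: "('p \<Rightarrow> 'v::real_vector) \<Rightarrow> ('p \<Rightarrow>\<^sub>0 int) \<Rightarrow> 'v" where
  "frag_lift f t = (\<Sum>p\<in>Poly_Mapping.keys t. real_of_int (Poly_Mapping.lookup t p) *\<^sub>R f p)"

definition tensor_lift :: "('e \<Rightarrow> 'f \<Rightarrow> 'v::real_vector) \<Rightarrow> ('e, 'f) tens \<Rightarrow> 'v" where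
  "tensor_lift f X = the_elem (frag_lift (\<lambda>(x, y). f x y) ` X)"

text \<open>\<open>tensor_map A E' F' \<phi> \<psi>\<close> is \<open>\<phi> \<otimes> \<psi>\<close> with target \<open>E' \<otimes>\<^sub>A F'\<close>: the coset of the images of the
  representatives.\<close>

definition tensor_map ::
    "'s set \<Rightarrow> ('s, 'e2::plus) bimodule \<Rightarrow> ('s, 'f2::plus, 'y) lmodule_scheme \<Rightarrow>
     ('e \<Rightarrow> 'e2) \<Rightarrow> ('f \<Rightarrow> 'f2) \<Rightarrow> ('e, 'f) tens \<Rightarrow> ('e2, 'f2) tens" where
  "tensor_map A E' F' \<phi> \<psi> X = tensor_null A E' F'
     <#>\<^bsub>free_Abelian_group (mcar E' \<times> mcar F')\<^esub>
       frag_extend (\<lambda>(x, y). frag_of (\<phi> x, \<psi> y)) ` X"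


section \<open>Line modules, star operations and Hermitian metrics\<close>

definition ev :: "('l, 'l \<Rightarrow> 'h::complex_hilbert op) tens \<Rightarrow> 'h op" where
  "ev = tensor_lift (\<lambda>e \<alpha>. \<alpha> e)"

text \<open>\<open>coev\<close> is the bimodule map with \<open>coev 1 = \<Sum>i<n. \<epsilon> i \<otimes> e i\<close>; it does not depend on the
  choice of the dual basis.\<close>

definition coev ::
    "'h::complex_hilbert op set \<Rightarrow> ('h op, 'l::complex_vector) bimodule \<Rightarrow>
     nat \<Rightarrow> (nat \<Rightarrow> 'l) \<Rightarrow> (nat \<Rightarrow> 'l \<Rightarrow> 'h op) \<Rightarrow> 'h op \<Rightarrow> ('l \<Rightarrow> 'h op, 'l) tens" where
  "coev A L n e \<epsilon> a =
     tensor_sum A (dual_bimodule A L) L n (\<lambda>i. lact (dual_bimodule A L) a (\<epsilon> i)) e"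

text \<open>\<open>(n, e, \<epsilon>)\<close> is the dual basis used to write \<open>coev\<close>.  Both \<open>ev\<close> and \<open>coev\<close> are bimodule maps,
  so they are isomorphisms when bijective.\<close>

definition left_line_module ::
    "'h::complex_hilbert op set \<Rightarrow> ('h op, 'l::complex_vector) bimodule \<Rightarrow>
     nat \<Rightarrow> (nat \<Rightarrow> 'l) \<Rightarrow> (nat \<Rightarrow> 'l \<Rightarrow> 'h op) \<Rightarrow> bool" where
  "left_line_module A L n e \<epsilon> \<longleftrightarrow> bimodule A L \<and> fg_projective A L \<and> dual_basis A L n e \<epsilon> \<and>
     bij_betw ev (carrier (tensor_group A L (dual_bimodule A L))) A \<and>
     bij_betw (coev A L n e \<epsilon>) A (carrier (tensor_group A (dual_bimodule A L) L))"

definition star_operation ::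
    "'h::complex_hilbert op set \<Rightarrow> ('h op, 'l::complex_vector) bimodule \<Rightarrow> ('l \<Rightarrow> 'l) \<Rightarrow> bool" where
  "star_operation A L st \<longleftrightarrow>
     bimodule_map A L (conj_bimodule L) (\<lambda>e. Conj (st e)) \<and> (\<forall>e. st (st e) = e)"

definition hip ::
    "'h::complex_hilbert op set \<Rightarrow> ('h op, 'l::complex_vector) bimodule \<Rightarrow>
     ('l conj \<Rightarrow> 'l \<Rightarrow> 'h op) \<Rightarrow> 'l \<Rightarrow> 'l conj \<Rightarrow> 'h op" where
  "hip A L G e f = ev (tensor_elem A L (dual_bimodule A L) e (G f))"

definition hermitian_metric ::
    "'h::complex_hilbert op set \<Rightarrow> ('h op, 'l::complex_vector) bimodule \<Rightarrow>
     ('l conj \<Rightarrow> 'l \<Rightarrow> 'h op) \<Rightarrow> bool" where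
  "hermitian_metric A L G \<longleftrightarrow>
     bimodule_map A (conj_bimodule L) (dual_bimodule A L) G \<and>
     bij_betw G (mcar (conj_bimodule L)) (mcar (dual_bimodule A L)) \<and>
     (\<forall>e f. hip A L G e (Conj f) = adj (hip A L G f (Conj e)))"

definition metric_star :: "('l conj \<Rightarrow> 'l \<Rightarrow> 'h::complex_hilbert op) \<Rightarrow> ('l \<Rightarrow> 'l) \<Rightarrow> 'l \<Rightarrow> 'l \<Rightarrow> 'h op"
  where "metric_star G st e = G (Conj (st e))"

definition star_compatible ::
    "'h::complex_hilbert op set \<Rightarrow> ('h op, 'l::complex_vector) bimodule \<Rightarrow>
     nat \<Rightarrow> (nat \<Rightarrow> 'l) \<Rightarrow> (nat \<Rightarrow> 'l \<Rightarrow> 'h op) \<Rightarrow> ('l \<Rightarrow> 'l) \<Rightarrow> ('l conj \<Rightarrow> 'l \<Rightarrow> 'h op) \<Rightarrow> bool" where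
  "star_compatible A L n e \<epsilon> st G \<longleftrightarrow>
     ev (tensor_map A L (dual_bimodule A L) (inv_into UNIV (metric_star G st)) (metric_star G st)
       (coev A L n e \<epsilon> id_blinfun)) = id_blinfun"

definition hilbert_cstar_module ::
    "'h::complex_hilbert op set \<Rightarrow> ('h op, 'l::complex_vector) bimodule \<Rightarrow>
     ('l conj \<Rightarrow> 'l \<Rightarrow> 'h op) \<Rightarrow> bool" where
  "hilbert_cstar_module A L G \<longleftrightarrow>
     (\<forall>e. positive_in A (hip A L G e (Conj e))) \<and>
     (\<forall>e. hip A L G e (Conj e) = 0 \<longrightarrow> e = 0) \<and>
     Metric_space.mcomplete UNIV
       (\<lambda>e f. sqrt (norm (hip A L G (e - f) (Conj (e - f)))))"


section \<open>Function spaces\<close>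

definition compact_support :: "(real \<Rightarrow> 'v::real_normed_vector) \<Rightarrow> bool" where
  "compact_support f \<longleftrightarrow> compact (closure {x. f x \<noteq> 0})"

definition Cc :: "'v::real_normed_vector set \<Rightarrow> (real \<Rightarrow> 'v) set" where
  "Cc X = {f. continuous_on UNIV f \<and> range f \<subseteq> X \<and> compact_support f}"

definition C0 :: "'v::real_normed_vector set \<Rightarrow> (real \<Rightarrow> 'v) set" where
  "C0 X = {f. continuous_on UNIV f \<and> range f \<subseteq> X \<and> (f \<longlongrightarrow> 0) at_infinity}"

text \<open>A continuous function on the one point compactification is represented by its (determining)
  restriction to the real line.\<close>

definition C_inf :: "'v::real_normed_vector set \<Rightarrow> (real \<Rightarrow> 'v) set" where
  "C_inf X = {f. \<exists>F. continuous_map (Alexandroff_compactification euclideanreal) (top_of_set X) F \<and>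
     f = (\<lambda>x. F (Some x))}"


section \<open>The Hilbert space\<close>

type_synonym ('h, 'l) vec = "(real \<Rightarrow> 'h) \<times> (real \<Rightarrow> ('l conj, 'h) tens)"

definition H1 ::
    "'h::complex_hilbert op set \<Rightarrow> ('h op, 'l::complex_vector) bimodule \<Rightarrow>
     nat \<Rightarrow> (nat \<Rightarrow> 'l) \<Rightarrow> (real \<Rightarrow> ('l conj, 'h) tens) set" where
  "H1 A L n e = {(\<lambda>x. tensor_sum A (conj_bimodule L) hilb_lmodule n (\<lambda>i. Conj (e i)) (\<lambda>i. k i x)) | k.
     \<forall>i<n. k i \<in> Cc UNIV}"

definition H01 ::
    "'h::complex_hilbert op set \<Rightarrow> ('h op, 'l::complex_vector) bimodule \<Rightarrow>
     nat \<Rightarrow> (nat \<Rightarrow> 'l) \<Rightarrow> ('h, 'l) vec set" where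
  "H01 A L n e = C_inf UNIV \<times> H1 A L n e"

definition vec_zero ::
    "'h::complex_hilbert op set \<Rightarrow> ('h op, 'l::complex_vector) bimodule \<Rightarrow> ('h, 'l) vec" where
  "vec_zero A L = (\<lambda>x. 0, \<lambda>x. \<one>\<^bsub>tensor_group A (conj_bimodule L) hilb_lmodule\<^esub>)"

definition vec_add ::
    "'h::complex_hilbert op set \<Rightarrow> ('h op, 'l::complex_vector) bimodule \<Rightarrow>
     ('h, 'l) vec \<Rightarrow> ('h, 'l) vec \<Rightarrow> ('h, 'l) vec" where
  "vec_add A L v w = (\<lambda>x. fst v x + fst w x,
     \<lambda>x. snd v x \<otimes>\<^bsub>tensor_group A (conj_bimodule L) hilb_lmodule\<^esub> snd w x)"

definition vec_scale ::
    "'h::complex_hilbert op set \<Rightarrow> ('h op, 'l::complex_vector) bimodule \<Rightarrow>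
     complex \<Rightarrow> ('h, 'l) vec \<Rightarrow> ('h, 'l) vec" where
  "vec_scale A L c v = (\<lambda>x. c *\<^sub>C fst v x,
     \<lambda>x. tensor_map A (conj_bimodule L) hilb_lmodule id (scaleC c) (snd v x))"

definition inner_tens ::
    "'h::complex_hilbert op set \<Rightarrow> ('h op, 'l::complex_vector) bimodule \<Rightarrow>
     ('l conj \<Rightarrow> 'l \<Rightarrow> 'h op) \<Rightarrow> ('l conj, 'h) tens \<Rightarrow> ('l conj, 'h) tens \<Rightarrow> complex" where
  "inner_tens A L G X Y =
     tensor_lift (\<lambda>e u. tensor_lift (\<lambda>e' u'. cinner u (blinfun_apply (hip A L G (unConj e) e') u')) Y) X"

definition inner01 ::
    "'h::complex_hilbert op set \<Rightarrow> ('h op, 'l::complex_vector) bimodule \<Rightarrow>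
     ('l conj \<Rightarrow> 'l \<Rightarrow> 'h op) \<Rightarrow> ('h, 'l) vec \<Rightarrow> ('h, 'l) vec \<Rightarrow> complex" where
  "inner01 A L G v w = (LINT x|lborel.
     (cinner (fst v x) (fst w x) + complex_of_real (x\<^sup>2) * inner_tens A L G (snd v x) (snd w x))
       / complex_of_real (1 + x\<^sup>2))"

text \<open>The form on \<open>H01\<close> is an inner product, so that it has a Hilbert space completion.\<close>

definition pre_hilbert_H01 ::
    "'h::complex_hilbert op set \<Rightarrow> ('h op, 'l::complex_vector) bimodule \<Rightarrow>
     ('l conj \<Rightarrow> 'l \<Rightarrow> 'h op) \<Rightarrow> nat \<Rightarrow> (nat \<Rightarrow> 'l) \<Rightarrow> bool" where
  "pre_hilbert_H01 A L G n e \<longleftrightarrow> (let V = H01 A L n e; ip = inner01 A L G in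
     vec_zero A L \<in> V \<and> (\<forall>v\<in>V. \<forall>w\<in>V. vec_add A L v w \<in> V) \<and>
     (\<forall>c. \<forall>v\<in>V. vec_scale A L c v \<in> V) \<and>
     (\<forall>v\<in>V. \<forall>w\<in>V. ip v w = cnj (ip w v)) \<and>
     (\<forall>u\<in>V. \<forall>v\<in>V. \<forall>w\<in>V. ip u (vec_add A L v w) = ip u v + ip u w) \<and>
     (\<forall>c. \<forall>v\<in>V. \<forall>w\<in>V. ip v (vec_scale A L c w) = c * ip v w) \<and>
     (\<forall>v\<in>V. v \<noteq> vec_zero A L \<longrightarrow> Re (ip v v) > 0))"

text \<open>\<open>(UNIV :: 'k set, \<iota>)\<close> is the Hilbert space completion: \<open>\<iota>\<close> is a linear isometry of \<open>H01\<close> onto a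
  dense subspace of the Hilbert space \<open>'k\<close>.\<close>

definition is_completion ::
    "'h::complex_hilbert op set \<Rightarrow> ('h op, 'l::complex_vector) bimodule \<Rightarrow>
     ('l conj \<Rightarrow> 'l \<Rightarrow> 'h op) \<Rightarrow> nat \<Rightarrow> (nat \<Rightarrow> 'l) \<Rightarrow> (('h, 'l) vec \<Rightarrow> 'k::complex_hilbert) \<Rightarrow> bool"
  where
  "is_completion A L G n e \<iota> \<longleftrightarrow> (let V = H01 A L n e in
     (\<forall>v\<in>V. \<forall>w\<in>V. \<iota> (vec_add A L v w) = \<iota> v + \<iota> w) \<and>
     (\<forall>c. \<forall>v\<in>V. \<iota> (vec_scale A L c v) = c *\<^sub>C \<iota> v) \<and>
     (\<forall>v\<in>V. \<forall>w\<in>V. cinner (\<iota> v) (\<iota> w) = inner01 A L G v w) \<and>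
     closure (\<iota> ` V) = UNIV)"


section \<open>The algebra of pairs and its action\<close>

type_synonym ('h, 'l) fpair = "(real \<Rightarrow> 'h op) \<times> (real \<Rightarrow> 'l)"

definition fpairs ::
    "'h::complex_hilbert op set \<Rightarrow> ('h op, 'l::complex_vector) bimodule \<Rightarrow>
     nat \<Rightarrow> (nat \<Rightarrow> 'l) \<Rightarrow> (real \<Rightarrow> 'h op) set \<Rightarrow> ('h, 'l) fpair set" where
  "fpairs A L n e F0 = F0 \<times> {(\<lambda>x. \<Sum>i<n. lact L (c i x) (e i)) | c. \<forall>i<n. c i \<in> Cc A}"

definition C0_plus_scalars :: "'h::complex_hilbert op set \<Rightarrow> (real \<Rightarrow> 'h op) set" where
  "C0_plus_scalars A = {(\<lambda>x. f x + c *\<^sub>C id_blinfun) | f c. f \<in> C0 A}"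

definition fpair_add :: "('h::complex_hilbert, 'l::complex_vector) fpair \<Rightarrow> ('h, 'l) fpair \<Rightarrow> ('h, 'l) fpair"
  where "fpair_add f g = (\<lambda>x. fst f x + fst g x, \<lambda>x. snd f x + snd g x)"

definition fpair_scale :: "complex \<Rightarrow> ('h::complex_hilbert, 'l::complex_vector) fpair \<Rightarrow> ('h, 'l) fpair"
  where "fpair_scale c f = (\<lambda>x. c *\<^sub>C fst f x, \<lambda>x. c *\<^sub>C snd f x)"

definition fpair_mult ::
    "'h::complex_hilbert op set \<Rightarrow> ('h op, 'l::complex_vector) bimodule \<Rightarrow> ('l \<Rightarrow> 'l) \<Rightarrow>
     ('l conj \<Rightarrow> 'l \<Rightarrow> 'h op) \<Rightarrow> ('h, 'l) fpair \<Rightarrow> ('h, 'l) fpair \<Rightarrow> ('h, 'l) fpair" where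
  "fpair_mult A L st G f g =
     (\<lambda>x. (fst f x o\<^sub>L fst g x) + x\<^sup>2 *\<^sub>R hip A L G (snd f x) (Conj (st (snd g x))),
      \<lambda>x. lact L (fst f x) (snd g x) + ract L (snd f x) (fst g x))"

definition fpair_star ::
    "('l \<Rightarrow> 'l) \<Rightarrow> ('h::complex_hilbert, 'l::complex_vector) fpair \<Rightarrow> ('h, 'l) fpair" where
  "fpair_star st f = (\<lambda>x. adj (fst f x), \<lambda>x. st (snd f x))"

definition fpair_act ::
    "'h::complex_hilbert op set \<Rightarrow> ('h op, 'l::complex_vector) bimodule \<Rightarrow> ('l \<Rightarrow> 'l) \<Rightarrow>
     ('l conj \<Rightarrow> 'l \<Rightarrow> 'h op) \<Rightarrow> ('h, 'l) fpair \<Rightarrow> ('h, 'l) vec \<Rightarrow> ('h, 'l) vec" where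
  "fpair_act A L st G f v =
     (\<lambda>x. blinfun_apply (fst f x) (fst v x) +
          x\<^sup>2 *\<^sub>R tensor_lift (\<lambda>e u. blinfun_apply (hip A L G (snd f x) e) u) (snd v x),
      \<lambda>x. tensor_elem A (conj_bimodule L) hilb_lmodule (Conj (st (snd f x))) (fst v x)
          \<otimes>\<^bsub>tensor_group A (conj_bimodule L) hilb_lmodule\<^esub>
          tensor_map A (conj_bimodule L) hilb_lmodule
            (\<lambda>e. Conj (ract L (unConj e) (adj (fst f x)))) id (snd v x))"

text \<open>\<open>T\<close> is the extension by continuity to the completion of the action of the pair \<open>f\<close>.\<close>

definition extends_act ::
    "'h::complex_hilbert op set \<Rightarrow> ('h op, 'l::complex_vector) bimodule \<Rightarrow> ('l \<Rightarrow> 'l) \<Rightarrow>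
     ('l conj \<Rightarrow> 'l \<Rightarrow> 'h op) \<Rightarrow> nat \<Rightarrow> (nat \<Rightarrow> 'l) \<Rightarrow> (('h, 'l) vec \<Rightarrow> 'k::complex_hilbert) \<Rightarrow>
     ('h, 'l) fpair \<Rightarrow> 'k op \<Rightarrow> bool" where
  "extends_act A L st G n e \<iota> f T \<longleftrightarrow> clinear_op T \<and>
     (\<forall>v\<in>H01 A L n e. blinfun_apply T (\<iota> v) = \<iota> (fpair_act A L st G f v))"

definition rep ::
    "'h::complex_hilbert op set \<Rightarrow> ('h op, 'l::complex_vector) bimodule \<Rightarrow> ('l \<Rightarrow> 'l) \<Rightarrow>
     ('l conj \<Rightarrow> 'l \<Rightarrow> 'h op) \<Rightarrow> nat \<Rightarrow> (nat \<Rightarrow> 'l) \<Rightarrow> (('h, 'l) vec \<Rightarrow> 'k::complex_hilbert) \<Rightarrow>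
     ('h, 'l) fpair \<Rightarrow> 'k op" where
  "rep A L st G n e \<iota> f = (THE T. extends_act A L st G n e \<iota> f T)"

text \<open>The pairs in \<open>P\<close> form a *-algebra acting on the completion by bounded operators.\<close>

definition acts_by_bounded ::
    "'h::complex_hilbert op set \<Rightarrow> ('h op, 'l::complex_vector) bimodule \<Rightarrow> ('l \<Rightarrow> 'l) \<Rightarrow>
     ('l conj \<Rightarrow> 'l \<Rightarrow> 'h op) \<Rightarrow> nat \<Rightarrow> (nat \<Rightarrow> 'l) \<Rightarrow> (('h, 'l) vec \<Rightarrow> 'k::complex_hilbert) \<Rightarrow>
     ('h, 'l) fpair set \<Rightarrow> bool" where
  "acts_by_bounded A L st G n e \<iota> P \<longleftrightarrow>
     (\<forall>f\<in>P. \<forall>v\<in>H01 A L n e. fpair_act A L st G f v \<in> H01 A L n e) \<and>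
     (\<forall>f\<in>P. \<exists>!T. extends_act A L st G n e \<iota> f T) \<and>
     (let \<pi> = rep A L st G n e \<iota> in
       (\<forall>f\<in>P. \<forall>g\<in>P. fpair_add f g \<in> P \<and> \<pi> (fpair_add f g) = \<pi> f + \<pi> g) \<and>
       (\<forall>c. \<forall>f\<in>P. fpair_scale c f \<in> P \<and> \<pi> (fpair_scale c f) = c *\<^sub>C \<pi> f) \<and>
       (\<forall>f\<in>P. \<forall>g\<in>P. fpair_mult A L st G f g \<in> P \<and>
          \<pi> (fpair_mult A L st G f g) = \<pi> f o\<^sub>L \<pi> g) \<and>
       (\<forall>f\<in>P. fpair_star st f \<in> P \<and> is_adjoint (\<pi> (fpair_star st f)) (\<pi> f)))"

definition cstar_completion ::
    "'h::complex_hilbert op set \<Rightarrow> ('h op, 'l::complex_vector) bimodule \<Rightarrow> ('l \<Rightarrow> 'l) \<Rightarrow>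
     ('l conj \<Rightarrow> 'l \<Rightarrow> 'h op) \<Rightarrow> nat \<Rightarrow> (nat \<Rightarrow> 'l) \<Rightarrow> (('h, 'l) vec \<Rightarrow> 'k::complex_hilbert) \<Rightarrow>
     ('h, 'l) fpair set \<Rightarrow> 'k op set" where
  "cstar_completion A L st G n e \<iota> P = closure (rep A L st G n e \<iota> ` P)"

end

theory Submission
  imports Defs "HOL-Probability.Sinc_Integral"
begin

text \<open>The dual basis gives coordinates: every element \<open>X\<close> of \<open>conj L \<otimes> H\<close> is
  \<open>\<Sum>i. conj (e i) \<otimes> \<kappa> i X\<close>, so that vectors become tuples of \<open>H\<close>-valued functions and every
  operation is given by matrices over \<open>A\<close>.  The square root \<open>r\<close> of the Gram matrix turns the inner
  product on \<open>conj L \<otimes> H\<close> into a sum of squared norms, and invertibility of the metric recovers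
  the coordinates from these, which gives definiteness and a norm equivalent to the coordinate
  norm.  The constant \<open>M\<close> makes the coordinates of \<open>x.a\<close> continuous in \<open>a\<close>, so a pair preserves
  the dense subspace and acts on it by a bounded operator; the compact support of the \<open>L\<close>-part
  absorbs the weight \<open>x\<^sup>2\<close>.  Multiplicativity comes down to \<open>\<langle>x, y\<rangle>.z = x.\<langle>y*, z*\<rangle>\<close>, which is what
  star compatibility and injectivity of the evaluation give.  The norm closure of a *-algebra of
  bounded operators is a C*-algebra, adding a line to a closed subspace keeps it closed, and a unit
  of the closure in case (a) would fix vectors supported arbitrarily far out, where every generator
  is almost zero.\<close>

section \<open>Complex Hilbert spaces and operator algebras\<close>

text \<open>The e^i form a dual basis, not a free one, so neither the functions k_i in the
  definition of H_1 nor the coefficients of a pair are determined by the element they describe, and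
  the Gram matrix may be singular. The maps \<open>\<kappa> i\<close> single out canonical
  coordinates, those fixed by the idempotent matrix with entries
  \<open>adj (\<epsilon> i (e j))\<close>. To return from inner products to coordinates, each
  \<open>\<epsilon> i\<close> is represented by a vector through G; no inverse of the Gram matrix is
  formed. L carries no topology: continuity of an L-valued function means continuity of its
  coordinates, and star and right action are controlled through the maps taking a to
  \<open>\<epsilon> i (ra x a)\<close>, which is the place of M. All algebra and all estimates are
  done in a single fibre. In the fibre norm |v_0| + |x| |v_1| the off-diagonal entries of a pair
  have size |x| |f_1| in both directions, so compact support bounds them although the action
  contains x^2. Integration then only transports fibrewise identities and inequalities to the
  completion.\<close>

lemma scaleC_zero_right [simp]: "c *\<^sub>C (0::'a::complex_vector) = 0"
  using scaleC_add_right[of c 0 "0::'a"] by simp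

lemma scaleC_zero_left [simp]: "0 *\<^sub>C (x::'a::complex_vector) = 0"
  using scaleC_add_left[of 0 0 x] by simp

lemma scaleC_minus_right: "c *\<^sub>C (- x::'a::complex_vector) = - (c *\<^sub>C x)"
  using scaleC_add_right[of c x "- x"] by (simp add: eq_neg_iff_add_eq_0 add.commute)

lemma scaleC_minus_left: "(- c) *\<^sub>C (x::'a::complex_vector) = - (c *\<^sub>C x)"
  using scaleC_add_left[of c "- c" x] by (simp add: eq_neg_iff_add_eq_0 add.commute)

lemma scaleC_diff_right: "c *\<^sub>C (x - y::'a::complex_vector) = c *\<^sub>C x - c *\<^sub>C y"
  using scaleC_add_right[of c x "- y"] by (simp add: scaleC_minus_right)

lemma scaleC_diff_left: "(c - d) *\<^sub>C (x::'a::complex_vector) = c *\<^sub>C x - d *\<^sub>C x"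
  using scaleC_add_left[of c "- d" x] by (simp add: scaleC_minus_left)

lemma scaleC_sum_right: "c *\<^sub>C (\<Sum>i\<in>I. f i :: 'a::complex_vector) = (\<Sum>i\<in>I. c *\<^sub>C f i)"
  by (induction I rule: infinite_finite_induct) (auto simp: scaleC_add_right)

lemma scaleC_scaleR: "c *\<^sub>C (s *\<^sub>R x::'a::complex_vector) = s *\<^sub>R (c *\<^sub>C x)"
  by (simp add: scaleR_scaleC scaleC_scaleC mult.commute)

lemma bounded_linear_scaleC: "bounded_linear (\<lambda>y::'b::complex_normed_vector. c *\<^sub>C y)"
  by (rule bounded_linear_intro[where K = "cmod c"])
    (simp_all add: scaleC_add_right scaleR_scaleC scaleC_scaleC norm_scaleC mult.commute)

lemma bounded_bilinear_scaleC:
  "bounded_bilinear (\<lambda>c (y::'b::complex_normed_vector). c *\<^sub>C y)"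
  by (rule bounded_bilinear.intro)
    (auto simp: scaleC_add_right scaleC_add_left scaleR_scaleC scaleC_scaleC norm_scaleC
      scaleR_conv_of_real mult.commute intro!: exI[of _ 1])

instance complex_hilbert \<subseteq> banach ..

instance blinfun :: (real_normed_vector, complex_normed_vector) complex_normed_vector
proof
  fix c :: complex and T :: "'a \<Rightarrow>\<^sub>L 'b"
  have le: "norm (c *\<^sub>C T) \<le> cmod c * norm T" for c and T :: "'a \<Rightarrow>\<^sub>L 'b"
    by (rule norm_blinfun_bound)
      (auto simp: scaleC_blinfun.rep_eq norm_scaleC mult.assoc intro!: mult_left_mono norm_blinfun)
  show "norm (c *\<^sub>C T) = cmod c * norm T"
  proof (cases "c = 0")
    case False
    have "cmod c * norm T = cmod c * norm (inverse c *\<^sub>C c *\<^sub>C T)"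
      using False by (simp add: scaleC_scaleC scaleC_one)
    also have "\<dots> \<le> cmod c * (cmod (inverse c) * norm (c *\<^sub>C T))"
      by (intro mult_left_mono le) auto
    also have "\<dots> = norm (c *\<^sub>C T)"
      using False by (simp add: norm_inverse)
    finally show ?thesis using le[of c T] by simp
  qed simp
qed

lemmas blinfun_apply_scaleC [simp] = scaleC_blinfun.rep_eq

section \<open>Sesquilinear calculus and the Cauchy-Schwarz inequality\<close>

context
  fixes x y z :: "'a::complex_hilbert"
begin

lemma cinner_add_left: "cinner (x + y) z = cinner x z + cinner y z"
  by (metis cinner_add_right cinner_commute complex_cnj_add)

lemma cinner_scaleC_left: "cinner (c *\<^sub>C x) y = cnj c * cinner x y"
  by (metis cinner_scaleC_right cinner_commute complex_cnj_mult)

lemma cinner_zero_right [simp]: "cinner x 0 = 0"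
  using cinner_scaleC_right[of x 0 0] by simp

lemma cinner_zero_left [simp]: "cinner 0 x = 0"
  by (metis cinner_commute cinner_zero_right complex_cnj_zero)

lemma cinner_scaleR_right: "cinner x (s *\<^sub>R y) = of_real s * cinner x y"
  by (simp add: scaleR_scaleC cinner_scaleC_right)

lemma cinner_scaleR_left: "cinner (s *\<^sub>R x) y = of_real s * cinner x y"
  by (simp add: scaleR_scaleC cinner_scaleC_left)

lemma cinner_minus_right: "cinner x (- y) = - cinner x y"
  using cinner_scaleC_right[of x "-1" y] by (simp add: scaleC_minus_left scaleC_one)

lemma cinner_minus_left: "cinner (- x) y = - cinner x y"
  using cinner_scaleC_left[of "-1" ] by (simp add: scaleC_minus_left scaleC_one)

end

context
  fixes x y z :: "'a::complex_hilbert"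
begin

lemma cinner_diff_right: "cinner x (y - z) = cinner x y - cinner x z"
  using cinner_add_right[of x y "- z"] by (simp add: cinner_minus_right)

lemma cinner_diff_left: "cinner (x - y) z = cinner x z - cinner y z"
  using cinner_add_left[of x "- y" z] by (simp add: cinner_minus_left)

end

context
  fixes x y z :: "'a::complex_hilbert"
begin

lemma cinner_self_eq_0_iff: "cinner x x = 0 \<longleftrightarrow> x = 0"
  by (simp add: cinner_self)

lemma norm_eq_sqrt_cinner: "(norm x)\<^sup>2 = Re (cinner x x)"
  by (simp add: cinner_self)

lemma complex_Cauchy_Schwarz: "cmod (cinner x y) \<le> norm x * norm y"
proof (cases "y = 0")
  case False
  \<comment> \<open>\<open>c\<close> makes \<open>x - c y\<close> orthogonal to \<open>y\<close>;
    the numerator is \<open>cinner y x\<close> because the form is linear in its second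
    argument.\<close>
  define c where "c = cinner y x / of_real ((norm y)\<^sup>2)"
  have "0 \<le> Re (cinner (x - c *\<^sub>C y) (x - c *\<^sub>C y))"
    by (simp add: cinner_self)
  also have "cinner (x - c *\<^sub>C y) (x - c *\<^sub>C y)
      = cinner x x - c * cinner x y - cnj c * (cinner y x - c * cinner y y)"
    by (simp add: cinner_diff_right cinner_diff_left cinner_scaleC_left cinner_scaleC_right
        algebra_simps)
  also have "c * cinner y y = cinner y x"
    using False by (simp add: c_def cinner_self)
  also have "c * cinner x y = of_real ((cmod (cinner x y))\<^sup>2 / (norm y)\<^sup>2)"
    unfolding c_def by (subst (1) cinner_commute)
      (simp add: complex_norm_square[unfolded of_real_power] mult.commute)
  finally have "(cmod (cinner x y))\<^sup>2 / (norm y)\<^sup>2 \<le> (norm x)\<^sup>2"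
    by (simp add: cinner_self)
  then have "(cmod (cinner x y))\<^sup>2 \<le> (norm x * norm y)\<^sup>2"
    using False by (simp add: divide_simps power_mult_distrib)
  then show ?thesis
    by (rule power2_le_imp_le) simp
qed simp

end

lemma bounded_bilinear_cinner: "bounded_bilinear (cinner :: 'a::complex_hilbert \<Rightarrow> _)"
  by (rule bounded_bilinear.intro)
    (auto simp: cinner_add_left cinner_add_right cinner_scaleR_left cinner_scaleR_right
      scaleR_conv_of_real complex_Cauchy_Schwarz intro!: exI[of _ 1])

lemmas cinner_sum_left = bounded_bilinear.sum_left[OF bounded_bilinear_cinner]
lemmas cinner_sum_right = bounded_bilinear.sum_right[OF bounded_bilinear_cinner]
lemmas continuous_on_cinner [continuous_intros] =
  bounded_bilinear.continuous_on[OF bounded_bilinear_cinner]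

lemma cinner_eqI:
  fixes x :: "'a::complex_hilbert"
  assumes "\<And>y. cinner x y = cinner x' y"
  shows "x = x'"
proof -
  have "cinner (x - x') (x - x') = 0"
    using assms[of "x - x'"] by (simp add: cinner_diff_left)
  then show ?thesis by (simp add: cinner_self_eq_0_iff)
qed

section \<open>Adjoints\<close>

lemma is_adjoint_unique: "is_adjoint S T \<Longrightarrow> is_adjoint S' T \<Longrightarrow> S = S'"
  by (metis blinfun_eqI cinner_eqI is_adjoint_def)

text \<open>\<open>adj\<close> is a definite description, meaningful only where an adjoint exists.
  The calculus is therefore done with the relation \<open>is_adjoint\<close>, and this rule turns
  its results into equations for \<open>adj\<close>.\<close>

lemma adj_eqI: "is_adjoint S T \<Longrightarrow> adj T = S"
  unfolding adj_def using is_adjoint_unique by blast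

lemma is_adjoint_sym: "is_adjoint S T \<Longrightarrow> is_adjoint T S"
  unfolding is_adjoint_def by (metis cinner_commute)

lemma is_adjoint_add: "is_adjoint S T \<Longrightarrow> is_adjoint S' T' \<Longrightarrow> is_adjoint (S + S') (T + T')"
  by (simp add: is_adjoint_def blinfun.add_left cinner_add_left cinner_add_right)

lemma is_adjoint_diff: "is_adjoint S T \<Longrightarrow> is_adjoint S' T' \<Longrightarrow> is_adjoint (S - S') (T - T')"
  by (simp add: is_adjoint_def blinfun.diff_left cinner_diff_left cinner_diff_right)

lemma is_adjoint_scaleC: "is_adjoint S T \<Longrightarrow> is_adjoint (cnj c *\<^sub>C S) (c *\<^sub>C T)"
  by (simp add: is_adjoint_def cinner_scaleC_left cinner_scaleC_right)

lemma is_adjoint_compose: "is_adjoint S T \<Longrightarrow> is_adjoint S' T' \<Longrightarrow> is_adjoint (S' o\<^sub>L S) (T o\<^sub>L T')"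
  by (simp add: is_adjoint_def)

lemma is_adjoint_zero: "is_adjoint 0 0"
  by (simp add: is_adjoint_def)

lemma is_adjoint_id: "is_adjoint id_blinfun id_blinfun"
  by (simp add: is_adjoint_def)

text \<open>From |Sx|^2 = <x, TSx>. As the relation is symmetric, this makes the adjoint isometric,
  so that adjoints of a Cauchy sequence are again Cauchy.\<close>

lemma is_adjoint_norm_le:
  assumes "is_adjoint S T"
  shows "norm S \<le> norm T"
proof (rule norm_blinfun_bound)
  fix x
  have "(norm (S x))\<^sup>2 = cmod (cinner (S x) (S x))"
    by (simp add: cinner_self norm_power)
  also have "cinner (S x) (S x) = cinner x (T (S x))"
    using assms by (simp add: is_adjoint_def)
  also have "cmod \<dots> \<le> norm x * norm (T (S x))"
    by (rule complex_Cauchy_Schwarz)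
  also have "\<dots> \<le> norm x * (norm T * norm (S x))"
    by (intro mult_left_mono norm_blinfun) auto
  finally have "norm (S x) * norm (S x) \<le> (norm T * norm x) * norm (S x)"
    by (simp add: power2_eq_square ac_simps)
  then show "norm (S x) \<le> norm T * norm x"
    by (cases "norm (S x) = 0") (auto simp: mult_le_cancel_right)
qed simp

lemma is_adjoint_norm_eq: "is_adjoint S T \<Longrightarrow> norm S = norm T"
  by (simp add: is_adjoint_norm_le is_adjoint_sym order_antisym)

lemma is_adjoint_limit:
  assumes "\<And>k. is_adjoint (S k) (T k)" "S \<longlonglongrightarrow> S'" "T \<longlonglongrightarrow> T'"
  shows "is_adjoint S' T'"
  unfolding is_adjoint_def
proof (intro allI)
  fix x y
  have "(\<lambda>k. cinner (S k x) y) \<longlonglongrightarrow> cinner (S' x) y" "(\<lambda>k. cinner x (T k y)) \<longlonglongrightarrow> cinner x (T' y)"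
    by (intro bounded_bilinear.tendsto[OF bounded_bilinear_cinner] assms(2,3)
        bounded_bilinear.tendsto[OF bounded_bilinear_blinfun_apply] tendsto_const)+
  moreover have "(\<lambda>k. cinner (S k x) y) = (\<lambda>k. cinner x (T k y))"
    using assms(1) by (simp add: is_adjoint_def)
  ultimately show "cinner (S' x) y = cinner x (T' y)"
    using LIMSEQ_unique by metis
qed

lemma clinear_op_limit:
  assumes "\<And>k. clinear_op (T k)" "T \<longlonglongrightarrow> T'"
  shows "clinear_op T'"
  unfolding clinear_op_def
proof (intro allI)
  fix c x
  have "(\<lambda>k. T k (c *\<^sub>C x)) \<longlonglongrightarrow> T' (c *\<^sub>C x)"
    by (intro bounded_bilinear.tendsto[OF bounded_bilinear_blinfun_apply] assms tendsto_const)
  moreover have "(\<lambda>k. c *\<^sub>C T k x) \<longlonglongrightarrow> c *\<^sub>C T' x"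
    by (intro bounded_linear.tendsto[OF bounded_linear_scaleC] assms tendsto_const
      bounded_bilinear.tendsto[OF bounded_bilinear_blinfun_apply])
  ultimately show "T' (c *\<^sub>C x) = c *\<^sub>C T' x"
    using assms(1) by (simp add: clinear_op_def LIMSEQ_unique)
qed

section \<open>Norm closures of operator algebras and of subspaces\<close>

lemma closure_limI: "(\<And>k. s k \<in> B) \<Longrightarrow> s \<longlonglongrightarrow> x \<Longrightarrow> x \<in> closure B"
  for x :: "'a::metric_space"
  unfolding closure_sequential by (intro exI[of _ s]) simp

lemma op_cstar_algebra_closure:
  assumes lin: "\<And>T. T \<in> B \<Longrightarrow> clinear_op T" and zero: "0 \<in> B"
    and add: "\<And>S T. S \<in> B \<Longrightarrow> T \<in> B \<Longrightarrow> S + T \<in> B"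
    and scale: "\<And>c T. T \<in> B \<Longrightarrow> c *\<^sub>C T \<in> B"
    and mult: "\<And>S T. S \<in> B \<Longrightarrow> T \<in> B \<Longrightarrow> S o\<^sub>L T \<in> B"
    and adjoint: "\<And>T. T \<in> B \<Longrightarrow> \<exists>S\<in>B. is_adjoint S T"
  shows "op_cstar_algebra (closure B)"
  unfolding op_cstar_algebra_def
proof (intro conjI ballI allI)
  fix S T c assume T: "T \<in> closure B"
  then obtain t where t: "\<And>k. t k \<in> B" "t \<longlonglongrightarrow> T"
    by (auto simp: closure_sequential)
  show "clinear_op T"
    using clinear_op_limit[of t T] t lin by blast
  show "c *\<^sub>C T \<in> closure B"
    by (rule closure_limI[OF _ bounded_linear.tendsto[OF bounded_linear_scaleC t(2)]])
      (simp add: scale t(1))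
  \<comment> \<open>Adjoints of the approximants are chosen inside \<open>B\<close>. Since taking
    adjoints preserves norms they form a Cauchy sequence, and its limit is an adjoint of
    \<open>T\<close>.\<close>
  have "\<exists>s. s \<in> B \<and> is_adjoint s (t k)" for k
    using adjoint t(1) by blast
  then obtain s where s: "\<And>k. s k \<in> B" "\<And>k. is_adjoint (s k) (t k)"
    by metis
  have "norm (s k - s l) = norm (t k - t l)" for k l
    by (intro is_adjoint_norm_eq is_adjoint_diff s)
  then have "Cauchy s"
    using LIMSEQ_imp_Cauchy[OF t(2)] by (simp add: Cauchy_def dist_norm)
  then have lim: "s \<longlonglongrightarrow> lim s"
    by (simp add: Cauchy_convergent convergent_LIMSEQ_iff[symmetric])
  show "\<exists>S\<in>closure B. is_adjoint S T"
    by (intro bexI[of _ "lim s"] is_adjoint_limit[OF s(2) lim t(2)] closure_limI[OF s(1) lim])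
  {
    assume "S \<in> closure B"
    then obtain s where s: "\<And>k. s k \<in> B" "s \<longlonglongrightarrow> S"
      by (auto simp: closure_sequential)
    show "S + T \<in> closure B"
      by (rule closure_limI[OF _ tendsto_add[OF s(2) t(2)]]) (simp add: add s(1) t(1))
    show "S o\<^sub>L T \<in> closure B"
      by (rule closure_limI[OF _ bounded_bilinear.tendsto[OF bounded_bilinear_blinfun_compose
            s(2) t(2)]]) (simp add: mult s(1) t(1))
  }
qed (use zero closure_subset in auto)

text \<open>For \<open>u\<close> outside the closure, its positive distance \<open>d\<close> to
  \<open>S\<close> controls the coefficients by |c| d \<le> |x + c u|, so a convergent sequence has
  convergent coefficients. For \<open>u\<close> inside the closure the line adds nothing. This
  yields the description of the Thom algebra as case (a) plus the scalars.\<close>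

lemma closure_add_line:
  fixes S :: "'a::complex_normed_vector set"
  assumes zero: "0 \<in> S" and add: "\<And>x y. x \<in> S \<Longrightarrow> y \<in> S \<Longrightarrow> x + y \<in> S"
    and scale: "\<And>c x. x \<in> S \<Longrightarrow> c *\<^sub>C x \<in> S"
  shows "closure {x + c *\<^sub>C u | x c. x \<in> S} = {x + c *\<^sub>C u | x c. x \<in> closure S}"
    (is "closure ?L = ?R")
proof (intro equalityI subsetI)
  fix y assume "y \<in> ?R"
  then obtain x c where y: "y = x + c *\<^sub>C u" and "x \<in> closure S"
    by blast
  then obtain s where s: "\<And>k. s k \<in> S" "s \<longlonglongrightarrow> x"
    by (auto simp: closure_sequential)
  then have "(\<lambda>k. s k + c *\<^sub>C u) \<longlonglongrightarrow> y"
    unfolding y by (intro tendsto_add tendsto_const)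
  moreover have "\<And>k. s k + c *\<^sub>C u \<in> ?L"
    using s(1) by blast
  ultimately show "y \<in> closure ?L"
    by (rule closure_limI[rotated])
next
  fix y assume "y \<in> closure ?L"
  then obtain z where z: "\<And>k. z k \<in> ?L" "z \<longlonglongrightarrow> y"
    by (auto simp: closure_sequential)
  then have "\<forall>k. \<exists>x c. x \<in> S \<and> z k = x + c *\<^sub>C u"
    by blast
  then obtain x c where xc: "\<And>k. x k \<in> S" "\<And>k. z k = x k + c k *\<^sub>C u"
    by metis
  have diff: "a \<in> S \<Longrightarrow> b \<in> S \<Longrightarrow> a - b \<in> S" for a b
    using add[of a "(-1) *\<^sub>C b"] scale[of b "-1"] by (simp add: scaleC_minus_left scaleC_one)
  show "y \<in> ?R"
  proof (cases "u \<in> closure S")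
    case True
    have "z k \<in> closure S" for k
    proof -
      obtain t where t: "\<And>j. t j \<in> S" "t \<longlonglongrightarrow> u"
        using True by (auto simp: closure_sequential)
      have "(\<lambda>j. x k + c k *\<^sub>C t j) \<longlonglongrightarrow> z k"
        unfolding xc(2) by (intro tendsto_intros bounded_linear.tendsto[OF bounded_linear_scaleC] t)
      moreover have "\<And>j. x k + c k *\<^sub>C t j \<in> S"
        using xc(1) t(1) add scale by blast
      ultimately show ?thesis
        by (rule closure_limI[rotated])
    qed
    then have "y \<in> closure S"
      using z(2) closed_sequentially[OF closed_closure] by blast
    then show ?thesis
      by (intro CollectI exI[of _ y] exI[of _ 0]) simp
  next
    case False
    then obtain d where d: "d > 0" "\<And>v. v \<in> S \<Longrightarrow> d \<le> dist v u"
      by (meson closure_approachable not_less)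
    have bound: "cmod (c k - c l) * d \<le> norm (z k - z l)" for k l
    proof (cases "c k = c l")
      case ne: False
      \<comment> \<open>Dividing out the difference of the coefficients writes
        \<open>z k - z l\<close> as a multiple of \<open>u - v\<close> with \<open>v\<close> in
        \<open>S\<close>, to which the distance bound applies.\<close>
      define v where "v = (- inverse (c k - c l)) *\<^sub>C (x k - x l)"
      have "v \<in> S" unfolding v_def by (intro scale diff xc)
      have "z k - z l = (x k - x l) + (c k - c l) *\<^sub>C u"
        by (simp add: xc(2) scaleC_diff_left)
      also have "\<dots> = (c k - c l) *\<^sub>C (u - v)"
        using ne by (simp add: v_def scaleC_diff_right scaleC_scaleC scaleC_minus_left
            scaleC_minus_right scaleC_one)
      finally have "norm (z k - z l) = cmod (c k - c l) * dist v u"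
        by (simp add: norm_scaleC dist_norm norm_minus_commute)
      then show ?thesis
        using d(2)[OF \<open>v \<in> S\<close>] by (simp add: mult_left_mono)
    qed simp
    have "Cauchy c"
    proof (rule metric_CauchyI)
      fix r :: real assume "r > 0"
      then obtain N where N: "\<And>k l. k \<ge> N \<Longrightarrow> l \<ge> N \<Longrightarrow> dist (z k) (z l) < r * d"
        using metric_CauchyD[OF LIMSEQ_imp_Cauchy[OF z(2)], of "r * d"] d(1) by auto
      show "\<exists>N. \<forall>k\<ge>N. \<forall>l\<ge>N. dist (c k) (c l) < r"
        using N bound d(1) by (intro exI[of _ N] allI impI)
          (metis dist_norm order_le_less_trans mult_less_cancel_right_pos)
    qed
    then obtain c' where c': "c \<longlonglongrightarrow> c'"
      using Cauchy_convergent convergent_def by blast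
    have "(\<lambda>k. z k - c k *\<^sub>C u) \<longlonglongrightarrow> y - c' *\<^sub>C u"
      by (intro tendsto_intros z c' bounded_bilinear.tendsto[OF bounded_bilinear_scaleC])
    moreover have "(\<lambda>k. z k - c k *\<^sub>C u) = x"
      by (simp add: xc(2))
    ultimately have "y - c' *\<^sub>C u \<in> closure S"
      using closure_limI[of x S] xc(1) by simp
    then show ?thesis
      by (intro CollectI exI[of _ "y - c' *\<^sub>C u"] exI[of _ c']) simp
  qed
qed

lemma continuous_on_scaleC: "continuous_on S (\<lambda>y::'b::complex_normed_vector. c *\<^sub>C y)"
  using bounded_linear.continuous_on[OF bounded_linear_scaleC continuous_on_id] .

lemma linear_blinfun_apply: "linear (blinfun_apply T)"
  using blinfun.bounded_linear_right bounded_linear.linear by blast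

lemma linear_cinner: "linear (cinner (u :: 'a::complex_hilbert))"
  by (rule linearI) (simp_all add: cinner_add_right cinner_scaleR_right scaleR_conv_of_real)

lemmas compose_add_left = bounded_bilinear.add_left[OF bounded_bilinear_blinfun_compose]
lemmas compose_add_right = bounded_bilinear.add_right[OF bounded_bilinear_blinfun_compose]
lemmas compose_sum_left = bounded_bilinear.sum_left[OF bounded_bilinear_blinfun_compose]

lemma blinfun_compose_assoc: "(S o\<^sub>L T) o\<^sub>L U = S o\<^sub>L (T o\<^sub>L U)"
  by (rule blinfun_eqI) simp

lemma compose_id_left [simp]: "id_blinfun o\<^sub>L T = T" and compose_id_right [simp]: "T o\<^sub>L id_blinfun = T"
  by (rule blinfun_eqI, simp)+

lemma compose_scaleC_left: "(c *\<^sub>C S) o\<^sub>L T = c *\<^sub>C (S o\<^sub>L T)"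
  for S :: "'a::complex_normed_vector \<Rightarrow>\<^sub>L 'b::complex_normed_vector"
  by (rule blinfun_eqI) simp

section \<open>Extension from dense subspaces\<close>

lemma dense_induct:
  assumes "closure S = UNIV" "closed {x. P x}" "\<And>x. x \<in> S \<Longrightarrow> P x"
  shows "P x"
proof -
  have "closure S \<subseteq> {x. P x}"
    by (rule closure_minimal) (use assms in auto)
  then show ?thesis using assms(1) by auto
qed

lemma closed_blinfun_eq:
  fixes S T :: "'a::real_normed_vector \<Rightarrow>\<^sub>L 'b::real_normed_vector"
  shows "closed {x. S x = T x}"
  by (intro closed_Collect_eq linear_continuous_on blinfun.bounded_linear_right)

lemma blinfun_eq_on_dense:
  fixes S T :: "'a::real_normed_vector \<Rightarrow>\<^sub>L 'b::real_normed_vector"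
  assumes "closure D = UNIV" "\<And>x. x \<in> D \<Longrightarrow> S x = T x"
  shows "S = T"
  by (rule blinfun_eqI) (rule dense_induct[OF assms(1) closed_blinfun_eq assms(2)])

lemma is_adjoint_on_dense:
  fixes S T :: "'a::complex_hilbert op"
  assumes "closure D = UNIV" "\<And>x y. x \<in> D \<Longrightarrow> y \<in> D \<Longrightarrow> cinner (S x) y = cinner x (T y)"
  shows "is_adjoint S T"
proof -
  note cont = linear_continuous_on[OF blinfun.bounded_linear_right] continuous_on_cinner
    continuous_on_const continuous_on_id
  have 1: "cinner (S x) y = cinner x (T y)" if y: "y \<in> D" for x y
    by (rule dense_induct[OF assms(1), of "\<lambda>x. cinner (S x) y = cinner x (T y)"])
      (auto intro!: closed_Collect_eq cont assms(2) y)
  have "cinner (S x) y = cinner x (T y)" for x y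
    by (rule dense_induct[OF assms(1), of "\<lambda>y. cinner (S x) y = cinner x (T y)"])
      (auto intro!: closed_Collect_eq cont 1)
  then show ?thesis by (simp add: is_adjoint_def)
qed

text \<open>Uniform continuity provides the extension \<open>g\<close>; additivity, homogeneity and
  the bound are closed conditions and pass to it by density. Additivity is extended in one variable
  at a time, the second once the first ranges over the whole space.\<close>

lemma extend_clinear:
  fixes T\<^sub>0 :: "'k::complex_hilbert \<Rightarrow> 'k"
  assumes dense: "closure D = UNIV"
    and D_add: "\<And>x y. x \<in> D \<Longrightarrow> y \<in> D \<Longrightarrow> x + y \<in> D" and D_scale: "\<And>c x. x \<in> D \<Longrightarrow> c *\<^sub>C x \<in> D"
    and add: "\<And>x y. x \<in> D \<Longrightarrow> y \<in> D \<Longrightarrow> T\<^sub>0 (x + y) = T\<^sub>0 x + T\<^sub>0 y"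
    and scale: "\<And>c x. x \<in> D \<Longrightarrow> T\<^sub>0 (c *\<^sub>C x) = c *\<^sub>C T\<^sub>0 x"
    and bound: "\<And>x. x \<in> D \<Longrightarrow> norm (T\<^sub>0 x) \<le> C * norm x" and "C \<ge> 0"
  shows "\<exists>T. clinear_op T \<and> (\<forall>x\<in>D. blinfun_apply T x = T\<^sub>0 x)"
proof -
  have D_minus: "x - y \<in> D" and diff: "T\<^sub>0 (x - y) = T\<^sub>0 x - T\<^sub>0 y" if "x \<in> D" "y \<in> D" for x y
    using D_add[of x "(-1) *\<^sub>C y"] D_scale[of y "-1"] add[of x "(-1) *\<^sub>C y"] scale[of y "-1"] that
    by (simp_all add: scaleC_minus_left scaleC_one)
  have "C-lipschitz_on D T\<^sub>0"
    by (rule lipschitz_onI) (simp_all add: dist_norm diff[symmetric] bound D_minus \<open>C \<ge> 0\<close>)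
  then have "uniformly_continuous_on D T\<^sub>0"
    by (rule lipschitz_on_uniformly_continuous)
  then obtain g where g: "uniformly_continuous_on UNIV g" "\<And>x. x \<in> D \<Longrightarrow> T\<^sub>0 x = g x"
    using uniformly_continuous_on_extension_on_closure[of D T\<^sub>0] dense by metis
  have cont: "continuous_on UNIV g"
    by (rule uniformly_continuous_imp_continuous[OF g(1)])
  have g_comp: "continuous_on UNIV (\<lambda>x. g (h x))" if "continuous_on UNIV h" for h :: "'k \<Rightarrow> 'k"
    by (rule continuous_on_compose2[OF cont that]) auto
  have scaleC_cont: "continuous_on UNIV (\<lambda>x. c *\<^sub>C h x)" if "continuous_on UNIV h" for c and h :: "'k \<Rightarrow> 'k"
    by (rule bounded_linear.continuous_on[OF bounded_linear_scaleC that])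
  have g_add1: "g (x + y) = g x + g y" if y: "y \<in> D" for x y
    by (rule dense_induct[OF dense, of "\<lambda>x. g (x + y) = g x + g y"])
      (auto intro!: closed_Collect_eq g_comp continuous_intros cont simp: g(2)[symmetric] D_add add y)
  have g_add: "g (x + y) = g x + g y" for x y
    by (rule dense_induct[OF dense, of "\<lambda>y. g (x + y) = g x + g y"])
      (auto intro!: closed_Collect_eq g_comp continuous_intros cont simp: g_add1)
  have g_scale: "g (c *\<^sub>C x) = c *\<^sub>C g x" for c x
    by (rule dense_induct[OF dense, of "\<lambda>x. g (c *\<^sub>C x) = c *\<^sub>C g x"])
      (auto intro!: closed_Collect_eq g_comp scaleC_cont continuous_intros cont
        simp: g(2)[symmetric] D_scale scale)
  have g_norm: "norm (g x) \<le> C * norm x" for x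
    by (rule dense_induct[OF dense, of "\<lambda>x. norm (g x) \<le> C * norm x"])
      (auto intro!: closed_Collect_le continuous_intros cont simp: g(2)[symmetric] bound)
  have "bounded_linear g"
    by (rule bounded_linear_intro[of _ C]) (simp_all add: g_add scaleR_scaleC g_scale g_norm mult.commute)
  then have "blinfun_apply (Blinfun g) = g"
    by (rule bounded_linear_Blinfun_apply)
  then show ?thesis
    by (intro exI[of _ "Blinfun g"]) (simp add: clinear_op_def g_scale g(2))
qed

text \<open>Made for \<open>Z\<close> as the set of values that f_0 may take at infinity: these
  closure properties let the pairs with limits in \<open>Z\<close> form a star algebra.\<close>

definition star_subalgebra :: "'h::complex_hilbert op set \<Rightarrow> 'h op set \<Rightarrow> bool" where
  "star_subalgebra A Z \<longleftrightarrow> Z \<subseteq> A \<and> 0 \<in> Z \<and> (\<forall>a\<in>Z. \<forall>b\<in>Z. a + b \<in> Z) \<and> (\<forall>c. \<forall>a\<in>Z. c *\<^sub>C a \<in> Z) \<and>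
     (\<forall>a\<in>Z. \<forall>b\<in>Z. a o\<^sub>L b \<in> Z) \<and> (\<forall>a\<in>Z. adj a \<in> Z)"

text \<open>A crude matrix bound for the sum norm. The comparison of \<open>\<kappa>\<close> with
  \<open>\<rho>\<close> uses it in both directions, where only the existence of a constant
  matters.\<close>

lemma sum_norm_blinfun_le:
  fixes T :: "nat \<Rightarrow> nat \<Rightarrow> 'a::real_normed_vector \<Rightarrow>\<^sub>L 'b::real_normed_vector"
  shows "(\<Sum>p<m. norm (\<Sum>j<n. T p j (k j))) \<le> (\<Sum>p<m. \<Sum>j<n. norm (T p j)) * (\<Sum>j<n. norm (k j))"
proof -
  have "norm (\<Sum>j<n. T p j (k j)) \<le> (\<Sum>j<n. norm (T p j)) * (\<Sum>j<n. norm (k j))" for p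
  proof -
    have "norm (\<Sum>j<n. T p j (k j)) \<le> (\<Sum>j<n. norm (T p j) * norm (k j))"
      by (rule sum_norm_le) (rule norm_blinfun)
    also have "\<dots> \<le> (\<Sum>j<n. norm (T p j) * (\<Sum>j<n. norm (k j)))"
      by (intro sum_mono mult_left_mono member_le_sum) auto
    finally show ?thesis by (simp add: sum_distrib_right)
  qed
  then show ?thesis
    by (simp add: sum_distrib_right sum_mono)
qed

section \<open>Balanced tensor products\<close>

lemma frag_lift_superset:
  assumes "finite K" "Poly_Mapping.keys t \<subseteq> K"
  shows "frag_lift f t = (\<Sum>p\<in>K. real_of_int (Poly_Mapping.lookup t p) *\<^sub>R f p)"
  unfolding frag_lift_def using assms
  by (intro sum.mono_neutral_left) (auto simp: in_keys_iff)

lemma frag_lift_zero [simp]: "frag_lift f 0 = 0"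
  by (simp add: frag_lift_def)

lemma frag_lift_frag_of [simp]: "frag_lift f (frag_of p) = f p"
  by (simp add: frag_lift_def)

lemma frag_lift_add: "frag_lift f (s + t) = frag_lift f s + frag_lift f t"
proof -
  define K where "K = Poly_Mapping.keys s \<union> Poly_Mapping.keys t"
  have "finite K" "Poly_Mapping.keys (s + t) \<subseteq> K" "Poly_Mapping.keys s \<subseteq> K" "Poly_Mapping.keys t \<subseteq> K"
    using keys_add[of s t] by (auto simp: K_def)
  then show ?thesis
    by (simp add: frag_lift_superset[of K] lookup_add scaleR_add_left sum.distrib)
qed

lemma frag_lift_minus: "frag_lift f (- t) = - frag_lift f t"
  using frag_lift_add[of f t "- t"] by (simp add: eq_neg_iff_add_eq_0 add.commute)

lemma frag_lift_diff: "frag_lift f (s - t) = frag_lift f s - frag_lift f t"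
  using frag_lift_add[of f s "- t"] by (simp add: frag_lift_minus)

lemma frag_lift_sum: "frag_lift f (\<Sum>i\<in>I. t i) = (\<Sum>i\<in>I. frag_lift f (t i))"
  by (induction I rule: infinite_finite_induct) (auto simp: frag_lift_add)

lemma frag_lift_cong:
  assumes "\<And>p. p \<in> Poly_Mapping.keys t \<Longrightarrow> f p = g p"
  shows "frag_lift f t = frag_lift g t"
  unfolding frag_lift_def using assms by (intro sum.cong) auto

lemma frag_lift_linear:
  assumes "linear T"
  shows "frag_lift (\<lambda>p. T (f p)) t = T (frag_lift f t)"
  unfolding frag_lift_def by (simp add: linear_sum[OF assms] linear_scale[OF assms] o_def)

lemma frag_lift_sum_left:
  "frag_lift (\<lambda>p. \<Sum>i\<in>I. f i p) t = (\<Sum>i\<in>I. frag_lift (f i) t)"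
  unfolding frag_lift_def by (subst sum.swap) (simp add: scaleR_sum_right)

text \<open>The closure properties that keep the defining relations inside the free abelian group.
  The instances are conj L with H, L with its dual, and the dual with L.\<close>

locale tensor_pair =
  fixes A :: "'s set" and E :: "('s, 'e::ab_group_add) bimodule"
    and F :: "('s, 'f::ab_group_add, 'y) lmodule_scheme"
  assumes E_zero: "0 \<in> mcar E"
    and E_add: "x \<in> mcar E \<Longrightarrow> x' \<in> mcar E \<Longrightarrow> x + x' \<in> mcar E"
    and E_ract: "x \<in> mcar E \<Longrightarrow> a \<in> A \<Longrightarrow> ract E x a \<in> mcar E"
    and F_zero: "0 \<in> mcar F"
    and F_add: "y \<in> mcar F \<Longrightarrow> y' \<in> mcar F \<Longrightarrow> y + y' \<in> mcar F"
    and F_lact: "y \<in> mcar F \<Longrightarrow> a \<in> A \<Longrightarrow> lact F a y \<in> mcar F"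
begin

abbreviation FG where "FG \<equiv> free_Abelian_group (mcar E \<times> mcar F)"
abbreviation N where "N \<equiv> tensor_null A E F"

text \<open>Addition of formal combinations is total, so cosets can be computed without support
  conditions; \<open>formal\<close> enters where membership in the carriers matters.\<close>

definition cls :: "('e \<times> 'f \<Rightarrow>\<^sub>0 int) \<Rightarrow> ('e, 'f) tens" where
  "cls t = N #>\<^bsub>FG\<^esub> t"

definition formal :: "('e \<times> 'f \<Rightarrow>\<^sub>0 int) \<Rightarrow> bool" where
  "formal t \<longleftrightarrow> Poly_Mapping.keys t \<subseteq> mcar E \<times> mcar F"

lemma formal_zero [simp]: "formal 0"
  by (simp add: formal_def)

lemma formal_frag_of [simp]: "formal (frag_of (x, y)) \<longleftrightarrow> x \<in> mcar E \<and> y \<in> mcar F"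
  by (simp add: formal_def)

lemma formal_add: "formal s \<Longrightarrow> formal t \<Longrightarrow> formal (s + t)"
  unfolding formal_def using keys_add[of s t] by blast

lemma formal_diff: "formal s \<Longrightarrow> formal t \<Longrightarrow> formal (s - t)"
  unfolding formal_def using keys_diff[of s t] by blast

lemma formal_sum: "(\<And>i. i \<in> I \<Longrightarrow> formal (t i)) \<Longrightarrow> formal (\<Sum>i\<in>I. t i)"
  by (induction I rule: infinite_finite_induct) (auto intro: formal_add)

lemma tensor_rel_formal: "s \<in> tensor_rel A E F \<Longrightarrow> formal s"
  unfolding tensor_rel_def
  by (auto intro!: formal_diff simp: E_add E_ract F_add F_lact)

lemma subgroup_N: "subgroup N FG"
  unfolding tensor_null_def
  by (intro group.generate_is_subgroup) (auto dest: tensor_rel_formal simp: formal_def)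

lemma N_zero: "0 \<in> N"
  using subgroup.one_closed[OF subgroup_N] by simp

lemma N_formal: "s \<in> N \<Longrightarrow> formal s"
  unfolding formal_def using subsetD[OF subgroup.subset[OF subgroup_N], of s]
  by (simp only: carrier_free_Abelian_group_iff)

lemma N_add: "s \<in> N \<Longrightarrow> t \<in> N \<Longrightarrow> s + t \<in> N"
  using subgroup.m_closed[OF subgroup_N] by simp

lemma N_minus: "s \<in> N \<Longrightarrow> - s \<in> N"
  using subgroup.m_inv_closed[OF subgroup_N] N_formal by (metis formal_def inv_free_Abelian_group)

lemma N_diff: "s \<in> N \<Longrightarrow> t \<in> N \<Longrightarrow> s - t \<in> N"
  using N_add[OF _ N_minus, of s t] by simp

lemma tensor_rel_N: "s \<in> tensor_rel A E F \<Longrightarrow> s \<in> N"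
  unfolding tensor_null_def by (rule generate.incl)

lemma cls_eq_image: "cls t = (\<lambda>h. h + t) ` N"
  unfolding cls_def r_coset_def by auto

lemma cls_eqI:
  assumes "s - t \<in> N"
  shows "cls s = cls t"
proof (intro equalityI subsetI)
  fix u assume "u \<in> cls s"
  then obtain h where "h \<in> N" "u = (h + (s - t)) + t" by (auto simp: cls_eq_image)
  then show "u \<in> cls t" using N_add[OF _ assms] unfolding cls_eq_image by blast
next
  fix u assume "u \<in> cls t"
  then obtain h where "h \<in> N" "u = (h - (s - t)) + s" by (auto simp: cls_eq_image)
  then show "u \<in> cls s" using N_diff[OF _ assms] unfolding cls_eq_image by blast
qed

lemma cls_eqD: "cls s = cls t \<Longrightarrow> s - t \<in> N"
proof -
  assume "cls s = cls t"
  then have "s \<in> cls t" using N_zero by (force simp: cls_eq_image)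
  then show ?thesis by (auto simp: cls_eq_image)
qed

lemma cls_cong_add: "cls s = cls s' \<Longrightarrow> cls t = cls t' \<Longrightarrow> cls (s + t) = cls (s' + t')"
  using N_add[OF cls_eqD cls_eqD, of s s' t t'] by (intro cls_eqI) (simp add: algebra_simps)

lemma cls_cong_diff: "cls s = cls s' \<Longrightarrow> cls t = cls t' \<Longrightarrow> cls (s - t) = cls (s' - t')"
  using N_diff[OF cls_eqD cls_eqD, of s s' t t'] by (intro cls_eqI) (simp add: algebra_simps)

lemma cls_cong_sum:
  "(\<And>i. i \<in> I \<Longrightarrow> cls (s i) = cls (t i)) \<Longrightarrow> cls (\<Sum>i\<in>I. s i) = cls (\<Sum>i\<in>I. t i)"
proof (induction I rule: infinite_finite_induct)
  case (insert i I)
  then have "cls (s i + (\<Sum>i\<in>I. s i)) = cls (t i + (\<Sum>i\<in>I. t i))"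
    by (intro cls_cong_add) simp_all
  then show ?case using insert.hyps by simp
qed simp_all

lemma cls_frag_of_add_left:
  assumes "x \<in> mcar E" "x' \<in> mcar E" "y \<in> mcar F"
  shows "cls (frag_of (x + x', y)) = cls (frag_of (x, y) + frag_of (x', y))"
proof (rule cls_eqI)
  have "frag_of (x + x', y) - frag_of (x, y) - frag_of (x', y) \<in> N"
    using assms by (intro tensor_rel_N) (unfold tensor_rel_def, blast)
  then show "frag_of (x + x', y) - (frag_of (x, y) + frag_of (x', y)) \<in> N"
    by (simp add: diff_diff_eq)
qed

lemma cls_frag_of_add_right:
  assumes "x \<in> mcar E" "y \<in> mcar F" "y' \<in> mcar F"
  shows "cls (frag_of (x, y + y')) = cls (frag_of (x, y) + frag_of (x, y'))"
proof (rule cls_eqI)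
  have "frag_of (x, y + y') - frag_of (x, y) - frag_of (x, y') \<in> N"
    using assms by (intro tensor_rel_N) (unfold tensor_rel_def, blast)
  then show "frag_of (x, y + y') - (frag_of (x, y) + frag_of (x, y')) \<in> N"
    by (simp add: diff_diff_eq)
qed

lemma cls_frag_of_balanced:
  assumes "x \<in> mcar E" "a \<in> A" "y \<in> mcar F"
  shows "cls (frag_of (ract E x a, y)) = cls (frag_of (x, lact F a y))"
  using assms by (intro cls_eqI tensor_rel_N) (unfold tensor_rel_def, blast)

lemma cls_frag_of_zero_left: "y \<in> mcar F \<Longrightarrow> cls (frag_of (0, y)) = cls 0"
  using cls_eqD[OF cls_frag_of_add_left[OF E_zero E_zero, of y]] N_minus
  by (intro cls_eqI) fastforce

lemma cls_frag_of_zero_right: "x \<in> mcar E \<Longrightarrow> cls (frag_of (x, 0)) = cls 0"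
  using cls_eqD[OF cls_frag_of_add_right[OF _ F_zero F_zero, of x]] N_minus
  by (intro cls_eqI) fastforce

lemma E_sum: "(\<And>i. i \<in> I \<Longrightarrow> x i \<in> mcar E) \<Longrightarrow> (\<Sum>i\<in>I. x i) \<in> mcar E"
  by (induction I rule: infinite_finite_induct) (auto intro: E_zero E_add)

lemma cls_frag_of_sum_left:
  assumes "\<And>i. i \<in> I \<Longrightarrow> x i \<in> mcar E" "y \<in> mcar F"
  shows "cls (frag_of (\<Sum>i\<in>I. x i, y)) = cls (\<Sum>i\<in>I. frag_of (x i, y))"
  using assms
proof (induction I rule: infinite_finite_induct)
  case (insert i I)
  then have "cls (frag_of (x i + (\<Sum>i\<in>I. x i), y)) = cls (frag_of (x i, y) + frag_of (\<Sum>i\<in>I. x i, y))"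
    by (intro cls_frag_of_add_left E_sum) simp_all
  also have "\<dots> = cls (frag_of (x i, y) + (\<Sum>i\<in>I. frag_of (x i, y)))"
    using insert by (intro cls_cong_add) simp_all
  finally show ?case using insert by simp
qed (auto simp: cls_frag_of_zero_left)

lemma cls_frag_of_diff_right:
  assumes "x \<in> mcar E" "y \<in> mcar F" "y' \<in> mcar F" "y - y' \<in> mcar F"
  shows "cls (frag_of (x, y - y')) = cls (frag_of (x, y) - frag_of (x, y'))"
  using N_minus[OF cls_eqD[OF cls_frag_of_add_right[OF assms(1,4,3)]]]
    N_minus[of "frag_of (x, y) - frag_of (x, y') - frag_of (x, y - y')"]
  by (intro cls_eqI) (simp add: algebra_simps)

lemma tensor_elem_eq: "tensor_elem A E F x y = cls (frag_of (x, y))"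
  by (simp add: tensor_elem_def cls_def)

lemma tensor_sum_eq: "tensor_sum A E F n x y = cls (\<Sum>i<n. frag_of (x i, y i))"
  by (simp add: tensor_sum_def cls_def)

lemma tensor_one_eq: "\<one>\<^bsub>tensor_group A E F\<^esub> = cls 0"
  by (simp add: tensor_group_def cls_eq_image)

lemma tensor_mult_eq: "cls s \<otimes>\<^bsub>tensor_group A E F\<^esub> cls t = cls (s + t)"
proof -
  have "(\<lambda>h. h + (s + t)) ` N \<subseteq> (\<Union>h\<in>(\<lambda>h. h + s) ` N. \<Union>k\<in>(\<lambda>h. h + t) ` N. {h + k})"
  proof safe
    fix h assume "h \<in> N"
    then show "h + (s + t) \<in> (\<Union>h\<in>(\<lambda>h. h + s) ` N. \<Union>k\<in>(\<lambda>h. h + t) ` N. {h + k})"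
      using N_zero by (intro UN_I[of "h + s"] UN_I[of "0 + t"]) (auto simp: ac_simps)
  qed
  moreover have "(\<Union>h\<in>(\<lambda>h. h + s) ` N. \<Union>k\<in>(\<lambda>h. h + t) ` N. {h + k}) \<subseteq> (\<lambda>h. h + (s + t)) ` N"
  proof safe
    fix h k assume "h \<in> N" "k \<in> N"
    then show "(h + s) + (k + t) \<in> (\<lambda>h. h + (s + t)) ` N"
      using N_add by (intro image_eqI[of _ _ "h + k"]) (auto simp: ac_simps)
  qed
  ultimately show ?thesis
    by (simp add: tensor_group_def FactGroup_def set_mult_def cls_eq_image)
qed

lemma tensor_carrier_iff: "X \<in> carrier (tensor_group A E F) \<longleftrightarrow> (\<exists>t. formal t \<and> X = cls t)"
  by (simp add: tensor_group_def FactGroup_def RCOSETS_def cls_def formal_def Bex_def)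

section \<open>Balanced maps and their lifts\<close>

definition balanced :: "('e \<Rightarrow> 'f \<Rightarrow> 'v::real_vector) \<Rightarrow> bool" where
  "balanced f \<longleftrightarrow>
     (\<forall>x\<in>mcar E. \<forall>x'\<in>mcar E. \<forall>y\<in>mcar F. f (x + x') y = f x y + f x' y) \<and>
     (\<forall>x\<in>mcar E. \<forall>y\<in>mcar F. \<forall>y'\<in>mcar F. f x (y + y') = f x y + f x y') \<and>
     (\<forall>x\<in>mcar E. \<forall>a\<in>A. \<forall>y\<in>mcar F. f (ract E x a) y = f x (lact F a y))"

lemma frag_lift_N:
  assumes "balanced f" "s \<in> N"
  shows "frag_lift (\<lambda>(x, y). f x y) s = 0"
proof -
  have rel: "frag_lift (\<lambda>(x, y). f x y) s = 0" if "s \<in> tensor_rel A E F" for s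
    using that assms(1) unfolding tensor_rel_def balanced_def by (auto simp: frag_lift_diff)
  from assms(2)[unfolded tensor_null_def] show ?thesis
  proof (induction rule: generate.induct)
    case (inv h)
    then have "inv\<^bsub>FG\<^esub> h = - h"
      using tensor_rel_formal by (simp add: formal_def)
    then show ?case by (simp add: rel inv frag_lift_minus)
  qed (auto simp: rel frag_lift_add)
qed

text \<open>A balanced map kills the relations, hence the subgroup they generate, so the image of a
  coset is a singleton and \<open>the_elem\<close> selects its element.\<close>

lemma tensor_lift_cls:
  assumes "balanced f"
  shows "tensor_lift f (cls t) = frag_lift (\<lambda>(x, y). f x y) t"
proof -
  have "frag_lift (\<lambda>(x, y). f x y) ` cls t = {frag_lift (\<lambda>(x, y). f x y) t}"
    using N_zero by (auto simp: cls_eq_image image_image frag_lift_add frag_lift_N[OF assms])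
  then show ?thesis by (simp add: tensor_lift_def)
qed

lemma tensor_lift_elem: "balanced f \<Longrightarrow> tensor_lift f (tensor_elem A E F x y) = f x y"
  by (simp add: tensor_elem_eq tensor_lift_cls)

lemma tensor_lift_sum:
  "balanced f \<Longrightarrow> tensor_lift f (tensor_sum A E F n x y) = (\<Sum>i<n. f (x i) (y i))"
  by (simp add: tensor_sum_eq tensor_lift_cls frag_lift_sum)

text \<open>The image sets of the coset are compared, not their values, so a function can be
  rewritten on the carriers before anything is known about its balancedness.\<close>

lemma tensor_lift_cong:
  assumes "X \<in> carrier (tensor_group A E F)"
    and "\<And>x y. x \<in> mcar E \<Longrightarrow> y \<in> mcar F \<Longrightarrow> f x y = g x y"
  shows "tensor_lift f X = tensor_lift g X"
proof -
  obtain t where t: "formal t" "X = cls t"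
    using assms(1) tensor_carrier_iff by blast
  have "frag_lift (\<lambda>(x, y). f x y) s = frag_lift (\<lambda>(x, y). g x y) s" if "s \<in> X" for s
  proof (rule frag_lift_cong)
    fix p assume p: "p \<in> Poly_Mapping.keys s"
    have "formal s" using that t formal_add N_formal by (auto simp: cls_eq_image)
    then show "(case p of (x, y) \<Rightarrow> f x y) = (case p of (x, y) \<Rightarrow> g x y)"
      using p assms(2) by (auto simp: formal_def)
  qed
  then have "frag_lift (\<lambda>(x, y). f x y) ` X = frag_lift (\<lambda>(x, y). g x y) ` X"
    by (rule image_cong[OF refl])
  then show ?thesis
    by (simp only: tensor_lift_def)
qed

lemma tensor_lift_linear:
  assumes "X \<in> carrier (tensor_group A E F)" "linear T" "balanced f"
  shows "tensor_lift (\<lambda>x y. T (f x y)) X = T (tensor_lift f X)"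
proof -
  obtain t where t: "X = cls t"
    using assms(1) tensor_carrier_iff by blast
  have "balanced (\<lambda>x y. T (f x y))"
    using assms(3) by (simp add: balanced_def linear_add[OF assms(2)])
  then show ?thesis
    using frag_lift_linear[OF assms(2), of "\<lambda>(x, y). f x y" t]
    by (simp add: t tensor_lift_cls assms(3) case_prod_unfold)
qed

lemma tensor_lift_sum_left:
  assumes "X \<in> carrier (tensor_group A E F)" "\<And>i. i \<in> I \<Longrightarrow> balanced (f i)"
  shows "tensor_lift (\<lambda>x y. \<Sum>i\<in>I. f i x y) X = (\<Sum>i\<in>I. tensor_lift (f i) X)"
proof -
  obtain t where t: "X = cls t"
    using assms(1) tensor_carrier_iff by blast
  have bal: "balanced (\<lambda>x y. \<Sum>i\<in>I. f i x y)"
    unfolding balanced_def sum.distrib[symmetric]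
    by (intro conjI ballI sum.cong refl; use assms(2) in \<open>simp add: balanced_def\<close>)
  have "(\<Sum>i\<in>I. tensor_lift (f i) X) = (\<Sum>i\<in>I. frag_lift (\<lambda>p. f i (fst p) (snd p)) t)"
    by (intro sum.cong refl) (simp add: t tensor_lift_cls assms(2) case_prod_unfold)
  also have "\<dots> = frag_lift (\<lambda>p. \<Sum>i\<in>I. f i (fst p) (snd p)) t"
    by (rule frag_lift_sum_left[symmetric])
  finally show ?thesis
    by (simp add: t tensor_lift_cls[OF bal] case_prod_unfold)
qed

lemma tensor_lift_mult:
  assumes "X \<in> carrier (tensor_group A E F)" "Y \<in> carrier (tensor_group A E F)" "balanced f"
  shows "tensor_lift f (X \<otimes>\<^bsub>tensor_group A E F\<^esub> Y) = tensor_lift f X + tensor_lift f Y"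
proof -
  obtain s t where "X = cls s" "Y = cls t"
    using assms(1,2) tensor_carrier_iff by auto
  then show ?thesis
    by (simp add: tensor_mult_eq tensor_lift_cls assms(3) frag_lift_add)
qed

lemma tensor_lift_one: "balanced f \<Longrightarrow> tensor_lift f \<one>\<^bsub>tensor_group A E F\<^esub> = 0"
  by (simp add: tensor_one_eq tensor_lift_cls)

lemma cls_closed: "formal t \<Longrightarrow> cls t \<in> carrier (tensor_group A E F)"
  using tensor_carrier_iff by auto

lemma tensor_mult_closed:
  assumes "X \<in> carrier (tensor_group A E F)" "Y \<in> carrier (tensor_group A E F)"
  shows "X \<otimes>\<^bsub>tensor_group A E F\<^esub> Y \<in> carrier (tensor_group A E F)"
proof -
  obtain s t where "X = cls s" "Y = cls t" "formal s" "formal t"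
    using assms tensor_carrier_iff by auto
  then show ?thesis
    by (simp add: tensor_mult_eq cls_closed formal_add)
qed

lemma tensor_one_closed: "\<one>\<^bsub>tensor_group A E F\<^esub> \<in> carrier (tensor_group A E F)"
  by (simp add: tensor_one_eq cls_closed)

lemma tensor_elem_closed:
  "x \<in> mcar E \<Longrightarrow> y \<in> mcar F \<Longrightarrow> tensor_elem A E F x y \<in> carrier (tensor_group A E F)"
  by (simp add: tensor_elem_eq cls_closed)

lemma tensor_sum_closed:
  assumes "\<And>i. i < n \<Longrightarrow> x i \<in> mcar E" "\<And>i. i < n \<Longrightarrow> y i \<in> mcar F"
  shows "tensor_sum A E F n x y \<in> carrier (tensor_group A E F)"
  unfolding tensor_sum_eq by (intro cls_closed formal_sum) (simp add: assms)

end

section \<open>Maps between tensor products\<close>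

locale tensor_hom = S: tensor_pair A E F + T: tensor_pair A E' F'
  for A :: "'s set" and E :: "('s, 'e::ab_group_add) bimodule"
    and F :: "('s, 'f::ab_group_add, 'y) lmodule_scheme"
    and E' :: "('s, 'e2::ab_group_add) bimodule"
    and F' :: "('s, 'f2::ab_group_add, 'z) lmodule_scheme" +
  fixes \<phi> :: "'e \<Rightarrow> 'e2" and \<psi> :: "'f \<Rightarrow> 'f2"
  assumes \<phi>_in: "x \<in> mcar E \<Longrightarrow> \<phi> x \<in> mcar E'"
    and \<phi>_add: "x \<in> mcar E \<Longrightarrow> x' \<in> mcar E \<Longrightarrow> \<phi> (x + x') = \<phi> x + \<phi> x'"
    and \<phi>_act: "x \<in> mcar E \<Longrightarrow> a \<in> A \<Longrightarrow> \<phi> (ract E x a) = ract E' (\<phi> x) a"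
    and \<psi>_in: "y \<in> mcar F \<Longrightarrow> \<psi> y \<in> mcar F'"
    and \<psi>_add: "y \<in> mcar F \<Longrightarrow> y' \<in> mcar F \<Longrightarrow> \<psi> (y + y') = \<psi> y + \<psi> y'"
    and \<psi>_act: "y \<in> mcar F \<Longrightarrow> a \<in> A \<Longrightarrow> \<psi> (lact F a y) = lact F' a (\<psi> y)"
begin

abbreviation h where "h \<equiv> frag_extend (\<lambda>(x, y). frag_of (\<phi> x, \<psi> y))"

lemma h_rel:
  assumes "s \<in> tensor_rel A E F"
  shows "h s \<in> tensor_rel A E' F'"
proof -
  consider x x' y where "s = frag_of (x + x', y) - frag_of (x, y) - frag_of (x', y)"
      "x \<in> mcar E" "x' \<in> mcar E" "y \<in> mcar F"
    | x y y' where "s = frag_of (x, y + y') - frag_of (x, y) - frag_of (x, y')"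
      "x \<in> mcar E" "y \<in> mcar F" "y' \<in> mcar F"
    | x a y where "s = frag_of (ract E x a, y) - frag_of (x, lact F a y)"
      "x \<in> mcar E" "a \<in> A" "y \<in> mcar F"
    using assms unfolding tensor_rel_def by blast
  then show ?thesis
  proof cases
    case 1
    then have "h s = frag_of (\<phi> x + \<phi> x', \<psi> y) - frag_of (\<phi> x, \<psi> y) - frag_of (\<phi> x', \<psi> y)"
      by (simp add: frag_extend_diff \<phi>_add)
    with 1 \<phi>_in \<psi>_in show ?thesis
      unfolding tensor_rel_def by blast
  next
    case 2
    then have "h s = frag_of (\<phi> x, \<psi> y + \<psi> y') - frag_of (\<phi> x, \<psi> y) - frag_of (\<phi> x, \<psi> y')"
      by (simp add: frag_extend_diff \<psi>_add)
    with 2 \<phi>_in \<psi>_in show ?thesis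
      unfolding tensor_rel_def by blast
  next
    case 3
    then have "h s = frag_of (ract E' (\<phi> x) a, \<psi> y) - frag_of (\<phi> x, lact F' a (\<psi> y))"
      by (simp add: frag_extend_diff \<phi>_act \<psi>_act)
    with 3 \<phi>_in \<psi>_in show ?thesis
      unfolding tensor_rel_def by blast
  qed
qed

lemma h_N: "s \<in> S.N \<Longrightarrow> h s \<in> T.N"
  unfolding tensor_null_def[of A E F]
proof (induction rule: generate.induct)
  case (inv s)
  then have "inv\<^bsub>S.FG\<^esub> s = - s"
    using S.tensor_rel_formal by (simp add: S.formal_def)
  then show ?case
    by (simp add: frag_extend_minus T.N_minus T.tensor_rel_N h_rel inv)
qed (auto simp: frag_extend_add T.N_add T.N_zero T.tensor_rel_N h_rel)

text \<open>The image of a coset under \<open>h\<close> is in general only part of a coset of the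
  target. Adding the null subgroup of the target completes it, and \<open>h_N\<close> ensures that a
  single coset results.\<close>

lemma tensor_map_cls: "tensor_map A E' F' \<phi> \<psi> (S.cls t) = T.cls (h t)"
proof -
  have "(\<Union>k\<in>T.N. \<Union>u\<in>h ` S.cls t. {k + u}) = T.cls (h t)"
  proof (intro equalityI subsetI)
    fix v assume "v \<in> (\<Union>k\<in>T.N. \<Union>u\<in>h ` S.cls t. {k + u})"
    then obtain k s where "k \<in> T.N" "s \<in> S.N" "v = (k + h s) + h t"
      by (auto simp: S.cls_eq_image frag_extend_add add.assoc)
    then show "v \<in> T.cls (h t)"
      using T.N_add h_N by (auto simp: T.cls_eq_image)
  next
    fix v assume "v \<in> T.cls (h t)"
    then obtain k where "k \<in> T.N" "v = k + h t"
      by (auto simp: T.cls_eq_image)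
    moreover have "t \<in> S.cls t"
      using S.N_zero by (force simp: S.cls_eq_image)
    ultimately show "v \<in> (\<Union>k\<in>T.N. \<Union>u\<in>h ` S.cls t. {k + u})"
      by blast
  qed
  then show ?thesis
    by (simp add: tensor_map_def set_mult_def)
qed

lemma formal_h: "S.formal t \<Longrightarrow> T.formal (h t)"
  unfolding S.formal_def T.formal_def
  using keys_frag_extend[of "\<lambda>(x, y). frag_of (\<phi> x, \<psi> y)" t] \<phi>_in \<psi>_in by fastforce

lemma tensor_map_closed:
  assumes "X \<in> carrier (tensor_group A E F)"
  shows "tensor_map A E' F' \<phi> \<psi> X \<in> carrier (tensor_group A E' F')"
proof -
  obtain t where "X = S.cls t" "S.formal t"
    using assms S.tensor_carrier_iff by auto
  then show ?thesis
    by (simp add: tensor_map_cls T.cls_closed formal_h)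
qed

lemma frag_lift_h: "frag_lift f (h t) = frag_lift (\<lambda>(x, y). f (\<phi> x, \<psi> y)) t"
  by (rule frag_induction[of t UNIV]) (auto simp: frag_extend_diff frag_lift_diff)

lemma tensor_lift_map:
  assumes "X \<in> carrier (tensor_group A E F)" "T.balanced f"
  shows "tensor_lift f (tensor_map A E' F' \<phi> \<psi> X) = tensor_lift (\<lambda>x y. f (\<phi> x) (\<psi> y)) X"
proof -
  obtain t where t: "X = S.cls t"
    using assms(1) S.tensor_carrier_iff by blast
  have "S.balanced (\<lambda>x y. f (\<phi> x) (\<psi> y))"
    using assms(2) by (simp add: S.balanced_def T.balanced_def \<phi>_in \<psi>_in \<phi>_add \<psi>_add \<phi>_act \<psi>_act)
  then show ?thesis
    by (simp add: t tensor_map_cls T.tensor_lift_cls S.tensor_lift_cls assms(2) frag_lift_h)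
qed

lemma tensor_map_sum:
  "tensor_map A E' F' \<phi> \<psi> (tensor_sum A E F n x y)
     = tensor_sum A E' F' n (\<lambda>i. \<phi> (x i)) (\<lambda>i. \<psi> (y i))"
  by (simp add: S.tensor_sum_eq T.tensor_sum_eq tensor_map_cls frag_extend_sum o_def)

end

section \<open>Function spaces on the line\<close>

text \<open>For \<open>Z = {0}\<close>, the scalars and \<open>A\<close>, the set \<open>Clim A Z\<close> is \<open>C\<^sub>0\<close>, \<open>C\<^sub>0\<close> with scalars adjoined, and the
  functions on the one point compactification; the three cases are treated uniformly in \<open>Z\<close>.\<close>

definition Clim :: "'v::real_normed_vector set \<Rightarrow> 'v set \<Rightarrow> (real \<Rightarrow> 'v) set" where
  "Clim X Z = {f. continuous_on UNIV f \<and> range f \<subseteq> X \<and> (\<exists>l\<in>Z. (f \<longlongrightarrow> l) at_infinity)}"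

lemma C0_eq_Clim: "C0 X = Clim X {0}"
  by (simp add: C0_def Clim_def)

text \<open>Continuity at the added point is a limit at infinity. The limit lies in \<open>X\<close>
  because it is the value there of a map into the subspace \<open>X\<close>.\<close>

lemma C_inf_eq_Clim: "C_inf X = Clim X X"
proof (intro equalityI subsetI)
  fix f assume "f \<in> C_inf X"
  then obtain F where F: "continuous_map (Alexandroff_compactification euclideanreal) (top_of_set X) F"
    and f: "f = F \<circ> Some"
    by (auto simp: C_inf_def o_def)
  have "continuous_map euclideanreal (top_of_set X) f"
    unfolding f by (rule continuous_map_compose[OF continuous_map_Some F])
  then have cont: "continuous_on UNIV f" "range f \<subseteq> X"
    by (auto simp: continuous_map_in_subtopology)
  have l: "F None \<in> X"
    using continuous_map_image_subset_topspace[OF F] by auto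
  have "(f \<longlongrightarrow> F None) at_infinity"
  proof (rule topological_tendstoI)
    fix U assume U: "open U" "F None \<in> U"
    let ?W = "{p \<in> topspace (Alexandroff_compactification euclideanreal). F p \<in> X \<inter> U}"
    have "openin (Alexandroff_compactification euclideanreal) ?W"
      using openin_continuous_map_preimage[OF F openin_open_Int[OF U(1)]] .
    moreover have "None \<in> ?W"
      using U l by simp
    \<comment> \<open>An open set containing the added point is the complement of a compact subset
      of the line.\<close>
    ultimately obtain C where C: "compact C" "?W = insert None (Some ` (UNIV - C))"
      unfolding openin_Alexandroff_compactification by (auto simp: compactin_euclidean_iff)
    obtain b where b: "\<And>x. x \<in> C \<Longrightarrow> norm x \<le> b"
      using compact_imp_bounded[OF C(1)] bounded_iff by blast
    show "eventually (\<lambda>x. f x \<in> U) at_infinity"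
    proof (rule eventually_at_infinityI)
      fix x :: real assume "b + 1 \<le> norm x"
      then have "x \<notin> C" using b[of x] by auto
      then have "Some x \<in> ?W" unfolding C(2) by simp
      then show "f x \<in> U" by (simp add: f)
    qed
  qed
  with cont l show "f \<in> Clim X X"
    by (auto simp: Clim_def)
next
  fix f assume "f \<in> Clim X X"
  then obtain l where f: "continuous_on UNIV f" "range f \<subseteq> X" "l \<in> X" "(f \<longlongrightarrow> l) at_infinity"
    by (auto simp: Clim_def)
  let ?F = "case_option l f"
  have "continuous_map (Alexandroff_compactification euclideanreal) (top_of_set X) ?F"
    unfolding continuous_map_def
  proof (intro conjI allI impI)
    show "?F \<in> topspace (Alexandroff_compactification euclideanreal) \<rightarrow> topspace (top_of_set X)"
      using f by auto
    fix U assume "openin (top_of_set X) U"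
    then obtain V where V: "open V" "U = X \<inter> V"
      by (auto simp: openin_open)
    let ?W = "{p \<in> topspace (Alexandroff_compactification euclideanreal). ?F p \<in> U}"
    have op: "open (f -` V)"
      using f(1) V(1) by (simp add: continuous_on_open_vimage)
    show "openin (Alexandroff_compactification euclideanreal) ?W"
    proof (cases "l \<in> V")
      case True
      then have "eventually (\<lambda>x. f x \<in> V) at_infinity"
        using f(4) V(1) topological_tendstoD by blast
      then obtain b where b: "\<And>x. b \<le> norm x \<Longrightarrow> f x \<in> V"
        by (auto simp: eventually_at_infinity)
      \<comment> \<open>The complement of the preimage is closed, and it is bounded because
        \<open>f\<close> stays in \<open>V\<close> far out; hence it is compact.\<close>
      have "bounded (- (f -` V))"
        unfolding bounded_iff using b by (intro exI[of _ b]) force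
      then have "compact (- (f -` V))"
        using op by (simp add: compact_eq_bounded_closed closed_Compl)
      moreover have "?W = insert None (Some ` (UNIV - - (f -` V)))"
      proof (rule Set.set_eqI)
        fix p show "p \<in> ?W \<longleftrightarrow> p \<in> insert None (Some ` (UNIV - - (f -` V)))"
          using True f(2,3) by (cases p) (auto simp: V(2))
      qed
      ultimately show ?thesis
        unfolding openin_Alexandroff_compactification
        by (intro disjI2 exI[of _ "- (f -` V)"]) (simp add: op closed_Compl)
    next
      case False
      have "?W = Some ` (f -` V)"
      proof (rule Set.set_eqI)
        fix p show "p \<in> ?W \<longleftrightarrow> p \<in> Some ` (f -` V)"
          using False f(2) by (cases p) (auto simp: V(2))
      qed
      with op show ?thesis by simp
    qed
  qed
  then show "f \<in> C_inf X"
    unfolding C_inf_def by (intro CollectI exI[of _ ?F]) simp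
qed

lemma Clim_mono: "X \<subseteq> Y \<Longrightarrow> Z \<subseteq> W \<Longrightarrow> Clim X Z \<subseteq> Clim Y W"
  by (auto simp: Clim_def)

lemma Clim_continuous: "f \<in> Clim X Z \<Longrightarrow> continuous_on UNIV f"
  by (simp add: Clim_def)

lemma Clim_range: "f \<in> Clim X Z \<Longrightarrow> f x \<in> X"
  by (auto simp: Clim_def)

lemma ClimI:
  "continuous_on UNIV f \<Longrightarrow> (\<And>x. f x \<in> X) \<Longrightarrow> l \<in> Z \<Longrightarrow> (f \<longlongrightarrow> l) at_infinity \<Longrightarrow> f \<in> Clim X Z"
  by (auto simp: Clim_def)

lemma Clim_const: "c \<in> X \<Longrightarrow> c \<in> Z \<Longrightarrow> (\<lambda>x. c) \<in> Clim X Z"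
  by (auto simp: Clim_def)

text \<open>\<open>Z \<subseteq> X\<close> puts the limit into the set on which \<open>T\<close> is
  known to be continuous.\<close>

lemma Clim_comp:
  assumes "f \<in> Clim X Z" "continuous_on X T" "Z \<subseteq> X"
    "\<And>x. x \<in> X \<Longrightarrow> T x \<in> Y" "\<And>z. z \<in> Z \<Longrightarrow> T z \<in> W"
  shows "(\<lambda>x. T (f x)) \<in> Clim Y W"
proof -
  obtain l where f: "continuous_on UNIV f" "range f \<subseteq> X" "l \<in> Z" "(f \<longlongrightarrow> l) at_infinity"
    using assms(1) by (auto simp: Clim_def)
  have "((\<lambda>x. T (f x)) \<longlongrightarrow> T l) at_infinity"
    using f assms(3) by (intro continuous_on_tendsto_compose[OF assms(2) f(4)] always_eventually) auto
  moreover have "continuous_on UNIV (\<lambda>x. T (f x))"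
    using continuous_on_compose2[OF assms(2) f(1)] f(2) by simp
  ultimately show ?thesis
    using f assms(4,5) by (auto simp: Clim_def)
qed

lemma Clim_add:
  assumes "f \<in> Clim X Z" "g \<in> Clim Y W"
    "\<And>x y. x \<in> X \<Longrightarrow> y \<in> Y \<Longrightarrow> x + y \<in> V" "\<And>z w. z \<in> Z \<Longrightarrow> w \<in> W \<Longrightarrow> z + w \<in> U"
  shows "(\<lambda>x. f x + g x) \<in> Clim V U"
proof -
  obtain l m where l: "l \<in> Z" "(f \<longlongrightarrow> l) at_infinity" and m: "m \<in> W" "(g \<longlongrightarrow> m) at_infinity"
    using assms(1,2) by (auto simp: Clim_def)
  show ?thesis
    by (rule ClimI[OF _ _ assms(4)[OF l(1) m(1)] tendsto_add[OF l(2) m(2)]])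
      (use assms(1,2) in \<open>auto intro!: continuous_intros assms(3) simp: Clim_range Clim_continuous\<close>)
qed

lemma Clim_bilinear:
  assumes "bounded_bilinear B" "f \<in> Clim X Z" "g \<in> Clim Y W"
    "\<And>x y. x \<in> X \<Longrightarrow> y \<in> Y \<Longrightarrow> B x y \<in> V" "\<And>z w. z \<in> Z \<Longrightarrow> w \<in> W \<Longrightarrow> B z w \<in> U"
  shows "(\<lambda>x. B (f x) (g x)) \<in> Clim V U"
proof -
  obtain l m where l: "l \<in> Z" "(f \<longlongrightarrow> l) at_infinity" and m: "m \<in> W" "(g \<longlongrightarrow> m) at_infinity"
    using assms(2,3) by (auto simp: Clim_def)
  show ?thesis
    by (rule ClimI[OF bounded_bilinear.continuous_on[OF assms(1)] _ assms(5)[OF l(1) m(1)]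
        bounded_bilinear.tendsto[OF assms(1) l(2) m(2)]])
      (use assms(2,3) in \<open>auto intro!: assms(4) simp: Clim_range Clim_continuous\<close>)
qed

lemma Clim_bounded:
  assumes "f \<in> Clim X Z"
  obtains K where "K \<ge> 0" "\<And>x. norm (f x) \<le> K"
proof -
  obtain l where f: "continuous_on UNIV f" "(f \<longlongrightarrow> l) at_infinity"
    using assms by (auto simp: Clim_def)
  have "eventually (\<lambda>x. dist (f x) l < 1) at_infinity"
    using f(2) by (simp add: tendsto_iff)
  then obtain b where b: "\<And>x. b \<le> norm x \<Longrightarrow> dist (f x) l < 1"
    by (auto simp: eventually_at_infinity)
  have "compact (f ` cball 0 b)"
    using f(1) by (intro compact_continuous_image) (auto intro: continuous_on_subset)
  then obtain K where K: "\<And>x. x \<in> cball 0 b \<Longrightarrow> norm (f x) \<le> K"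
    using compact_imp_bounded bounded_iff by (metis imageI)
  \<comment> \<open>The maximum with 0 covers an empty ball, for which \<open>K\<close> is
    unconstrained.\<close>
  have "norm (f x) \<le> max K 0 + (norm l + 1)" for x
  proof (cases "norm x \<le> b")
    case True
    then have "norm (f x) \<le> K" by (intro K) (simp add: dist_norm)
    then show ?thesis by (simp add: max_def) (smt (verit) norm_ge_zero)
  next
    case False
    have "norm (f x) \<le> norm l + dist (f x) l"
      by (simp add: dist_norm norm_triangle_sub)
    then show ?thesis using b[of x] False by (simp add: max_def)
  qed
  then show ?thesis
    by (intro that[of "max K 0 + (norm l + 1)"]) auto
qed

section \<open>Compactly supported functions\<close>

lemma Cc_iff:
  "f \<in> Cc X \<longleftrightarrow> continuous_on UNIV f \<and> range f \<subseteq> X \<and> (\<exists>R. \<forall>x. R \<le> \<bar>x\<bar> \<longrightarrow> f x = 0)"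
proof -
  have "compact_support f \<longleftrightarrow> (\<exists>R. \<forall>x. R \<le> \<bar>x\<bar> \<longrightarrow> f x = 0)"
  proof
    assume "compact_support f"
    then have "bounded (closure {x. f x \<noteq> 0})"
      unfolding compact_support_def by (rule compact_imp_bounded)
    then obtain b where b: "\<And>x. x \<in> closure {x. f x \<noteq> 0} \<Longrightarrow> norm x \<le> b"
      by (auto simp: bounded_iff)
    have "f x = 0" if "b + 1 \<le> \<bar>x\<bar>" for x
      using b[of x] that closure_subset[of "{x. f x \<noteq> 0}"] by fastforce
    then show "\<exists>R. \<forall>x. R \<le> \<bar>x\<bar> \<longrightarrow> f x = 0" by blast
  next
    assume "\<exists>R. \<forall>x. R \<le> \<bar>x\<bar> \<longrightarrow> f x = 0"
    then obtain R where R: "\<And>x. R \<le> \<bar>x\<bar> \<Longrightarrow> f x = 0" by blast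
    have "\<bar>x\<bar> \<le> R" if "f x \<noteq> 0" for x
      using R[of x] that by linarith
    then have "bounded {x. f x \<noteq> 0}"
      unfolding bounded_iff by (intro exI[of _ R]) simp
    then show "compact_support f"
      by (simp add: compact_support_def)
  qed
  then show ?thesis by (simp add: Cc_def)
qed

lemma Cc_continuous: "f \<in> Cc X \<Longrightarrow> continuous_on UNIV f"
  by (simp add: Cc_def)

lemma Cc_range: "f \<in> Cc X \<Longrightarrow> f x \<in> X"
  by (auto simp: Cc_def)

lemma CcI:
  "continuous_on UNIV f \<Longrightarrow> (\<And>x. f x \<in> X) \<Longrightarrow> (\<And>x. R \<le> \<bar>x\<bar> \<Longrightarrow> f x = 0) \<Longrightarrow> f \<in> Cc X"
  by (auto simp: Cc_iff)

lemma Cc_zero: "0 \<in> X \<Longrightarrow> (\<lambda>x. 0) \<in> Cc X"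
  by (auto simp: Cc_iff)

lemma Cc_comp:
  assumes "f \<in> Cc X" "continuous_on X T" "T 0 = 0" "\<And>x. x \<in> X \<Longrightarrow> T x \<in> Y"
  shows "(\<lambda>x. T (f x)) \<in> Cc Y"
proof -
  have "continuous_on UNIV (\<lambda>x. T (f x))"
    using assms(1) by (intro continuous_on_compose2[OF assms(2)]) (auto simp: Cc_iff)
  then show ?thesis
    using assms unfolding Cc_iff by (auto; metis)
qed

lemma Cc_add:
  assumes "f \<in> Cc X" "g \<in> Cc Y" "\<And>x y. x \<in> X \<Longrightarrow> y \<in> Y \<Longrightarrow> x + y \<in> Z"
  shows "(\<lambda>x. f x + g x) \<in> Cc Z"
proof -
  obtain R S where R: "\<And>x. R \<le> \<bar>x\<bar> \<Longrightarrow> f x = 0" and S: "\<And>x. S \<le> \<bar>x\<bar> \<Longrightarrow> g x = 0"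
    using assms by (auto simp: Cc_iff)
  show ?thesis
    by (rule CcI[of _ _ "max R S"])
      (use assms(1,2) R S in \<open>auto intro!: continuous_intros assms(3) simp: Cc_continuous Cc_range\<close>)
qed

lemma Cc_sum:
  assumes "\<And>i. i \<in> I \<Longrightarrow> f i \<in> Cc X" "0 \<in> X" "\<And>x y. x \<in> X \<Longrightarrow> y \<in> X \<Longrightarrow> x + y \<in> X"
  shows "(\<lambda>x. \<Sum>i\<in>I. f i x) \<in> Cc X"
  using assms(1)
  by (induction I rule: infinite_finite_induct) (auto intro!: Cc_add Cc_zero assms(2,3))

text \<open>One compactly supported factor suffices; the other may be unbounded. In the mirrored
  version this absorbs the weight x^2.\<close>

lemma Cc_bilinear_left:
  assumes "bounded_bilinear B" "f \<in> Cc X" "continuous_on UNIV g" "\<And>x. B (f x) (g x) \<in> Z"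
  shows "(\<lambda>x. B (f x) (g x)) \<in> Cc Z"
proof -
  have "continuous_on UNIV (\<lambda>x. B (f x) (g x))"
    using assms(2,3) by (intro bounded_bilinear.continuous_on[OF assms(1)]) (auto simp: Cc_def)
  then show ?thesis
    using assms(2,4) bounded_bilinear.zero_left[OF assms(1)] unfolding Cc_iff by (auto; metis)
qed

lemma Cc_bilinear_right:
  assumes "bounded_bilinear B" "continuous_on UNIV f" "g \<in> Cc X" "\<And>x. B (f x) (g x) \<in> Z"
  shows "(\<lambda>x. B (f x) (g x)) \<in> Cc Z"
  using Cc_bilinear_left[OF bounded_bilinear.flip[OF assms(1)] assms(3,2,4)] .

lemma Cc_subset_Clim: "Cc X \<subseteq> Clim X {0}"
proof
  fix f assume f: "f \<in> Cc X"
  then obtain R where R: "\<And>x. R \<le> \<bar>x\<bar> \<Longrightarrow> f x = 0"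
    by (auto simp: Cc_iff)
  have "(f \<longlongrightarrow> 0) at_infinity"
    by (rule tendsto_eventually, rule eventually_at_infinityI[of R]) (simp add: R)
  with f show "f \<in> Clim X {0}" by (auto simp: Cc_iff Clim_def)
qed

text \<open>Domination by a multiple of 1/(1 + x^2). The weight gives finite norm to vectors that do
  not decay, such as those in C(R_inf, H).\<close>

lemma integrable_div_one_plus_square:
  fixes g :: "real \<Rightarrow> complex"
  assumes "continuous_on UNIV g" "\<And>x. cmod (g x) \<le> K"
  shows "integrable lborel (\<lambda>x. g x / complex_of_real (1 + x\<^sup>2))"
proof (rule Bochner_Integration.integrable_bound)
  show "integrable lborel (\<lambda>x::real. K * inverse (1 + x\<^sup>2))"
    using integrable_inverse_1_plus_square by (simp add: set_integrable_def einterval_eq_UNIV)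
  have "1 + x\<^sup>2 \<noteq> 0" for x :: real
    by (smt (verit) zero_le_power2)
  then have "complex_of_real (1 + x\<^sup>2) \<noteq> 0" for x
    unfolding of_real_eq_0_iff .
  then show "(\<lambda>x. g x / complex_of_real (1 + x\<^sup>2)) \<in> borel_measurable lborel"
    unfolding measurable_lborel2
    by (intro borel_measurable_continuous_onI continuous_intros assms) auto
  have "norm (g x / complex_of_real (1 + x\<^sup>2)) \<le> norm (K * inverse (1 + x\<^sup>2))" for x
  proof -
    have "K \<ge> 0" using assms(2)[of 0] norm_ge_zero order_trans by blast
    have "cmod (complex_of_real (1 + x\<^sup>2)) = 1 + x\<^sup>2"
      by (simp only: norm_of_real) (simp add: add_nonneg_nonneg)
    then have "norm (g x / complex_of_real (1 + x\<^sup>2)) \<le> K / (1 + x\<^sup>2)"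
      unfolding norm_divide by (simp add: divide_right_mono assms(2) add_nonneg_nonneg)
    also have "K / (1 + x\<^sup>2) = norm (K * inverse (1 + x\<^sup>2))"
      using \<open>K \<ge> 0\<close> by (simp add: divide_inverse abs_mult add_nonneg_nonneg)
    finally show ?thesis .
  qed
  then show "AE x in lborel. norm (g x / complex_of_real (1 + x\<^sup>2)) \<le> norm (K * inverse (1 + x\<^sup>2))"
    by simp
qed

text \<open>A zero integral would force \<open>h\<close> to vanish almost everywhere; its zero set
  is closed, and a closed set of full measure is the whole line.\<close>

lemma integral_continuous_pos:
  fixes h :: "real \<Rightarrow> real"
  assumes "continuous_on UNIV h" "\<And>x. h x \<ge> 0" "integrable lborel h" "h a \<noteq> 0"
  shows "(LINT x|lborel. h x) > 0"
proof (rule ccontr)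
  assume "\<not> (LINT x|lborel. h x) > 0"
  moreover have "(LINT x|lborel. h x) \<ge> 0"
    by (rule Bochner_Integration.integral_nonneg) (rule assms(2))
  ultimately have "(LINT x|lborel. h x) = 0" by simp
  then have "AE x in lborel. h x = 0"
    using integral_nonneg_eq_0_iff_AE[OF assms(3)] assms(2) by simp
  then have "AE x in lebesgue. x \<in> {x. h x = 0}"
    by (intro AE_completion) simp
  moreover have "closed {x. h x = 0}"
    using assms(1) by (intro closed_Collect_eq continuous_on_const) auto
  ultimately show False
    using mem_closed_if_AE_lebesgue[of "{x. h x = 0}" a] assms(4) by blast
qed

section \<open>Bump functions\<close>

definition tent :: "real \<Rightarrow> real \<Rightarrow> real" where
  "tent c x = max 0 (1 - \<bar>x - c\<bar>)"

text \<open>Equal to 1 wherever \<open>tent c\<close> is nonzero, so multiplication by it fixes the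
  tent.\<close>

definition plateau :: "real \<Rightarrow> real \<Rightarrow> real" where
  "plateau c x = max 0 (min 1 (2 - \<bar>x - c\<bar>))"

lemma tent_Cc: "tent c \<in> Cc UNIV"
  unfolding Cc_iff
  by (auto simp: tent_def[abs_def] intro!: continuous_intros exI[of _ "\<bar>c\<bar> + 1"])

lemma plateau_Cc: "plateau c \<in> Cc UNIV"
  unfolding Cc_iff
  by (auto simp: plateau_def[abs_def] intro!: continuous_intros exI[of _ "\<bar>c\<bar> + 2"])

lemma plateau_tent: "plateau c x * tent c x = tent c x"
  by (auto simp: tent_def plateau_def max_def min_def)

lemma tent_eq_0: "x \<le> c - 1 \<Longrightarrow> tent c x = 0"
  by (auto simp: tent_def)

lemma tent_center: "tent c c = 1"
  by (simp add: tent_def)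

text \<open>Prepared for the off-diagonal entries of the action, which occur multiplied by |x|. The
  common constant is the sum of the individual ones, which also covers \<open>n = 0\<close>.\<close>

lemma Cc_weighted_bound:
  fixes f :: "nat \<Rightarrow> real \<Rightarrow> 'a::real_normed_vector"
  assumes "\<And>i. i < n \<Longrightarrow> f i \<in> Cc X"
  shows "\<exists>K\<ge>0. \<forall>i<n. \<forall>x. \<bar>x\<bar> * norm (f i x) \<le> K"
proof -
  have "\<exists>K\<ge>0. \<forall>x. \<bar>x\<bar> * norm (f i x) \<le> K" if "i < n" for i
  proof -
    have "(\<lambda>x. x *\<^sub>R f i x) \<in> Cc UNIV"
      by (rule Cc_bilinear_right[OF bounded_bilinear_scaleR continuous_on_id assms[OF that]]) simp
    then obtain K where "K \<ge> 0" "\<And>x. norm (x *\<^sub>R f i x) \<le> K"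
      using Clim_bounded[OF subsetD[OF Cc_subset_Clim]] by blast
    then show ?thesis by auto
  qed
  then obtain K where K: "\<And>i. i < n \<Longrightarrow> K i \<ge> 0" "\<And>i x. i < n \<Longrightarrow> \<bar>x\<bar> * norm (f i x) \<le> K i"
    by metis
  show ?thesis
  proof (intro exI conjI allI impI)
    show "(\<Sum>i<n. K i) \<ge> 0" by (intro sum_nonneg) (simp add: K)
    fix i x assume i: "i < n"
    have "K i \<le> (\<Sum>i<n. K i)" by (intro member_le_sum) (auto simp: i K)
    then show "\<bar>x\<bar> * norm (f i x) \<le> (\<Sum>i<n. K i)" using K(2)[OF i, of x] by linarith
  qed
qed

lemma one_plus_square_pos: "1 + x\<^sup>2 > (0::real)"
  by (simp add: add_pos_nonneg)

lemma one_plus_square_nonzero: "1 + x\<^sup>2 \<noteq> (0::real)"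
  using one_plus_square_pos[of x] by simp

section \<open>Hermitian line modules\<close>

lemma Conj_add: "Conj (x + y) = Conj x + Conj y"
  by (simp add: plus_conj_def)

lemma unConj_add [simp]: "unConj (x + y) = unConj x + unConj y"
  by (simp add: plus_conj_def)

lemma Conj_sum: "Conj (\<Sum>i\<in>I. f i) = (\<Sum>i\<in>I. Conj (f i))"
  by (induction I rule: infinite_finite_induct) (simp_all add: Conj_add zero_conj_def[symmetric])

lemma Conj_scaleC: "Conj (c *\<^sub>C x) = cnj c *\<^sub>C Conj x"
  by (simp add: scaleC_conj_def)

lemma range_Conj: "range Conj = UNIV"
  by (metis conj.collapse surj_def)

section \<open>The operator algebra and its involution\<close>

locale operator_algebra =
  fixes A :: "'h::complex_hilbert op set"
  assumes A_algebra: "op_cstar_algebra A" and A_id: "id_blinfun \<in> A"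
begin

lemma A_zero: "0 \<in> A"
  and A_add: "a \<in> A \<Longrightarrow> b \<in> A \<Longrightarrow> a + b \<in> A"
  and A_scaleC: "a \<in> A \<Longrightarrow> c *\<^sub>C a \<in> A"
  and A_compose: "a \<in> A \<Longrightarrow> b \<in> A \<Longrightarrow> a o\<^sub>L b \<in> A"
  and A_clinear: "a \<in> A \<Longrightarrow> clinear_op a"
  using A_algebra unfolding op_cstar_algebra_def by auto

lemma A_scaleR: "a \<in> A \<Longrightarrow> s *\<^sub>R a \<in> A"
  using A_scaleC by (simp add: scaleR_scaleC)

lemma A_sum: "(\<And>i. i \<in> I \<Longrightarrow> f i \<in> A) \<Longrightarrow> (\<Sum>i\<in>I. f i) \<in> A"
  by (induction I rule: infinite_finite_induct) (auto intro: A_zero A_add)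

lemma A_apply_scaleC: "a \<in> A \<Longrightarrow> a (c *\<^sub>C u) = c *\<^sub>C a u"
  using A_clinear by (simp add: clinear_op_def)

lemma
  assumes "a \<in> A"
  shows is_adjoint_adj: "is_adjoint (adj a) a" and A_adj: "adj a \<in> A"
proof -
  have "\<forall>T\<in>A. \<exists>S\<in>A. is_adjoint S T"
    using A_algebra by (simp add: op_cstar_algebra_def)
  then obtain S where S: "S \<in> A" "is_adjoint S a"
    using assms by auto
  have "adj a = S"
    by (rule adj_eqI) (rule S)
  with S show "is_adjoint (adj a) a" "adj a \<in> A"
    by simp_all
qed

lemma adj_adj: "a \<in> A \<Longrightarrow> adj (adj a) = a"
  by (rule adj_eqI[OF is_adjoint_sym[OF is_adjoint_adj]])

lemma adj_add: "a \<in> A \<Longrightarrow> b \<in> A \<Longrightarrow> adj (a + b) = adj a + adj b"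
  by (rule adj_eqI) (intro is_adjoint_add is_adjoint_adj)

lemma adj_scaleC: "a \<in> A \<Longrightarrow> adj (c *\<^sub>C a) = cnj c *\<^sub>C adj a"
  by (rule adj_eqI) (intro is_adjoint_scaleC is_adjoint_adj)

lemma adj_compose: "a \<in> A \<Longrightarrow> b \<in> A \<Longrightarrow> adj (a o\<^sub>L b) = adj b o\<^sub>L adj a"
  by (rule adj_eqI) (intro is_adjoint_compose is_adjoint_adj)

lemma adj_zero: "adj 0 = 0"
  by (rule adj_eqI[OF is_adjoint_zero])

lemma adj_id: "adj id_blinfun = id_blinfun"
  by (rule adj_eqI[OF is_adjoint_id])

lemma adj_sum: "(\<And>i. i \<in> I \<Longrightarrow> f i \<in> A) \<Longrightarrow> adj (\<Sum>i\<in>I. f i) = (\<Sum>i\<in>I. adj (f i))"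
  by (induction I rule: infinite_finite_induct) (auto simp: adj_zero adj_add A_sum)

lemma norm_adj: "a \<in> A \<Longrightarrow> norm (adj a) = norm a"
  by (intro is_adjoint_norm_eq is_adjoint_adj)

lemma adj_diff: "a \<in> A \<Longrightarrow> b \<in> A \<Longrightarrow> adj (a - b) = adj a - adj b"
  by (rule adj_eqI) (intro is_adjoint_diff is_adjoint_adj)

lemma A_diff: "a \<in> A \<Longrightarrow> b \<in> A \<Longrightarrow> a - b \<in> A"
  using A_add[of a "(-1) *\<^sub>C b"] A_scaleC[of b "-1"] by (simp add: scaleC_minus_left scaleC_one)

lemma cinner_adj_left: "a \<in> A \<Longrightarrow> cinner (adj a u) v = cinner u (a v)"
  using is_adjoint_adj by (simp add: is_adjoint_def)

text \<open>For maps known to be additive only on \<open>A\<close>, such as the adjoint: the bound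
  on differences is a Lipschitz estimate. The constant is \<open>max K 0\<close> because the sign of
  \<open>K\<close> is open.\<close>

lemma continuous_on_additive:
  fixes T :: "'h op \<Rightarrow> 'b::real_normed_vector"
  assumes "\<And>a b. a \<in> A \<Longrightarrow> b \<in> A \<Longrightarrow> T (a - b) = T a - T b" "\<And>a. a \<in> A \<Longrightarrow> norm (T a) \<le> K * norm a"
  shows "continuous_on A T"
proof -
  have "dist (T a) (T b) \<le> max K 0 * dist a b" if "a \<in> A" "b \<in> A" for a b
  proof -
    have "dist (T a) (T b) = norm (T (a - b))"
      using assms(1) that by (simp add: dist_norm)
    also have "\<dots> \<le> K * norm (a - b)"
      using assms(2) A_diff that by blast
    also have "\<dots> \<le> max K 0 * norm (a - b)"
      by (intro mult_right_mono) auto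
    finally show ?thesis by (simp add: dist_norm)
  qed
  then have "(max K 0)-lipschitz_on A T"
    by (intro lipschitz_onI) auto
  then show ?thesis by (rule lipschitz_on_continuous_on)
qed

lemma continuous_on_adj: "continuous_on A adj"
  by (rule continuous_on_additive[of _ 1]) (simp_all add: adj_diff norm_adj)

end

locale hermitian_line_module = operator_algebra A
  for A :: "'h::complex_hilbert op set" +
  fixes L :: "('h op, 'l::complex_vector) bimodule"
    and st :: "'l \<Rightarrow> 'l"
    and G :: "'l conj \<Rightarrow> 'l \<Rightarrow> 'h op"
    and n :: nat
    and e :: "nat \<Rightarrow> 'l"
    and \<epsilon> :: "nat \<Rightarrow> 'l \<Rightarrow> 'h op"
    and r :: "nat \<Rightarrow> nat \<Rightarrow> 'h op"
    and M :: real
  assumes L_UNIV: "mcar L = UNIV" and line: "left_line_module A L n e \<epsilon>"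
    and star: "star_operation A L st"
    and metric: "hermitian_metric A L G" and compatible: "star_compatible A L n e \<epsilon> st G"
    and root: "\<forall>i<n. \<forall>j<n. r i j \<in> A \<and> adj (r i j) = r j i"
    and root_square: "\<forall>i<n. \<forall>j<n. (\<Sum>p<n. r i p o\<^sub>L r p j) = hip A L G (e i) (Conj (e j))"
    and M_nonneg: "M \<ge> 0"
    and M_bound: "\<forall>i<n. \<forall>j<n. \<forall>a\<in>A. norm (\<epsilon> i (ract L (e j) a)) \<le> M * norm a"
begin

abbreviation la where "la \<equiv> lact L"
abbreviation ra where "ra \<equiv> ract L"
abbreviation hp where "hp x y \<equiv> G (Conj y) x"

lemma L_bimodule: "bimodule A L"
  using line by (simp add: left_line_module_def)

lemma
  shows la_add_right: "a \<in> A \<Longrightarrow> la a (x + y) = la a x + la a y"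
    and la_add_left: "a \<in> A \<Longrightarrow> b \<in> A \<Longrightarrow> la (a + b) x = la a x + la b x"
    and la_scaleC_left: "a \<in> A \<Longrightarrow> la (c *\<^sub>C a) x = c *\<^sub>C la a x"
    and la_scaleC_right: "a \<in> A \<Longrightarrow> la a (c *\<^sub>C x) = c *\<^sub>C la a x"
    and la_compose: "a \<in> A \<Longrightarrow> b \<in> A \<Longrightarrow> la (a o\<^sub>L b) x = la a (la b x)"
  using L_bimodule L_UNIV unfolding bimodule_def left_module_def by auto

lemma
  shows ra_add_left: "a \<in> A \<Longrightarrow> ra (x + y) a = ra x a + ra y a"
    and ra_add_right: "a \<in> A \<Longrightarrow> b \<in> A \<Longrightarrow> ra x (a + b) = ra x a + ra x b"
    and ra_scaleC_right: "a \<in> A \<Longrightarrow> ra x (c *\<^sub>C a) = c *\<^sub>C ra x a"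
    and ra_scaleC_left: "a \<in> A \<Longrightarrow> ra (c *\<^sub>C x) a = c *\<^sub>C ra x a"
    and ra_compose: "a \<in> A \<Longrightarrow> b \<in> A \<Longrightarrow> ra x (a o\<^sub>L b) = ra (ra x a) b"
    and ra_id: "ra x id_blinfun = x"
    and ra_la: "a \<in> A \<Longrightarrow> b \<in> A \<Longrightarrow> ra (la a x) b = la a (ra x b)"
  using L_bimodule L_UNIV unfolding bimodule_def by auto

lemma ra_zero_left: "a \<in> A \<Longrightarrow> ra 0 a = 0"
  using ra_scaleC_left[of a 0 0] by simp

lemma ra_zero_right: "ra x 0 = 0"
  using ra_scaleC_right[OF A_zero, of x 0] by simp

lemma ra_sum_left: "a \<in> A \<Longrightarrow> ra (\<Sum>i\<in>I. f i) a = (\<Sum>i\<in>I. ra (f i) a)"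
  by (induction I rule: infinite_finite_induct) (auto simp: ra_zero_left ra_add_left)

section \<open>The dual and the conjugate bimodule\<close>

lemma
  shows dual_in: "\<alpha> \<in> mcar (dual_bimodule A L) \<Longrightarrow> \<alpha> x \<in> A"
    and dual_add: "\<alpha> \<in> mcar (dual_bimodule A L) \<Longrightarrow> \<alpha> (x + y) = \<alpha> x + \<alpha> y"
    and dual_scaleC: "\<alpha> \<in> mcar (dual_bimodule A L) \<Longrightarrow> \<alpha> (c *\<^sub>C x) = c *\<^sub>C \<alpha> x"
    and dual_la: "\<alpha> \<in> mcar (dual_bimodule A L) \<Longrightarrow> a \<in> A \<Longrightarrow> \<alpha> (la a x) = a o\<^sub>L \<alpha> x"
  using L_UNIV
  by (auto simp: dual_bimodule_def left_module_map_def alg_bimodule_def)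

lemma dual_memI:
  assumes "\<And>x. \<alpha> x \<in> A" "\<And>x y. \<alpha> (x + y) = \<alpha> x + \<alpha> y" "\<And>c x. \<alpha> (c *\<^sub>C x) = c *\<^sub>C \<alpha> x"
    "\<And>a x. a \<in> A \<Longrightarrow> \<alpha> (la a x) = a o\<^sub>L \<alpha> x"
  shows "\<alpha> \<in> mcar (dual_bimodule A L)"
  using assms L_UNIV by (auto simp: dual_bimodule_def left_module_map_def alg_bimodule_def)

lemma dual_lact [simp]: "lact (dual_bimodule A L) a \<alpha> = (\<lambda>x. \<alpha> (ra x a))"
  and dual_ract [simp]: "ract (dual_bimodule A L) \<alpha> a = (\<lambda>x. \<alpha> x o\<^sub>L a)"
  by (simp_all add: dual_bimodule_def)

lemma conj_mcar [simp]: "mcar (conj_bimodule L) = UNIV"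
  and conj_lact [simp]: "lact (conj_bimodule L) a x = Conj (ra (unConj x) (adj a))"
  and conj_ract [simp]: "ract (conj_bimodule L) x a = Conj (la (adj a) (unConj x))"
  by (simp_all add: conj_bimodule_def L_UNIV range_Conj)

lemma hilb_mcar [simp]: "mcar hilb_lmodule = UNIV"
  and hilb_lact [simp]: "lact hilb_lmodule = blinfun_apply"
  by (simp_all add: hilb_lmodule_def)

sublocale CT: tensor_pair A "conj_bimodule L" hilb_lmodule
  by unfold_locales auto

lemma dual_zero: "0 \<in> mcar (dual_bimodule A L)"
  by (rule dual_memI) (auto simp: A_zero)

lemma dual_plus:
  "\<alpha> \<in> mcar (dual_bimodule A L) \<Longrightarrow> \<beta> \<in> mcar (dual_bimodule A L) \<Longrightarrow>
   \<alpha> + \<beta> \<in> mcar (dual_bimodule A L)"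
  by (rule dual_memI)
    (simp_all add: A_add dual_in dual_add dual_scaleC dual_la scaleC_add_right compose_add_right)

lemma dual_lact_in:
  "\<alpha> \<in> mcar (dual_bimodule A L) \<Longrightarrow> a \<in> A \<Longrightarrow> (\<lambda>x. \<alpha> (ra x a)) \<in> mcar (dual_bimodule A L)"
  by (rule dual_memI) (simp_all add: dual_in dual_add dual_scaleC dual_la ra_add_left ra_scaleC_left ra_la)

lemma dual_ract_in:
  "\<alpha> \<in> mcar (dual_bimodule A L) \<Longrightarrow> a \<in> A \<Longrightarrow> (\<lambda>x. \<alpha> x o\<^sub>L a) \<in> mcar (dual_bimodule A L)"
  by (rule dual_memI)
    (simp_all add: dual_in dual_add dual_scaleC dual_la A_compose compose_add_left
      compose_scaleC_left blinfun_compose_assoc)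

sublocale LD: tensor_pair A L "dual_bimodule A L"
  by unfold_locales (auto simp: L_UNIV dual_zero dual_plus dual_lact_in)

sublocale DL: tensor_pair A "dual_bimodule A L" L
  by unfold_locales (auto simp: L_UNIV dual_zero dual_plus dual_ract_in)

lemma ev_balanced: "LD.balanced (\<lambda>x \<alpha>. \<alpha> x)"
  by (auto simp: LD.balanced_def dual_add)

section \<open>The metric as an A-valued inner product\<close>

lemma
  shows G_dual: "G x \<in> mcar (dual_bimodule A L)"
    and G_add: "G (x + y) = G x + G y"
    and G_scaleC: "G (c *\<^sub>C x) = c *\<^sub>C G x"
    and G_lact: "a \<in> A \<Longrightarrow> G (Conj (ra (unConj x) (adj a))) = (\<lambda>z. G x (ra z a))"
    and G_ract: "a \<in> A \<Longrightarrow> G (Conj (la (adj a) (unConj x))) = (\<lambda>z. G x z o\<^sub>L a)"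
  using metric unfolding hermitian_metric_def bimodule_map_def left_module_map_def by auto

text \<open>Removes the detour through the tensor product: the inner product is the value of a
  functional, and its bimodule rules become those of \<open>G\<close>.\<close>

lemma hip_eq: "hip A L G x (Conj y) = hp x y"
  by (simp add: hip_def ev_def LD.tensor_lift_elem[OF ev_balanced])

lemma hp_in: "hp x y \<in> A"
  by (rule dual_in[OF G_dual])

lemma hp_add_left: "hp (x + x') y = hp x y + hp x' y"
  by (rule dual_add[OF G_dual])

lemma hp_scaleC_left: "hp (c *\<^sub>C x) y = c *\<^sub>C hp x y"
  by (rule dual_scaleC[OF G_dual])

lemma hp_la_left: "a \<in> A \<Longrightarrow> hp (la a x) y = a o\<^sub>L hp x y"
  by (rule dual_la[OF G_dual])

lemma hp_add_right: "hp x (y + y') = hp x y + hp x y'"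
  by (simp add: Conj_add G_add)

lemma hp_scaleC_right: "hp x (c *\<^sub>C y) = cnj c *\<^sub>C hp x y"
  by (simp add: Conj_scaleC G_scaleC scaleC_fun_def)

text \<open>Left linearity of \<open>G\<close>, since \<open>a\<close> acts on the conjugate module
  through right multiplication by \<open>adj a\<close>.\<close>

lemma hp_ra_left: "a \<in> A \<Longrightarrow> hp (ra x a) y = hp x (ra y (adj a))"
  using G_lact[of a "Conj y"] by (simp add: fun_eq_iff)

lemma hp_la_right: "a \<in> A \<Longrightarrow> hp x (la a y) = hp x y o\<^sub>L adj a"
  using G_ract[of "adj a" "Conj y"] by (simp add: fun_eq_iff A_adj adj_adj)

lemma adj_hp: "adj (hp x y) = hp y x"
  using metric unfolding hermitian_metric_def hip_eq by metis

lemma hp_zero_left: "hp 0 y = 0"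
  using hp_scaleC_left[where c = 0 and x = 0 and y = y] by simp

lemma hp_zero_right: "hp x 0 = 0"
  using hp_scaleC_right[where c = 0 and x = x and y = 0] by simp

lemma hp_sum_left: "hp (\<Sum>i\<in>I. f i) y = (\<Sum>i\<in>I. hp (f i) y)"
  by (induction I rule: infinite_finite_induct) (auto simp: hp_zero_left hp_add_left)

lemma hp_sum_right: "hp x (\<Sum>i\<in>I. f i) = (\<Sum>i\<in>I. hp x (f i))"
  by (induction I rule: infinite_finite_induct) (auto simp: hp_zero_right hp_add_right)

section \<open>Coordinates with respect to the dual basis\<close>

lemma dual_basis: "dual_basis A L n e \<epsilon>"
  using line by (simp add: left_line_module_def)

lemma \<epsilon>_dual: "i < n \<Longrightarrow> \<epsilon> i \<in> mcar (dual_bimodule A L)"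
  using dual_basis by (simp add: dual_basis_def)

lemmas \<epsilon>_in = dual_in[OF \<epsilon>_dual]
lemmas \<epsilon>_add = dual_add[OF \<epsilon>_dual]
lemmas \<epsilon>_scaleC = dual_scaleC[OF \<epsilon>_dual]
lemmas \<epsilon>_la = dual_la[OF \<epsilon>_dual]

lemma \<epsilon>_zero: "i < n \<Longrightarrow> \<epsilon> i 0 = 0"
  using \<epsilon>_scaleC[of i 0 0] by simp

lemma \<epsilon>_sum: "i < n \<Longrightarrow> \<epsilon> i (\<Sum>j\<in>J. f j) = (\<Sum>j\<in>J. \<epsilon> i (f j))"
  by (induction J rule: infinite_finite_induct) (auto simp: \<epsilon>_zero \<epsilon>_add)

lemma expand: "x = (\<Sum>i<n. la (\<epsilon> i x) (e i))"
  using dual_basis L_UNIV unfolding dual_basis_def by blast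

text \<open>Right multiplication is left linear, so it acts on coordinates by a matrix; its entries
  \<open>\<epsilon> i (ra (e j) a)\<close> are the quantities that \<open>M\<close> bounds.\<close>

lemma \<epsilon>_ra:
  assumes "i < n" "a \<in> A"
  shows "\<epsilon> i (ra x a) = (\<Sum>j<n. \<epsilon> j x o\<^sub>L \<epsilon> i (ra (e j) a))"
proof -
  have "\<epsilon> i (ra x a) = \<epsilon> i (ra (\<Sum>j<n. la (\<epsilon> j x) (e j)) a)"
    using expand[of x] by simp
  also have "\<dots> = (\<Sum>j<n. \<epsilon> i (la (\<epsilon> j x) (ra (e j) a)))"
    using assms by (simp add: ra_sum_left \<epsilon>_sum ra_la \<epsilon>_in cong: sum.cong_simp)
  also have "\<dots> = (\<Sum>j<n. \<epsilon> j x o\<^sub>L \<epsilon> i (ra (e j) a))"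
    using assms by (intro sum.cong refl) (simp add: \<epsilon>_la \<epsilon>_in)
  finally show ?thesis .
qed

lemma hp_expand_left: "hp x y = (\<Sum>i<n. \<epsilon> i x o\<^sub>L hp (e i) y)"
proof -
  have "hp x y = hp (\<Sum>i<n. la (\<epsilon> i x) (e i)) y"
    using expand[of x] by simp
  also have "\<dots> = (\<Sum>i<n. \<epsilon> i x o\<^sub>L hp (e i) y)"
    by (simp add: hp_sum_left hp_la_left \<epsilon>_in)
  finally show ?thesis .
qed

lemma hp_expand_right: "hp x y = (\<Sum>i<n. hp x (e i) o\<^sub>L adj (\<epsilon> i y))"
proof -
  have "hp x y = hp x (\<Sum>i<n. la (\<epsilon> i y) (e i))"
    using expand[of y] by simp
  also have "\<dots> = (\<Sum>i<n. hp x (e i) o\<^sub>L adj (\<epsilon> i y))"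
    by (simp add: hp_sum_right hp_la_right \<epsilon>_in)
  finally show ?thesis .
qed

text \<open>The vector representing the coordinate functional \<open>\<epsilon> i\<close> through
  the metric; it exists because \<open>G\<close> is onto the dual. It takes the place of an inverse
  of the Gram matrix, which need not exist as the \<open>e i\<close> may be dependent.\<close>

definition dual_rep :: "nat \<Rightarrow> 'l" where
  "dual_rep i = (SOME y. G (Conj y) = \<epsilon> i)"

lemma dual_rep: "i < n \<Longrightarrow> hp x (dual_rep i) = \<epsilon> i x"
proof -
  assume "i < n"
  then have "\<epsilon> i \<in> G ` UNIV"
    using metric \<epsilon>_dual unfolding hermitian_metric_def bij_betw_def by auto
  then have "\<exists>y. G (Conj y) = \<epsilon> i"
    by (metis conj.exhaust imageE)
  then have "G (Conj (dual_rep i)) = \<epsilon> i"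
    unfolding dual_rep_def by (rule someI_ex)
  then show ?thesis by simp
qed

text \<open>The bound \<open>M\<close> on the generators passes to an arbitrary \<open>x\<close>
  through its coordinates, with a constant that depends on \<open>x\<close>.\<close>

lemma \<epsilon>_ra_bound: "\<exists>K\<ge>0. \<forall>i<n. \<forall>a\<in>A. norm (\<epsilon> i (ra x a)) \<le> K * norm a"
proof (intro exI conjI allI ballI impI)
  let ?K = "(\<Sum>j<n. norm (\<epsilon> j x) * M)"
  show "?K \<ge> 0" by (intro sum_nonneg mult_nonneg_nonneg M_nonneg) auto
  fix i a assume i: "i < n" and a: "a \<in> A"
  have "norm (\<epsilon> i (ra x a)) \<le> (\<Sum>j<n. norm (\<epsilon> j x o\<^sub>L \<epsilon> i (ra (e j) a)))"
    by (subst \<epsilon>_ra[OF i a]) (rule norm_sum)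
  also have "\<dots> \<le> (\<Sum>j<n. norm (\<epsilon> j x) * (M * norm a))"
    by (rule sum_mono, rule order_trans[OF norm_blinfun_compose mult_left_mono])
      (use M_bound i a in auto)
  finally show "norm (\<epsilon> i (ra x a)) \<le> ?K * norm a"
    by (simp add: sum_distrib_right mult.assoc)
qed

lemma ra_diff_right: "a \<in> A \<Longrightarrow> b \<in> A \<Longrightarrow> ra x (a - b) = ra x a - ra x b"
  using ra_add_right[of "a - b" b x] by (simp add: A_diff eq_diff_eq)

lemma \<epsilon>_diff: "i < n \<Longrightarrow> \<epsilon> i (x - y) = \<epsilon> i x - \<epsilon> i y"
  using \<epsilon>_add[of i "x - y" y] by (simp add: eq_diff_eq)

text \<open>As \<open>L\<close> itself carries no topology, this is the form in which the right
  action is continuous.\<close>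

lemma continuous_on_\<epsilon>_ra: "i < n \<Longrightarrow> continuous_on A (\<lambda>a. \<epsilon> i (ra x a))"
proof -
  assume i: "i < n"
  obtain K where K: "\<And>a. a \<in> A \<Longrightarrow> norm (\<epsilon> i (ra x a)) \<le> K * norm a"
    using \<epsilon>_ra_bound i by blast
  show ?thesis
    by (rule continuous_on_additive[OF _ K]) (simp_all add: ra_diff_right \<epsilon>_diff i)
qed

lemma
  shows st_add: "st (x + y) = st x + st y"
    and st_scaleC: "st (c *\<^sub>C x) = cnj c *\<^sub>C st x"
    and st_la: "a \<in> A \<Longrightarrow> st (la a x) = ra (st x) (adj a)"
    and st_ra: "a \<in> A \<Longrightarrow> st (ra x a) = la (adj a) (st x)"
    and st_st: "st (st x) = x"
  using star L_UNIV unfolding star_operation_def bimodule_map_def left_module_map_def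
  by (auto simp: plus_conj_def scaleC_conj_def)

lemma st_zero: "st 0 = 0"
  using st_scaleC[of 0 0] by simp

lemma st_sum: "st (\<Sum>i\<in>I. f i) = (\<Sum>i\<in>I. st (f i))"
  by (induction I rule: infinite_finite_induct) (auto simp: st_zero st_add)

section \<open>Coordinates on the tensor product\<close>

abbreviation TG where "TG \<equiv> tensor_group A (conj_bimodule L) (hilb_lmodule :: ('h op, 'h) lmodule)"

abbreviation tc :: "('l conj, 'h) tens \<Rightarrow> bool" where "tc X \<equiv> X \<in> carrier TG"

text \<open>The adjoint appears because conj (a.e) is (conj e).(adj a), and \<open>adj a\<close>
  then moves across the tensor sign to the vector in H.\<close>

definition \<kappa> :: "nat \<Rightarrow> ('l conj, 'h) tens \<Rightarrow> 'h" where
  "\<kappa> i = tensor_lift (\<lambda>x u. blinfun_apply (adj (\<epsilon> i (unConj x))) u)"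

lemma balanced_\<kappa>: "i < n \<Longrightarrow> CT.balanced (\<lambda>x u. blinfun_apply (adj (\<epsilon> i (unConj x))) u)"
  unfolding CT.balanced_def
  by (simp add: \<epsilon>_add \<epsilon>_in adj_add blinfun.add_left blinfun.add_right \<epsilon>_la A_adj adj_compose adj_adj)

lemma \<kappa>_elem: "i < n \<Longrightarrow> \<kappa> i (tensor_elem A (conj_bimodule L) hilb_lmodule (Conj z) u) = adj (\<epsilon> i z) u"
  by (simp add: \<kappa>_def CT.tensor_lift_elem[OF balanced_\<kappa>])

lemma \<kappa>_sum:
  "i < n \<Longrightarrow> \<kappa> i (tensor_sum A (conj_bimodule L) hilb_lmodule m (\<lambda>j. Conj (z j)) k)
     = (\<Sum>j<m. adj (\<epsilon> i (z j)) (k j))"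
  by (simp add: \<kappa>_def CT.tensor_lift_sum[OF balanced_\<kappa>])

lemma \<kappa>_mult: "i < n \<Longrightarrow> tc X \<Longrightarrow> tc Y \<Longrightarrow> \<kappa> i (X \<otimes>\<^bsub>TG\<^esub> Y) = \<kappa> i X + \<kappa> i Y"
  by (simp add: \<kappa>_def CT.tensor_lift_mult[OF _ _ balanced_\<kappa>])

lemma \<kappa>_one: "i < n \<Longrightarrow> \<kappa> i \<one>\<^bsub>TG\<^esub> = 0"
  by (simp add: \<kappa>_def CT.tensor_lift_one[OF balanced_\<kappa>])

lemma expand_Conj: "Conj x = (\<Sum>i<n. ract (conj_bimodule L) (Conj (e i)) (adj (\<epsilon> i x)))"
proof -
  have "Conj x = Conj (\<Sum>i<n. la (\<epsilon> i x) (e i))"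
    using expand[of x] by simp
  also have "\<dots> = (\<Sum>i<n. Conj (la (\<epsilon> i x) (e i)))"
    by (rule Conj_sum)
  also have "\<dots> = (\<Sum>i<n. ract (conj_bimodule L) (Conj (e i)) (adj (\<epsilon> i x)))"
    by (intro sum.cong refl) (simp add: adj_adj \<epsilon>_in)
  finally show ?thesis .
qed

text \<open>The dual basis expansion of a pure tensor, extended to formal differences. Coefficients
  of such a sum are not unique; \<open>\<kappa>\<close> provides a canonical choice.\<close>

lemma tensor_expand:
  assumes "tc X"
  shows "X = tensor_sum A (conj_bimodule L) hilb_lmodule n (\<lambda>i. Conj (e i)) (\<lambda>i. \<kappa> i X)"
proof -
  obtain t where t: "CT.formal t" "X = CT.cls t"
    using assms CT.tensor_carrier_iff by auto
  \<comment> \<open>\<open>k\<close> is \<open>\<kappa>\<close> on representatives, which makes an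
    induction over formal combinations possible.\<close>
  define k where "k i s = frag_lift (\<lambda>(x, u). blinfun_apply (adj (\<epsilon> i (unConj x))) u) s" for i s
  have k: "\<kappa> i X = k i t" if "i < n" for i
    using CT.tensor_lift_cls[OF balanced_\<kappa>[OF that]] by (simp add: \<kappa>_def k_def t)
  have "CT.cls t = CT.cls (\<Sum>i<n. frag_of (Conj (e i), k i t))"
    using t(1)[unfolded CT.formal_def]
  proof (induction t rule: frag_induction)
    case zero
    have "CT.cls (\<Sum>i<n. frag_of (Conj (e i), k i 0)) = CT.cls (\<Sum>i<n. 0)"
      by (intro CT.cls_cong_sum) (simp add: k_def CT.cls_frag_of_zero_right)
    then show ?case by simp
  next
    case (one p)
    obtain x u where p: "p = (Conj x, u)"
      by (metis conj.exhaust surj_pair)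
    have "CT.cls (frag_of (Conj x, u))
        = CT.cls (\<Sum>i<n. frag_of (ract (conj_bimodule L) (Conj (e i)) (adj (\<epsilon> i x)), u))"
      by (subst expand_Conj) (rule CT.cls_frag_of_sum_left; simp)
    also have "\<dots> = CT.cls (\<Sum>i<n. frag_of (Conj (e i), lact hilb_lmodule (adj (\<epsilon> i x)) u))"
      by (intro CT.cls_cong_sum CT.cls_frag_of_balanced) (simp_all add: A_adj \<epsilon>_in)
    finally show ?case
      by (simp add: p k_def)
  next
    case (diff a b)
    have "CT.cls (a - b) = CT.cls ((\<Sum>i<n. frag_of (Conj (e i), k i a)) - (\<Sum>i<n. frag_of (Conj (e i), k i b)))"
      by (rule CT.cls_cong_diff[OF diff])
    also have "\<dots> = CT.cls (\<Sum>i<n. frag_of (Conj (e i), k i a) - frag_of (Conj (e i), k i b))"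
      by (simp add: sum_subtractf)
    also have "\<dots> = CT.cls (\<Sum>i<n. frag_of (Conj (e i), k i (a - b)))"
      by (intro CT.cls_cong_sum) (simp add: k_def frag_lift_diff CT.cls_frag_of_diff_right)
    finally show ?case .
  qed
  moreover have "(\<Sum>i<n. frag_of (Conj (e i), \<kappa> i X)) = (\<Sum>i<n. frag_of (Conj (e i), k i t))"
    by (simp add: k)
  ultimately show ?thesis
    by (simp only: t(2)[symmetric] CT.tensor_sum_eq)
qed

text \<open>Equations between elements of conj L \<otimes> H are proved through this rule, without
  returning to cosets.\<close>

lemma tensor_eqI:
  assumes "tc X" "tc Y" "\<And>i. i < n \<Longrightarrow> \<kappa> i X = \<kappa> i Y"
  shows "X = Y"
proof -
  have "X = tensor_sum A (conj_bimodule L) hilb_lmodule n (\<lambda>i. Conj (e i)) (\<lambda>i. \<kappa> i X)"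
    by (rule tensor_expand[OF assms(1)])
  also have "\<dots> = tensor_sum A (conj_bimodule L) hilb_lmodule n (\<lambda>i. Conj (e i)) (\<lambda>i. \<kappa> i Y)"
    by (simp add: CT.tensor_sum_eq assms(3))
  also have "\<dots> = Y"
    by (rule tensor_expand[OF assms(2), symmetric])
  finally show ?thesis .
qed

text \<open>A map that depends on \<open>x\<close> and \<open>u\<close> only through the vectors
  \<open>adj (\<epsilon> j x) u\<close>, and linearly so, lifts to the same expression in the
  coordinates. This pointwise form also supplies balancedness, term by term.\<close>

lemma tensor_lift_coords:
  assumes "tc X" "\<And>j. j < n \<Longrightarrow> linear (T j)"
    and "\<And>x u. f (Conj x) u = (\<Sum>j<n. T j (blinfun_apply (adj (\<epsilon> j x)) u))"
  shows "tensor_lift f X = (\<Sum>j<n. T j (\<kappa> j X))"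
proof -
  have "tensor_lift f X = tensor_lift (\<lambda>x u. \<Sum>j<n. T j (blinfun_apply (adj (\<epsilon> j (unConj x))) u)) X"
    using assms(3) by (intro CT.tensor_lift_cong assms(1)) (metis conj.collapse)
  also have "\<dots> = (\<Sum>j<n. tensor_lift (\<lambda>x u. T j (blinfun_apply (adj (\<epsilon> j (unConj x))) u)) X)"
  proof (rule CT.tensor_lift_sum_left[OF assms(1)])
    fix j assume "j \<in> {..<n}"
    then show "CT.balanced (\<lambda>x u. T j (blinfun_apply (adj (\<epsilon> j (unConj x))) u))"
      using balanced_\<kappa>[of j] by (simp add: CT.balanced_def linear_add[OF assms(2)])
  qed
  also have "\<dots> = (\<Sum>j<n. T j (\<kappa> j X))"
    unfolding \<kappa>_def
    by (intro sum.cong refl CT.tensor_lift_linear assms(1,2) balanced_\<kappa>) auto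
  finally show ?thesis .
qed

lemma tensor_lift_hp:
  assumes "tc X"
  shows "tensor_lift (\<lambda>x u. blinfun_apply (hip A L G z x) u) X = (\<Sum>j<n. hp z (e j) (\<kappa> j X))"
proof (rule tensor_lift_coords[OF assms linear_blinfun_apply])
  fix x u
  show "blinfun_apply (hip A L G z (Conj x)) u = (\<Sum>j<n. hp z (e j) (adj (\<epsilon> j x) u))"
    unfolding hip_eq by (subst hp_expand_right) (simp add: blinfun.sum_left)
qed

lemma inner_tens_coords:
  assumes X: "tc X" and Y: "tc Y"
  shows "inner_tens A L G X Y = (\<Sum>i<n. \<Sum>j<n. cinner (\<kappa> i X) (hp (e i) (e j) (\<kappa> j Y)))"
proof -
  have inner: "tensor_lift (\<lambda>y' v. cinner u (blinfun_apply (hip A L G y y') v)) Y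
      = (\<Sum>j<n. cinner u (hp y (e j) (\<kappa> j Y)))" for y u
  proof (rule tensor_lift_coords[OF Y])
    show "linear (\<lambda>w. cinner u (hp y (e j) w))" for j
      using linear_compose[OF linear_blinfun_apply linear_cinner] by (simp add: o_def)
    show "cinner u (blinfun_apply (hip A L G y (Conj x)) v)
        = (\<Sum>j<n. cinner u (hp y (e j) (adj (\<epsilon> j x) v)))" for x v
      unfolding hip_eq by (subst hp_expand_right) (simp add: blinfun.sum_left cinner_sum_right)
  qed
  show ?thesis
    unfolding inner_tens_def inner
  proof (rule tensor_lift_coords[OF X])
    \<comment> \<open>Conjugate linearity in this argument is enough, as \<open>linear\<close> means
      linearity over the reals.\<close>
    show "linear (\<lambda>w. \<Sum>j<n. cinner w (hp (e i) (e j) (\<kappa> j Y)))" for i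
      by (rule linearI) (simp_all add: cinner_add_left cinner_scaleR_left sum.distrib
          scaleR_conv_of_real sum_distrib_left)
    fix x u
    have "hp x (e j) w = (\<Sum>i<n. \<epsilon> i x (hp (e i) (e j) w))" for j w
      by (subst hp_expand_left) (simp add: blinfun.sum_left)
    then have "(\<Sum>j<n. cinner u (hp x (e j) (\<kappa> j Y)))
        = (\<Sum>j<n. \<Sum>i<n. cinner u (\<epsilon> i x (hp (e i) (e j) (\<kappa> j Y))))"
      by (simp add: cinner_sum_right)
    also have "\<dots> = (\<Sum>i<n. \<Sum>j<n. cinner (adj (\<epsilon> i x) u) (hp (e i) (e j) (\<kappa> j Y)))"
      by (subst sum.swap) (simp add: cinner_adj_left \<epsilon>_in)
    finally show "(\<Sum>j<n. cinner u (hp (unConj (Conj x)) (e j) (\<kappa> j Y)))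
        = (\<Sum>i<n. \<Sum>j<n. cinner (adj (\<epsilon> i x) u) (hp (e i) (e j) (\<kappa> j Y)))"
      by simp
  qed
qed

lemma tensor_hom_scaleC:
  "tensor_hom A (conj_bimodule L) hilb_lmodule (conj_bimodule L) hilb_lmodule id (scaleC c :: 'h \<Rightarrow> 'h)"
  by unfold_locales (auto simp: scaleC_add_right A_apply_scaleC)

lemma tensor_hom_lact:
  "a \<in> A \<Longrightarrow> tensor_hom A (conj_bimodule L) hilb_lmodule (conj_bimodule L) hilb_lmodule
     (\<lambda>x. Conj (ra (unConj x) (adj a))) id"
  by unfold_locales (auto simp: Conj_add ra_add_left A_adj ra_la)

lemma tc_scaleC: "tc X \<Longrightarrow> tc (tensor_map A (conj_bimodule L) hilb_lmodule id (scaleC c) X)"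
  by (rule tensor_hom.tensor_map_closed[OF tensor_hom_scaleC])

lemma tc_lact: "a \<in> A \<Longrightarrow> tc X \<Longrightarrow>
    tc (tensor_map A (conj_bimodule L) hilb_lmodule (\<lambda>x. Conj (ra (unConj x) (adj a))) id X)"
  by (rule tensor_hom.tensor_map_closed[OF tensor_hom_lact])

lemma \<kappa>_scaleC:
  assumes "i < n" "tc X"
  shows "\<kappa> i (tensor_map A (conj_bimodule L) hilb_lmodule id (scaleC c) X) = c *\<^sub>C \<kappa> i X"
proof -
  have lin: "linear (scaleC c :: 'h \<Rightarrow> 'h)"
    by (rule linearI) (simp_all add: scaleC_add_right scaleC_scaleR)
  have "\<kappa> i (tensor_map A (conj_bimodule L) hilb_lmodule id (scaleC c) X)
      = tensor_lift (\<lambda>x u. c *\<^sub>C blinfun_apply (adj (\<epsilon> i (unConj x))) u) X"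
    unfolding \<kappa>_def
    by (subst tensor_hom.tensor_lift_map[OF tensor_hom_scaleC assms(2) balanced_\<kappa>[OF assms(1)]])
      (simp add: A_apply_scaleC A_adj \<epsilon>_in assms(1))
  also have "\<dots> = c *\<^sub>C \<kappa> i X"
    unfolding \<kappa>_def by (rule CT.tensor_lift_linear[OF assms(2) lin balanced_\<kappa>[OF assms(1)]])
  finally show ?thesis .
qed

text \<open>The left action on the conjugate is right multiplication by \<open>adj a\<close> on
  \<open>L\<close>, so its matrix is that of \<open>\<epsilon>_ra\<close> with adjoints taken
  entrywise.\<close>

lemma \<kappa>_lact:
  assumes "i < n" "a \<in> A" "tc X"
  shows "\<kappa> i (tensor_map A (conj_bimodule L) hilb_lmodule (\<lambda>x. Conj (ra (unConj x) (adj a))) id X)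
    = (\<Sum>j<n. adj (\<epsilon> i (ra (e j) (adj a))) (\<kappa> j X))"
proof -
  have "\<kappa> i (tensor_map A (conj_bimodule L) hilb_lmodule (\<lambda>x. Conj (ra (unConj x) (adj a))) id X)
      = tensor_lift (\<lambda>x u. blinfun_apply (adj (\<epsilon> i (ra (unConj x) (adj a)))) u) X"
    unfolding \<kappa>_def
    by (subst tensor_hom.tensor_lift_map[OF tensor_hom_lact[OF assms(2)] assms(3) balanced_\<kappa>[OF assms(1)]])
      simp
  also have "\<dots> = (\<Sum>j<n. adj (\<epsilon> i (ra (e j) (adj a))) (\<kappa> j X))"
  proof (rule tensor_lift_coords[OF assms(3) linear_blinfun_apply])
    fix x u
    have "adj (\<epsilon> i (ra x (adj a))) = adj (\<Sum>j<n. \<epsilon> j x o\<^sub>L \<epsilon> i (ra (e j) (adj a)))"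
      using assms(1,2) by (subst \<epsilon>_ra) (simp_all add: A_adj)
    also have "\<dots> = (\<Sum>j<n. adj (\<epsilon> j x o\<^sub>L \<epsilon> i (ra (e j) (adj a))))"
      by (rule adj_sum) (simp add: A_compose \<epsilon>_in assms(1))
    also have "\<dots> = (\<Sum>j<n. adj (\<epsilon> i (ra (e j) (adj a))) o\<^sub>L adj (\<epsilon> j x))"
      by (simp add: adj_compose \<epsilon>_in assms(1))
    finally show "blinfun_apply (adj (\<epsilon> i (ra (unConj (Conj x)) (adj a)))) u
        = (\<Sum>j<n. adj (\<epsilon> i (ra (e j) (adj a))) (adj (\<epsilon> j x) u))"
      by (simp add: blinfun.sum_left)
  qed
  finally show ?thesis .
qed

text \<open>The functions \<open>k i\<close> of the definition need not be the coordinates; the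
  constant matrix \<open>adj (\<epsilon> i (e j))\<close> turns them into coordinates and preserves
  continuity and compact support.\<close>

lemma mem_H1_iff:
  "X \<in> H1 A L n e \<longleftrightarrow> (\<forall>x. tc (X x)) \<and> (\<forall>i<n. (\<lambda>x. \<kappa> i (X x)) \<in> Cc UNIV)"
proof
  assume "X \<in> H1 A L n e"
  then obtain k where k: "\<And>i. i < n \<Longrightarrow> k i \<in> Cc UNIV"
    and X: "X = (\<lambda>x. tensor_sum A (conj_bimodule L) hilb_lmodule n (\<lambda>i. Conj (e i)) (\<lambda>i. k i x))"
    by (auto simp: H1_def)
  have "(\<lambda>x. \<Sum>j<n. adj (\<epsilon> i (e j)) (k j x)) \<in> Cc UNIV" for i
    by (rule Cc_sum) (auto intro!: Cc_bilinear_right[OF bounded_bilinear_blinfun_apply _ k])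
  then show "(\<forall>x. tc (X x)) \<and> (\<forall>i<n. (\<lambda>x. \<kappa> i (X x)) \<in> Cc UNIV)"
    by (simp add: X \<kappa>_sum CT.tensor_sum_closed)
next
  assume X: "(\<forall>x. tc (X x)) \<and> (\<forall>i<n. (\<lambda>x. \<kappa> i (X x)) \<in> Cc UNIV)"
  then have "X = (\<lambda>x. tensor_sum A (conj_bimodule L) hilb_lmodule n (\<lambda>i. Conj (e i)) (\<lambda>i. \<kappa> i (X x)))"
    using tensor_expand by blast
  then show "X \<in> H1 A L n e"
    unfolding H1_def using X by (intro CollectI exI[of _ "\<lambda>i x. \<kappa> i (X x)"]) simp
qed

text \<open>A condition on coordinates, as \<open>L\<close> has no topology. Arbitrary coefficient
  functions give the same set, since the constant matrix \<open>\<epsilon> i (e j)\<close> turns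
  them into coordinates.\<close>

definition L_Cc :: "(real \<Rightarrow> 'l) set" where
  "L_Cc = {f. \<forall>i<n. (\<lambda>x. \<epsilon> i (f x)) \<in> Cc A}"

lemma L_Cc_eq: "{(\<lambda>x. \<Sum>i<n. la (c i x) (e i)) | c. \<forall>i<n. c i \<in> Cc A} = L_Cc"
proof (intro equalityI subsetI)
  fix f assume "f \<in> {(\<lambda>x. \<Sum>i<n. la (c i x) (e i)) | c. \<forall>i<n. c i \<in> Cc A}"
  then obtain c where c: "\<And>i. i < n \<Longrightarrow> c i \<in> Cc A" and f: "f = (\<lambda>x. \<Sum>i<n. la (c i x) (e i))"
    by blast
  have "(\<lambda>x. \<epsilon> i (f x)) = (\<lambda>x. \<Sum>j<n. c j x o\<^sub>L \<epsilon> i (e j))" if "i < n" for i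
    by (intro ext) (simp add: f \<epsilon>_sum \<epsilon>_la that Cc_range[OF c])
  moreover have "(\<lambda>x. \<Sum>j<n. c j x o\<^sub>L \<epsilon> i (e j)) \<in> Cc A" if "i < n" for i
    by (rule Cc_sum)
      (auto intro!: Cc_bilinear_left[OF bounded_bilinear_blinfun_compose c] A_zero A_add A_compose
        \<epsilon>_in[OF that] Cc_range[OF c])
  ultimately show "f \<in> L_Cc"
    by (simp add: L_Cc_def)
next
  fix f assume f: "f \<in> L_Cc"
  have "f = (\<lambda>x. \<Sum>i<n. la (\<epsilon> i (f x)) (e i))"
    using expand by blast
  then show "f \<in> {(\<lambda>x. \<Sum>i<n. la (c i x) (e i)) | c. \<forall>i<n. c i \<in> Cc A}"
    using f unfolding L_Cc_def by (intro CollectI exI[of _ "\<lambda>i x. \<epsilon> i (f x)"]) simp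
qed

lemma fpairs_eq: "fpairs A L n e F0 = F0 \<times> L_Cc"
  by (simp add: fpairs_def L_Cc_eq)

section \<open>The A-bilinear pairing of L with itself\<close>

abbreviation pr where "pr x y \<equiv> hp x (st y)"
abbreviation Gst where "Gst \<equiv> metric_star G st"

lemma Gst_apply: "Gst y x = pr x y"
  by (simp add: metric_star_def)

lemma pr_ra_left: "a \<in> A \<Longrightarrow> pr (ra x a) y = pr x (la a y)"
  by (simp add: hp_ra_left st_la)

lemma pr_ra_right: "a \<in> A \<Longrightarrow> pr x (ra y a) = pr x y o\<^sub>L a"
  by (simp add: st_ra hp_la_right A_adj adj_adj)

lemma pr_add_right: "pr x (y + z) = pr x y + pr x z"
  by (simp add: st_add hp_add_right)

lemma Gst_dual: "Gst y \<in> mcar (dual_bimodule A L)"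
  by (simp add: metric_star_def G_dual)

lemma Gst_inj: "inj Gst"
proof (rule injI)
  fix x y assume "Gst x = Gst y"
  then have "G (Conj (st x)) = G (Conj (st y))"
    by (simp add: metric_star_def)
  moreover have "inj G"
    using metric by (simp add: hermitian_metric_def bij_betw_def)
  ultimately have "Conj (st x) = Conj (st y)"
    by (rule injD[rotated])
  then show "x = y" by (metis conj.inject st_st)
qed

lemma Gst_surj: "\<alpha> \<in> mcar (dual_bimodule A L) \<Longrightarrow> \<alpha> \<in> range Gst"
proof -
  assume "\<alpha> \<in> mcar (dual_bimodule A L)"
  moreover have "range G = mcar (dual_bimodule A L)"
    using metric by (simp add: hermitian_metric_def bij_betw_def)
  ultimately obtain y where "\<alpha> = G (Conj y)"
    by (metis conj.exhaust imageE)
  then have "\<alpha> = Gst (st y)" by (simp add: metric_star_def st_st)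
  then show ?thesis by blast
qed

abbreviation iG where "iG \<equiv> inv_into UNIV Gst"

lemma Gst_iG: "\<alpha> \<in> mcar (dual_bimodule A L) \<Longrightarrow> Gst (iG \<alpha>) = \<alpha>"
  by (rule f_inv_into_f[OF Gst_surj])

lemma iG_eqI: "Gst y = \<alpha> \<Longrightarrow> iG \<alpha> = y"
  using Gst_inj by (simp add: inv_f_eq)

lemma Gst_add: "Gst (x + y) = Gst x + Gst y"
  by (simp add: fun_eq_iff Gst_apply pr_add_right)

lemma Gst_ra: "a \<in> A \<Longrightarrow> Gst (ra y a) = (\<lambda>x. Gst y x o\<^sub>L a)"
  by (simp add: fun_eq_iff Gst_apply pr_ra_right)

lemma Gst_la: "a \<in> A \<Longrightarrow> Gst (la a y) = (\<lambda>x. Gst y (ra x a))"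
  by (simp add: fun_eq_iff Gst_apply pr_ra_left)

lemma iG_add: "\<alpha> \<in> mcar (dual_bimodule A L) \<Longrightarrow> \<beta> \<in> mcar (dual_bimodule A L) \<Longrightarrow>
    iG (\<alpha> + \<beta>) = iG \<alpha> + iG \<beta>"
  by (rule iG_eqI) (simp add: Gst_add Gst_iG)

lemma iG_ract: "\<alpha> \<in> mcar (dual_bimodule A L) \<Longrightarrow> a \<in> A \<Longrightarrow> iG (\<lambda>x. \<alpha> x o\<^sub>L a) = ra (iG \<alpha>) a"
  by (rule iG_eqI) (simp add: Gst_ra Gst_iG)

lemma iG_lact: "\<alpha> \<in> mcar (dual_bimodule A L) \<Longrightarrow> a \<in> A \<Longrightarrow> iG (\<lambda>x. \<alpha> (ra x a)) = la a (iG \<alpha>)"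
  by (rule iG_eqI) (simp add: Gst_la Gst_iG)

lemma tensor_hom_Gst: "tensor_hom A (dual_bimodule A L) L L (dual_bimodule A L) iG Gst"
  by unfold_locales
    (simp_all add: L_UNIV iG_add iG_ract Gst_dual Gst_add Gst_la)

text \<open>Star compatibility with \<open>coev\<close> written out. Multiplied by an element of
  \<open>A\<close>, it exhibits that element as the evaluation of a sum over the dual basis, to be
  compared with any other tensor of the same evaluation.\<close>

lemma pr_dual_basis: "(\<Sum>i<n. pr (iG (\<epsilon> i)) (e i)) = id_blinfun"
proof -
  have "ev (tensor_map A L (dual_bimodule A L) iG Gst (coev A L n e \<epsilon> id_blinfun)) = id_blinfun"
    using compatible by (simp add: star_compatible_def)
  then show ?thesis
    by (simp add: coev_def ra_id tensor_hom.tensor_map_sum[OF tensor_hom_Gst] ev_def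
        LD.tensor_lift_sum[OF ev_balanced] Gst_apply)
qed

lemma pr_iG: "i < n \<Longrightarrow> pr x (iG (\<epsilon> i)) = \<epsilon> i x"
  using Gst_apply[of "iG (\<epsilon> i)" x] by (simp add: Gst_iG \<epsilon>_dual)

text \<open>Both \<open>y \<otimes> Gst z\<close> and \<open>\<Sum>i. iG (\<epsilon> i) \<otimes> Gst (e i.(y, z))\<close> evaluate to \<open>(y, z)\<close>, where \<open>(y, z) = pr y z\<close>, so
  they agree; the claim is the image of this equation under \<open>w \<otimes> \<alpha> \<mapsto> (x, w).iG \<alpha>\<close>.\<close>

lemma pr_associative: "la (pr x y) z = ra x (pr y z)"
proof -
  define F where "F w \<alpha> = la (pr x w) (iG \<alpha>)" for w \<alpha>
  define X1 where "X1 = tensor_elem A L (dual_bimodule A L) y (Gst z)"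
  define X2 where "X2 = tensor_sum A L (dual_bimodule A L) n (\<lambda>i. iG (\<epsilon> i))
      (\<lambda>i. Gst (ra (e i) (pr y z)))"
  have bal: "LD.balanced F"
    by (auto simp: LD.balanced_def F_def pr_add_right la_add_left la_add_right hp_in iG_add iG_lact
        pr_ra_right la_compose)
  have "ev X2 = (\<Sum>i<n. pr (iG (\<epsilon> i)) (e i)) o\<^sub>L pr y z"
    by (simp add: X2_def ev_def LD.tensor_lift_sum[OF ev_balanced] Gst_apply pr_ra_right hp_in
        compose_sum_left)
  also have "\<dots> = ev X1"
    by (simp add: pr_dual_basis X1_def ev_def LD.tensor_lift_elem[OF ev_balanced] Gst_apply)
  finally have "X2 = X1"
    using line unfolding left_line_module_def bij_betw_def
    by (elim conjE) (erule inj_onD; simp add: X1_def X2_def LD.tensor_elem_closed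
        LD.tensor_sum_closed L_UNIV Gst_dual)
  then have "tensor_lift F X2 = tensor_lift F X1" by simp
  moreover have "tensor_lift F X1 = la (pr x y) z"
    by (simp add: X1_def LD.tensor_lift_elem[OF bal] F_def iG_eqI)
  moreover have "tensor_lift F X2 = (\<Sum>i<n. ra (la (\<epsilon> i x) (e i)) (pr y z))"
    unfolding X2_def LD.tensor_lift_sum[OF bal]
    by (intro sum.cong refl) (simp add: F_def iG_eqI pr_iG ra_la \<epsilon>_in hp_in)
  moreover have "(\<Sum>i<n. ra (la (\<epsilon> i x) (e i)) (pr y z)) = ra x (pr y z)"
    using expand[of x] by (simp add: ra_sum_left[symmetric] hp_in)
  ultimately show ?thesis by simp
qed

lemma hp_associative: "la (hp x y) z = ra x (hp (st y) (st z))"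
  using pr_associative[where x = x and y = "st y" and z = z] by (simp add: st_st)

section \<open>The inner product\<close>

abbreviation V where "V \<equiv> H01 A L n e"

lemma mem_V_iff:
  "v \<in> V \<longleftrightarrow> fst v \<in> Clim UNIV UNIV \<and> (\<forall>x. tc (snd v x)) \<and> (\<forall>i<n. (\<lambda>x. \<kappa> i (snd v x)) \<in> Cc UNIV)"
  by (cases v) (auto simp: H01_def C_inf_eq_Clim mem_H1_iff)

lemma V_tc: "v \<in> V \<Longrightarrow> tc (snd v x)"
  by (simp add: mem_V_iff)

lemma V_fst: "v \<in> V \<Longrightarrow> fst v \<in> Clim UNIV UNIV"
  by (simp add: mem_V_iff)

lemma V_\<kappa>: "v \<in> V \<Longrightarrow> i < n \<Longrightarrow> (\<lambda>x. \<kappa> i (snd v x)) \<in> Cc UNIV"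
  by (simp add: mem_V_iff)

lemma vec_eqI:
  assumes "\<And>x. tc (snd v x)" "\<And>x. tc (snd w x)" "\<And>x. fst v x = fst w x"
    "\<And>i x. i < n \<Longrightarrow> \<kappa> i (snd v x) = \<kappa> i (snd w x)"
  shows "v = w"
  using assms by (intro prod_eqI ext tensor_eqI) auto

lemma vec_zero_coords:
  "fst (vec_zero A L) = (\<lambda>x. 0)" "tc (snd (vec_zero A L) x)" "i < n \<Longrightarrow> \<kappa> i (snd (vec_zero A L) x) = 0"
  by (simp_all add: vec_zero_def CT.tensor_one_closed \<kappa>_one)

lemma vec_add_coords:
  assumes "\<And>x. tc (snd v x)" "\<And>x. tc (snd w x)"
  shows "fst (vec_add A L v w) x = fst v x + fst w x" "tc (snd (vec_add A L v w) x)"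
    "i < n \<Longrightarrow> \<kappa> i (snd (vec_add A L v w) x) = \<kappa> i (snd v x) + \<kappa> i (snd w x)"
  using assms by (simp_all add: vec_add_def CT.tensor_mult_closed \<kappa>_mult)

lemma vec_scale_coords:
  assumes "\<And>x. tc (snd v x)"
  shows "fst (vec_scale A L c v) x = c *\<^sub>C fst v x" "tc (snd (vec_scale A L c v) x)"
    "i < n \<Longrightarrow> \<kappa> i (snd (vec_scale A L c v) x) = c *\<^sub>C \<kappa> i (snd v x)"
  using assms by (simp_all add: vec_scale_def tc_scaleC \<kappa>_scaleC)

lemma vec_zero_V: "vec_zero A L \<in> V"
  by (simp add: mem_V_iff vec_zero_coords Clim_const Cc_zero)

lemma vec_add_V:
  assumes "v \<in> V" "w \<in> V"
  shows "vec_add A L v w \<in> V"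
proof -
  have "fst (vec_add A L v w) = (\<lambda>x. fst v x + fst w x)"
    by (simp add: vec_add_def)
  moreover have "(\<lambda>x. fst v x + fst w x) \<in> Clim UNIV UNIV"
    by (rule Clim_add[OF V_fst[OF assms(1)] V_fst[OF assms(2)]]) auto
  moreover have "(\<lambda>x. \<kappa> i (snd v x) + \<kappa> i (snd w x)) \<in> Cc UNIV" if "i < n" for i
    by (rule Cc_add[OF V_\<kappa>[OF assms(1) that] V_\<kappa>[OF assms(2) that]]) auto
  ultimately show ?thesis
    using assms unfolding mem_V_iff by (simp add: vec_add_coords)
qed

lemma vec_scale_V:
  assumes "v \<in> V"
  shows "vec_scale A L c v \<in> V"
proof -
  have "fst (vec_scale A L c v) = (\<lambda>x. c *\<^sub>C fst v x)"
    by (simp add: vec_scale_def)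
  moreover have "(\<lambda>x. c *\<^sub>C fst v x) \<in> Clim UNIV UNIV"
    by (rule Clim_comp[OF V_fst[OF assms]]) (auto intro: continuous_on_scaleC)
  moreover have "(\<lambda>x. c *\<^sub>C \<kappa> i (snd v x)) \<in> Cc UNIV" if "i < n" for i
    by (rule Cc_comp[OF V_\<kappa>[OF assms that]]) (auto intro: continuous_on_scaleC)
  ultimately show ?thesis
    using assms unfolding mem_V_iff by (simp add: vec_scale_coords)
qed

text \<open>The numerator of the integrand of \<open>inner01\<close> once the tensor part is in
  coordinates.\<close>

definition fibre_form :: "('h, 'l) vec \<Rightarrow> ('h, 'l) vec \<Rightarrow> real \<Rightarrow> complex" where
  "fibre_form v w x = cinner (fst v x) (fst w x) + of_real (x\<^sup>2) *
     (\<Sum>i<n. \<Sum>j<n. cinner (\<kappa> i (snd v x)) (hp (e i) (e j) (\<kappa> j (snd w x))))"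

lemma inner01_eq:
  assumes "\<And>x. tc (snd v x)" "\<And>x. tc (snd w x)"
  shows "inner01 A L G v w = (LINT x|lborel. fibre_form v w x / complex_of_real (1 + x\<^sup>2))"
  using assms by (simp add: inner01_def inner_tens_coords fibre_form_def)

text \<open>The second summand has compact support in spite of the weight, so only the first
  contributes at infinity. Boundedness, and with it integrability, follows.\<close>

lemma fibre_form_Clim:
  assumes v: "v \<in> V" and w: "w \<in> V"
  shows "fibre_form v w \<in> Clim UNIV UNIV"
proof -
  have "(\<lambda>x. cinner (fst v x) (fst w x)) \<in> Clim UNIV UNIV"
    by (rule Clim_bilinear[OF bounded_bilinear_cinner V_fst[OF v] V_fst[OF w]]) auto
  moreover have "(\<lambda>x. of_real (x\<^sup>2) *
     (\<Sum>i<n. \<Sum>j<n. cinner (\<kappa> i (snd v x)) (hp (e i) (e j) (\<kappa> j (snd w x))))) \<in> Cc UNIV"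
    by (rule Cc_bilinear_right[OF bounded_bilinear_mult])
      (auto intro!: continuous_intros Cc_sum Cc_bilinear_left[OF bounded_bilinear_cinner V_\<kappa>[OF v]]
        Cc_continuous[OF V_\<kappa>[OF w]])
  ultimately show ?thesis
    unfolding fibre_form_def[abs_def]
    by (rule Clim_add[OF _ subsetD[OF Cc_subset_Clim]]) auto
qed

lemma fibre_form_integrable:
  assumes "v \<in> V" "w \<in> V"
  shows "integrable lborel (\<lambda>x. fibre_form v w x / complex_of_real (1 + x\<^sup>2))"
proof -
  obtain K where "\<And>x. norm (fibre_form v w x) \<le> K"
    using Clim_bounded[OF fibre_form_Clim[OF assms]] by blast
  then show ?thesis
    by (intro integrable_div_one_plus_square[of _ K] Clim_continuous[OF fibre_form_Clim[OF assms]])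
qed

lemma cinner_hp: "cinner u (hp x y w) = cinner (hp y x u) w"
  using cinner_adj_left[OF hp_in[where x = x and y = y]] by (simp add: adj_hp)

lemma fibre_form_commute: "fibre_form v w x = cnj (fibre_form w v x)"
proof -
  have "(\<Sum>i<n. \<Sum>j<n. cinner (\<kappa> i (snd v x)) (hp (e i) (e j) (\<kappa> j (snd w x))))
      = (\<Sum>j<n. \<Sum>i<n. cnj (cinner (\<kappa> j (snd w x)) (hp (e j) (e i) (\<kappa> i (snd v x)))))"
    by (subst sum.swap) (simp add: cinner_hp cinner_commute[symmetric])
  then show ?thesis
    by (simp add: fibre_form_def cinner_commute[symmetric])
qed

lemma fibre_form_add_right:
  assumes "\<And>x. tc (snd v x)" "\<And>x. tc (snd w x)"
  shows "fibre_form u (vec_add A L v w) x = fibre_form u v x + fibre_form u w x"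
  by (simp add: fibre_form_def vec_add_coords[OF assms] cinner_add_right blinfun.add_right
      sum.distrib distrib_left)

lemma hp_apply_scaleC: "hp x y (c *\<^sub>C u) = c *\<^sub>C hp x y u"
  by (rule A_apply_scaleC[OF hp_in])

lemma fibre_form_scale_right:
  assumes "\<And>x. tc (snd w x)"
  shows "fibre_form v (vec_scale A L c w) x = c * fibre_form v w x"
  by (simp add: fibre_form_def vec_scale_coords[OF assms] cinner_scaleC_right hp_apply_scaleC
      sum_distrib_left distrib_left mult.left_commute)

text \<open>Since \<open>r\<^sup>2\<close> is the Gram matrix, the inner product is the standard one in terms of \<open>\<rho>\<close>.\<close>

definition \<rho> :: "nat \<Rightarrow> ('l conj, 'h) tens \<Rightarrow> 'h" where
  "\<rho> p X = (\<Sum>j<n. r p j (\<kappa> j X))"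

definition fibre_norm2 :: "('h, 'l) vec \<Rightarrow> real \<Rightarrow> real" where
  "fibre_norm2 v x = (norm (fst v x))\<^sup>2 + x\<^sup>2 * (\<Sum>p<n. (norm (\<rho> p (snd v x)))\<^sup>2)"

lemma r_in: "i < n \<Longrightarrow> j < n \<Longrightarrow> r i j \<in> A"
  using root by blast

lemma cinner_r: "i < n \<Longrightarrow> p < n \<Longrightarrow> cinner u (r i p w) = cinner (r p i u) w"
  using cinner_adj_left[OF r_in[of i p]] root by simp

lemma hp_root:
  assumes "i < n" "j < n"
  shows "hp (e i) (e j) w = (\<Sum>p<n. r i p (r p j w))"
proof -
  have "hp (e i) (e j) = (\<Sum>p<n. r i p o\<^sub>L r p j)"
    using root_square assms by (simp add: hip_eq)
  then show ?thesis by (simp add: blinfun.sum_left)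
qed

lemma fibre_form_self: "fibre_form v v x = of_real (fibre_norm2 v x)"
proof -
  let ?k = "\<lambda>i. \<kappa> i (snd v x)"
  have "(\<Sum>i<n. \<Sum>j<n. cinner (?k i) (hp (e i) (e j) (?k j)))
      = (\<Sum>i<n. \<Sum>j<n. \<Sum>p<n. cinner (r p i (?k i)) (r p j (?k j)))"
    by (intro sum.cong refl) (simp add: hp_root cinner_sum_right cinner_r)
  also have "\<dots> = (\<Sum>p<n. \<Sum>i<n. \<Sum>j<n. cinner (r p i (?k i)) (r p j (?k j)))"
    by (subst sum.swap[where A = "{..<n}" and B = "{..<n}" and g = "\<lambda>j p. _ j p"], rule sum.swap)
  also have "\<dots> = (\<Sum>p<n. cinner (\<rho> p (snd v x)) (\<rho> p (snd v x)))"
    unfolding \<rho>_def cinner_sum_left by (simp only: cinner_sum_right)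
  finally show ?thesis
    by (simp add: fibre_form_def fibre_norm2_def cinner_self)
qed

lemma fibre_norm2_nonneg: "fibre_norm2 v x \<ge> 0"
  by (simp add: fibre_norm2_def sum_nonneg)

text \<open>Coordinate \<open>i\<close> is the pairing with \<open>dual_rep i\<close>. Expanding
  that vector in the dual basis leaves rows of the Gram matrix applied to the coordinates, and
  factoring the Gram matrix through \<open>r\<close> collects them into
  \<open>\<rho>\<close>.\<close>

lemma \<kappa>_eq_\<rho>:
  assumes "i < n" "tc X"
  shows "\<kappa> i X = (\<Sum>m<n. \<Sum>p<n. \<epsilon> m (dual_rep i) (r m p (\<rho> p X)))"
proof -
  have adj_eq: "adj (\<epsilon> i x) = hip A L G (dual_rep i) (Conj x)" for x
    by (simp add: hip_eq dual_rep[OF assms(1), symmetric] adj_hp)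
  have "\<kappa> i X = tensor_lift (\<lambda>x u. blinfun_apply (hip A L G (dual_rep i) x) u) X"
    unfolding \<kappa>_def by (simp add: adj_eq)
  also have "\<dots> = (\<Sum>j<n. hp (dual_rep i) (e j) (\<kappa> j X))"
    by (rule tensor_lift_hp[OF assms(2)])
  also have "\<dots> = (\<Sum>j<n. \<Sum>m<n. \<Sum>p<n. \<epsilon> m (dual_rep i) (r m p (r p j (\<kappa> j X))))"
  proof (intro sum.cong refl)
    fix j assume "j \<in> {..<n}"
    then show "hp (dual_rep i) (e j) (\<kappa> j X) = (\<Sum>m<n. \<Sum>p<n. \<epsilon> m (dual_rep i) (r m p (r p j (\<kappa> j X))))"
      by (subst hp_expand_left) (simp add: blinfun.sum_left hp_root blinfun.sum_right)
  qed
  also have "\<dots> = (\<Sum>m<n. \<Sum>j<n. \<Sum>p<n. \<epsilon> m (dual_rep i) (r m p (r p j (\<kappa> j X))))"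
    by (rule sum.swap)
  also have "\<dots> = (\<Sum>m<n. \<Sum>p<n. \<Sum>j<n. \<epsilon> m (dual_rep i) (r m p (r p j (\<kappa> j X))))"
    by (intro sum.cong refl sum.swap)
  also have "\<dots> = (\<Sum>m<n. \<Sum>p<n. \<epsilon> m (dual_rep i) (r m p (\<rho> p X)))"
    by (simp add: \<rho>_def blinfun.sum_right)
  finally show ?thesis .
qed

lemma fibre_norm2_pos:
  assumes v: "v \<in> V" and "v \<noteq> vec_zero A L"
  shows "\<exists>x. fibre_norm2 v x \<noteq> 0"
proof (rule ccontr)
  assume "\<not> ?thesis"
  then have zero: "fibre_norm2 v x = 0" for x by simp
  have fst: "fst v x = 0" and \<rho>: "x \<noteq> 0 \<Longrightarrow> p < n \<Longrightarrow> \<rho> p (snd v x) = 0" for x p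
    using zero[of x] unfolding fibre_norm2_def
    by (auto simp: add_nonneg_eq_0_iff sum_nonneg sum_nonneg_eq_0_iff)
  have \<kappa>: "\<kappa> i (snd v x) = 0" if i: "i < n" for i x
  proof -
    \<comment> \<open>The weight x^2 hides the tensor part over 0; there the coordinates vanish by
      continuity.\<close>
    have away: "\<kappa> i (snd v y) = 0" if "y \<noteq> 0" for y
      unfolding \<kappa>_eq_\<rho>[OF i V_tc[OF v]] by (simp add: \<rho> that)
    have "((\<lambda>x. \<kappa> i (snd v x)) \<longlongrightarrow> \<kappa> i (snd v 0)) (at 0)"
      using Cc_continuous[OF V_\<kappa>[OF v i]] by (simp add: continuous_on_def)
    moreover have "((\<lambda>x. \<kappa> i (snd v x)) \<longlongrightarrow> 0) (at 0)"
      by (rule tendsto_eventually) (auto simp: eventually_at_filter away)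
    ultimately have "\<kappa> i (snd v 0) = 0"
      using LIM_unique by blast
    then show ?thesis using away by (cases "x = 0") auto
  qed
  have "v = vec_zero A L"
    by (rule vec_eqI) (simp_all add: V_tc[OF v] vec_zero_coords fst \<kappa>)
  with assms(2) show False by blast
qed

section \<open>Integration of the fibre norm\<close>

lemma inner01_self:
  assumes "v \<in> V"
  shows "inner01 A L G v v = of_real (LINT x|lborel. fibre_norm2 v x / (1 + x\<^sup>2))"
    and "integrable lborel (\<lambda>x. fibre_norm2 v x / (1 + x\<^sup>2))"
proof -
  have eq: "fibre_form v v x / complex_of_real (1 + x\<^sup>2) = of_real (fibre_norm2 v x / (1 + x\<^sup>2))" for x
    by (simp add: fibre_form_self)
  show "inner01 A L G v v = of_real (LINT x|lborel. fibre_norm2 v x / (1 + x\<^sup>2))"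
    unfolding inner01_eq[OF V_tc[OF assms] V_tc[OF assms]] eq by (rule integral_complex_of_real)
  show "integrable lborel (\<lambda>x. fibre_norm2 v x / (1 + x\<^sup>2))"
    using fibre_form_integrable[OF assms assms] unfolding eq complex_of_real_integrable_eq .
qed

lemma fibre_norm2_continuous:
  assumes "v \<in> V"
  shows "continuous_on UNIV (fibre_norm2 v)"
proof -
  have "fibre_norm2 v = (\<lambda>x. Re (fibre_form v v x))"
    by (simp add: fibre_form_self)
  then show ?thesis
    using Clim_continuous[OF fibre_form_Clim[OF assms assms]] by (simp add: continuous_intros)
qed

lemma inner01_pos:
  assumes "v \<in> V" "v \<noteq> vec_zero A L"
  shows "Re (inner01 A L G v v) > 0"
proof -
  obtain a where "fibre_norm2 v a \<noteq> 0"
    using fibre_norm2_pos[OF assms] by blast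
  then have "(LINT x|lborel. fibre_norm2 v x / (1 + x\<^sup>2)) > 0"
    by (intro integral_continuous_pos[of _ a] continuous_intros fibre_norm2_continuous assms
        inner01_self(2))
      (auto simp: one_plus_square_nonzero fibre_norm2_nonneg add_nonneg_nonneg)
  then show ?thesis by (simp add: inner01_self(1)[OF assms(1)])
qed

lemma inner01_add_right:
  assumes "u \<in> V" "v \<in> V" "w \<in> V"
  shows "inner01 A L G u (vec_add A L v w) = inner01 A L G u v + inner01 A L G u w"
  using assms
  by (simp add: inner01_eq V_tc vec_add_coords fibre_form_add_right add_divide_distrib
      fibre_form_integrable del: of_real_add)

lemma inner01_scale_right:
  assumes "v \<in> V" "w \<in> V"
  shows "inner01 A L G v (vec_scale A L c w) = c * inner01 A L G v w"
  using assms
  by (simp add: inner01_eq V_tc vec_scale_coords fibre_form_scale_right flip: times_divide_eq_right)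

lemma inner01_commute:
  assumes "v \<in> V" "w \<in> V"
  shows "inner01 A L G v w = cnj (inner01 A L G w v)"
proof -
  have "fibre_form v w x / complex_of_real (1 + x\<^sup>2) = cnj (fibre_form w v x / complex_of_real (1 + x\<^sup>2))" for x
    by (subst fibre_form_commute) simp
  then show ?thesis
    using assms by (simp only: inner01_eq V_tc Bochner_Integration.integral_cnj)
qed

lemma pre_hilbert: "pre_hilbert_H01 A L G n e"
  unfolding pre_hilbert_H01_def Let_def
  by (intro conjI ballI allI impI vec_zero_V vec_add_V vec_scale_V inner01_commute
      inner01_add_right inner01_scale_right inner01_pos)

section \<open>Algebra of the action\<close>

abbreviation act where "act \<equiv> fpair_act A L st G"

lemma adj_scaleR: "a \<in> A \<Longrightarrow> adj (s *\<^sub>R a) = s *\<^sub>R adj a"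
  by (simp add: scaleR_scaleC adj_scaleC)

lemma ra_scaleR_right: "a \<in> A \<Longrightarrow> ra x (s *\<^sub>R a) = s *\<^sub>R ra x a"
  by (simp add: scaleR_scaleC ra_scaleC_right)

lemma \<epsilon>_scaleR: "i < n \<Longrightarrow> \<epsilon> i (s *\<^sub>R x) = s *\<^sub>R \<epsilon> i x"
  by (simp add: scaleR_scaleC \<epsilon>_scaleC)

text \<open>The action as a two by two block matrix in coordinates, the form used in all that
  follows.\<close>

lemma act_coords:
  assumes "\<And>x. fst f x \<in> A" "\<And>x. tc (snd v x)"
  shows "fst (act f v) x = fst f x (fst v x) + x\<^sup>2 *\<^sub>R (\<Sum>j<n. hp (snd f x) (e j) (\<kappa> j (snd v x)))"
    and "tc (snd (act f v) x)"
    and "i < n \<Longrightarrow> \<kappa> i (snd (act f v) x) = adj (\<epsilon> i (st (snd f x))) (fst v x) +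
      (\<Sum>j<n. adj (\<epsilon> i (ra (e j) (adj (fst f x)))) (\<kappa> j (snd v x)))"
  using assms
  by (simp_all add: fpair_act_def tensor_lift_hp CT.tensor_mult_closed CT.tensor_elem_closed tc_lact
      \<kappa>_mult \<kappa>_elem \<kappa>_lact)

lemma act_vec_add:
  assumes "\<And>x. fst f x \<in> A" "\<And>x. tc (snd v x)" "\<And>x. tc (snd w x)"
  shows "act f (vec_add A L v w) = vec_add A L (act f v) (act f w)"
  by (rule vec_eqI)
    (simp_all add: assms act_coords vec_add_coords blinfun.add_right sum.distrib scaleR_add_right)

lemma act_vec_scale:
  assumes "\<And>x. fst f x \<in> A" "\<And>x. tc (snd v x)"
  shows "act f (vec_scale A L c v) = vec_scale A L c (act f v)"
  by (rule vec_eqI)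
    (simp_all add: assms act_coords vec_scale_coords A_apply_scaleC hp_apply_scaleC A_adj \<epsilon>_in
      scaleC_add_right scaleC_sum_right scaleC_scaleR)

lemma act_add:
  assumes "\<And>x. fst f x \<in> A" "\<And>x. fst g x \<in> A" "\<And>x. tc (snd v x)"
  shows "act (fpair_add f g) v = vec_add A L (act f v) (act g v)"
proof -
  have *: "\<And>x. fst (fpair_add f g) x \<in> A"
    by (simp add: fpair_add_def assms A_add)
  show ?thesis
    by (rule vec_eqI)
      (simp_all add: assms * act_coords vec_add_coords,
       simp_all add: fpair_add_def assms hp_add_left st_add \<epsilon>_add adj_add ra_add_right A_adj \<epsilon>_in
         blinfun.add_left sum.distrib scaleR_add_right)
qed

lemma act_scale:
  assumes "\<And>x. fst f x \<in> A" "\<And>x. tc (snd v x)"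
  shows "act (fpair_scale c f) v = vec_scale A L c (act f v)"
proof -
  have *: "\<And>x. fst (fpair_scale c f) x \<in> A"
    by (simp add: fpair_scale_def assms A_scaleC)
  show ?thesis
    by (rule vec_eqI)
      (simp_all add: assms * act_coords vec_scale_coords,
       simp_all add: fpair_scale_def assms hp_scaleC_left st_scaleC \<epsilon>_scaleC adj_scaleC ra_scaleC_right
         A_adj \<epsilon>_in scaleC_add_right scaleC_sum_right scaleC_scaleR)
qed

text \<open>On coordinates the unit acts by the matrix \<open>adj (\<epsilon> i (e j))\<close>, in
  general an idempotent and not the identity matrix; by \<open>tensor_expand\<close> it fixes the
  coordinates of every tensor.\<close>

lemma act_one:
  assumes "\<And>x. tc (snd v x)"
  shows "act (\<lambda>x. id_blinfun, \<lambda>x. 0) v = v"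
proof (rule vec_eqI)
  fix i x assume i: "i < n"
  have "\<kappa> i (snd v x) = (\<Sum>j<n. adj (\<epsilon> i (e j)) (\<kappa> j (snd v x)))"
    by (subst tensor_expand[OF assms]) (simp add: \<kappa>_sum[OF i])
  then show "\<kappa> i (snd (act (\<lambda>x. id_blinfun, \<lambda>x. 0) v) x) = \<kappa> i (snd v x)"
    by (simp add: assms act_coords A_id i st_zero \<epsilon>_zero adj_zero adj_id ra_id)
qed (simp_all add: assms act_coords A_id hp_zero_left)

text \<open>Sums out the dual basis between two factors. With \<open>\<epsilon>_contract\<close> it
  reduces a composite of two actions to single sums.\<close>

lemma hp_contract: "(\<Sum>i<n. hp x (e i) (adj (\<epsilon> i z) u)) = hp x z u"
  by (subst (2) hp_expand_right) (simp add: blinfun.sum_left)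

lemma \<epsilon>_contract:
  assumes "i < n" "a \<in> A"
  shows "(\<Sum>j<n. adj (\<epsilon> i (ra (e j) a)) (adj (\<epsilon> j z) u)) = adj (\<epsilon> i (ra z a)) u"
proof -
  have "adj (\<epsilon> i (ra z a)) = adj (\<Sum>j<n. \<epsilon> j z o\<^sub>L \<epsilon> i (ra (e j) a))"
    using assms by (subst \<epsilon>_ra) simp_all
  also have "\<dots> = (\<Sum>j<n. adj (\<epsilon> j z o\<^sub>L \<epsilon> i (ra (e j) a)))"
    by (rule adj_sum) (simp add: A_compose \<epsilon>_in assms(1))
  also have "\<dots> = (\<Sum>j<n. adj (\<epsilon> i (ra (e j) a)) o\<^sub>L adj (\<epsilon> j z))"
    by (simp add: adj_compose \<epsilon>_in assms(1))
  finally show ?thesis by (simp add: blinfun.sum_left)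
qed

lemma fpair_mult_fst_in:
  assumes "\<And>x. fst f x \<in> A" "\<And>x. fst g x \<in> A"
  shows "fst (fpair_mult A L st G f g) x \<in> A"
  by (simp add: fpair_mult_def assms A_add A_compose A_scaleR hip_eq hp_in)

text \<open>The bimodule rules match all terms except the one quadratic in the
  \<open>L\<close>-parts that acts on the tensor component. There x^2 <f_1, conj (st g_1)> acting on
  conj e \<otimes> u has to equal conj (st f_1) \<otimes> x^2 <g_1, conj e> u, which is
  \<open>hp_associative\<close>.\<close>

lemma act_mult:
  assumes f: "\<And>x. fst f x \<in> A" and g: "\<And>x. fst g x \<in> A" and v: "\<And>x. tc (snd v x)"
  shows "act (fpair_mult A L st G f g) v = act f (act g v)"
proof -
  let ?h = "fpair_mult A L st G f g"
  note h = fpair_mult_fst_in[of f g, OF f g]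
  show ?thesis
  proof (rule vec_eqI)
    fix x
    let ?k = "\<lambda>j. \<kappa> j (snd v x)" and ?u = "fst v x"
    have gv: "\<And>x. tc (snd (act g v) x)"
      by (simp add: act_coords g v)
    show "tc (snd (act ?h v) x)" "tc (snd (act f (act g v)) x)"
      by (simp_all add: act_coords f g h v)
    have "(\<Sum>i<n. hp (snd f x) (e i) (\<kappa> i (snd (act g v) x)))
        = hp (snd f x) (st (snd g x)) ?u
          + (\<Sum>i<n. \<Sum>j<n. hp (snd f x) (e i) (adj (\<epsilon> i (ra (e j) (adj (fst g x)))) (?k j)))"
      by (simp add: act_coords g v blinfun.add_right blinfun.sum_right sum.distrib hp_contract)
    also have "(\<Sum>i<n. \<Sum>j<n. hp (snd f x) (e i) (adj (\<epsilon> i (ra (e j) (adj (fst g x)))) (?k j)))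
        = (\<Sum>j<n. hp (ra (snd f x) (fst g x)) (e j) (?k j))"
      by (subst sum.swap) (simp add: hp_contract hp_ra_left g)
    finally have contr: "(\<Sum>i<n. hp (snd f x) (e i) (\<kappa> i (snd (act g v) x)))
        = hp (snd f x) (st (snd g x)) ?u + (\<Sum>j<n. hp (ra (snd f x) (fst g x)) (e j) (?k j))" .
    show "fst (act ?h v) x = fst (act f (act g v)) x"
      unfolding act_coords(1)[of f "act g v", OF f gv] contr act_coords(1)[of ?h v, OF h v]
        act_coords(1)[of g v, OF g v]
      by (simp add: fpair_mult_def hip_eq hp_add_left hp_la_left f blinfun.bilinear_simps sum.distrib
          blinfun.sum_right scaleR_add_right)
    fix i assume i: "i < n"
    have "(\<Sum>m<n. adj (\<epsilon> i (ra (e m) (adj (fst f x)))) (\<kappa> m (snd (act g v) x)))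
        = adj (\<epsilon> i (ra (st (snd g x)) (adj (fst f x)))) ?u + (\<Sum>m<n. \<Sum>j<n.
            adj (\<epsilon> i (ra (e m) (adj (fst f x)))) (adj (\<epsilon> m (ra (e j) (adj (fst g x)))) (?k j)))"
      by (simp add: act_coords g v blinfun.add_right blinfun.sum_right sum.distrib \<epsilon>_contract i A_adj f)
    also have "(\<Sum>m<n. \<Sum>j<n.
            adj (\<epsilon> i (ra (e m) (adj (fst f x)))) (adj (\<epsilon> m (ra (e j) (adj (fst g x)))) (?k j)))
        = (\<Sum>j<n. adj (\<epsilon> i (ra (e j) (adj (fst g x) o\<^sub>L adj (fst f x)))) (?k j))"
      by (subst sum.swap) (simp add: \<epsilon>_contract i A_adj f g ra_compose)
    finally have contr': "(\<Sum>m<n. adj (\<epsilon> i (ra (e m) (adj (fst f x)))) (\<kappa> m (snd (act g v) x)))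
        = adj (\<epsilon> i (ra (st (snd g x)) (adj (fst f x)))) ?u
          + (\<Sum>j<n. adj (\<epsilon> i (ra (e j) (adj (fst g x) o\<^sub>L adj (fst f x)))) (?k j))" .
    have "adj (\<epsilon> i (ra (e j) (adj (fst ?h x)))) = adj (\<epsilon> i (ra (e j) (adj (fst g x) o\<^sub>L adj (fst f x))))
        + x\<^sup>2 *\<^sub>R (adj (\<epsilon> i (st (snd f x))) o\<^sub>L hp (snd g x) (e j))" for j
    proof -
      have "ra (e j) (hp (st (snd g x)) (snd f x)) = la (hp (e j) (snd g x)) (st (snd f x))"
        using hp_associative[where x = "e j" and y = "snd g x" and z = "st (snd f x)"]
        by (simp add: st_st)
      then have "ra (e j) (adj (fst ?h x)) = ra (e j) (adj (fst g x) o\<^sub>L adj (fst f x))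
          + x\<^sup>2 *\<^sub>R la (hp (e j) (snd g x)) (st (snd f x))"
        by (simp add: fpair_mult_def f g hip_eq adj_add adj_scaleR adj_compose A_compose A_scaleR hp_in
            adj_hp ra_add_right A_adj ra_scaleR_right)
      then show ?thesis
        by (simp add: \<epsilon>_add \<epsilon>_scaleR \<epsilon>_la i hp_in adj_add adj_scaleR adj_compose \<epsilon>_in adj_hp
            A_scaleR A_compose)
    qed
    then have "(\<Sum>j<n. adj (\<epsilon> i (ra (e j) (adj (fst ?h x)))) (?k j))
        = (\<Sum>j<n. adj (\<epsilon> i (ra (e j) (adj (fst g x) o\<^sub>L adj (fst f x)))) (?k j))
          + adj (\<epsilon> i (st (snd f x))) (x\<^sup>2 *\<^sub>R (\<Sum>j<n. hp (snd g x) (e j) (?k j)))"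
      by (simp add: blinfun.add_left blinfun.scaleR_left blinfun.scaleR_right blinfun.sum_right
          sum.distrib scaleR_sum_right)
    moreover have "adj (\<epsilon> i (st (snd ?h x))) = adj (\<epsilon> i (ra (st (snd g x)) (adj (fst f x))))
        + (adj (\<epsilon> i (st (snd f x))) o\<^sub>L fst g x)"
      by (simp add: fpair_mult_def st_add st_la st_ra f g \<epsilon>_add i adj_add \<epsilon>_in \<epsilon>_la A_adj A_compose
          adj_compose adj_adj)
    ultimately show "\<kappa> i (snd (act ?h v) x) = \<kappa> i (snd (act f (act g v)) x)"
      unfolding act_coords(3)[of f "act g v", OF f gv i] contr' act_coords(3)[of ?h v, OF h v i]
        act_coords(1)[of g v, OF g v]
      by (simp add: blinfun.add_left blinfun.add_right)
  qed
qed

lemma left_contract: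
  "(\<Sum>i<n. \<Sum>j<n. cinner (adj (\<epsilon> i z) u) (hp (e i) (e j) (k j))) = (\<Sum>j<n. cinner u (hp z (e j) (k j)))"
proof -
  have "hp z (e j) w = (\<Sum>i<n. \<epsilon> i z (hp (e i) (e j) w))" for j w
    by (subst hp_expand_left) (simp add: blinfun.sum_left)
  then have "(\<Sum>j<n. cinner u (hp z (e j) (k j)))
      = (\<Sum>j<n. \<Sum>i<n. cinner u (\<epsilon> i z (hp (e i) (e j) (k j))))"
    by (simp add: cinner_sum_right)
  also have "\<dots> = (\<Sum>i<n. \<Sum>j<n. cinner (adj (\<epsilon> i z) u) (hp (e i) (e j) (k j)))"
    by (subst sum.swap) (simp add: cinner_adj_left \<epsilon>_in)
  finally show ?thesis by simp
qed

lemma right_contract: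
  "(\<Sum>i<n. \<Sum>j<n. cinner (k i) (hp (e i) (e j) (adj (\<epsilon> j z) u))) = (\<Sum>i<n. cinner (k i) (hp (e i) z u))"
  by (simp add: cinner_sum_right[symmetric] hp_contract)

text \<open>The weight x^2 in the first component of the action equals the one in front of the
  tensor part of the form, so the two cross terms change places when f_1 is replaced by its star.
  The diagonal terms agree by \<open>hp_ra_left\<close>.\<close>

lemma act_adjoint:
  assumes f: "\<And>x. fst f x \<in> A" and v: "\<And>x. tc (snd v x)" and w: "\<And>x. tc (snd w x)"
  shows "fibre_form (act (fpair_star st f) v) w x = fibre_form v (act f w) x"
proof -
  let ?k = "\<lambda>j. \<kappa> j (snd v x)" and ?l = "\<lambda>j. \<kappa> j (snd w x)"
  let ?u = "fst v x" and ?t = "fst w x" and ?f = "fst f x" and ?g = "snd f x"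
  have fs: "\<And>x. fst (fpair_star st f) x \<in> A"
    by (simp add: fpair_star_def f A_adj)
  have \<kappa>l: "\<kappa> i (snd (act (fpair_star st f) v) x) = adj (\<epsilon> i ?g) ?u
      + (\<Sum>m<n. adj (\<epsilon> i (ra (e m) ?f)) (?k m))" if "i < n" for i
    unfolding act_coords(3)[of "fpair_star st f" v, OF fs v that]
    by (simp add: fpair_star_def st_st adj_adj f)
  have "(\<Sum>i<n. \<Sum>j<n. cinner (\<kappa> i (snd (act (fpair_star st f) v) x)) (hp (e i) (e j) (?l j)))
      = (\<Sum>i<n. \<Sum>j<n. cinner (adj (\<epsilon> i ?g) ?u) (hp (e i) (e j) (?l j)))
        + (\<Sum>i<n. \<Sum>j<n. \<Sum>m<n. cinner (adj (\<epsilon> i (ra (e m) ?f)) (?k m)) (hp (e i) (e j) (?l j)))"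
    by (simp add: \<kappa>l cinner_add_left cinner_sum_left sum.distrib)
  also have "(\<Sum>i<n. \<Sum>j<n. \<Sum>m<n. cinner (adj (\<epsilon> i (ra (e m) ?f)) (?k m)) (hp (e i) (e j) (?l j)))
      = (\<Sum>i<n. \<Sum>m<n. \<Sum>j<n. cinner (adj (\<epsilon> i (ra (e m) ?f)) (?k m)) (hp (e i) (e j) (?l j)))"
    by (intro sum.cong refl sum.swap)
  also have "\<dots> = (\<Sum>m<n. \<Sum>i<n. \<Sum>j<n. cinner (adj (\<epsilon> i (ra (e m) ?f)) (?k m)) (hp (e i) (e j) (?l j)))"
    by (rule sum.swap)
  finally have left: "(\<Sum>i<n. \<Sum>j<n. cinner (\<kappa> i (snd (act (fpair_star st f) v) x)) (hp (e i) (e j) (?l j)))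
      = (\<Sum>j<n. cinner ?u (hp ?g (e j) (?l j))) + (\<Sum>m<n. \<Sum>j<n. cinner (?k m) (hp (ra (e m) ?f) (e j) (?l j)))"
    by (simp only: left_contract)
  have "(\<Sum>i<n. \<Sum>j<n. cinner (?k i) (hp (e i) (e j) (\<kappa> j (snd (act f w) x))))
      = (\<Sum>i<n. \<Sum>j<n. cinner (?k i) (hp (e i) (e j) (adj (\<epsilon> j (st ?g)) ?t)))
        + (\<Sum>i<n. \<Sum>j<n. \<Sum>m<n. cinner (?k i) (hp (e i) (e j) (adj (\<epsilon> j (ra (e m) (adj ?f))) (?l m))))"
    by (simp add: act_coords f w cinner_add_right cinner_sum_right blinfun.add_right blinfun.sum_right
        sum.distrib)
  also have "(\<Sum>i<n. \<Sum>j<n. \<Sum>m<n. cinner (?k i) (hp (e i) (e j) (adj (\<epsilon> j (ra (e m) (adj ?f))) (?l m))))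
      = (\<Sum>i<n. \<Sum>m<n. \<Sum>j<n. cinner (?k i) (hp (e i) (e j) (adj (\<epsilon> j (ra (e m) (adj ?f))) (?l m))))"
    by (intro sum.cong refl sum.swap)
  also have "\<dots> = (\<Sum>i<n. \<Sum>m<n. cinner (?k i) (hp (ra (e i) ?f) (e m) (?l m)))"
    by (simp add: cinner_sum_right[symmetric] hp_contract hp_ra_left f)
  finally have right: "(\<Sum>i<n. \<Sum>j<n. cinner (?k i) (hp (e i) (e j) (\<kappa> j (snd (act f w) x))))
      = (\<Sum>i<n. cinner (?k i) (hp (e i) (st ?g) ?t)) + (\<Sum>i<n. \<Sum>m<n. cinner (?k i) (hp (ra (e i) ?f) (e m) (?l m)))"
    by (simp only: right_contract)
  have "cinner (fst (act (fpair_star st f) v) x) ?t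
      = cinner ?u (?f ?t) + of_real (x\<^sup>2) * (\<Sum>i<n. cinner (?k i) (hp (e i) (st ?g) ?t))"
    unfolding act_coords(1)[of "fpair_star st f" v, OF fs v]
    by (simp add: fpair_star_def cinner_add_left cinner_adj_left f cinner_scaleR_left cinner_sum_left
        cinner_hp)
  moreover have "cinner ?u (fst (act f w) x)
      = cinner ?u (?f ?t) + of_real (x\<^sup>2) * (\<Sum>j<n. cinner ?u (hp ?g (e j) (?l j)))"
    by (simp add: act_coords f w cinner_add_right cinner_scaleR_right cinner_sum_right)
  ultimately show ?thesis
    unfolding fibre_form_def left right by (simp add: distrib_left)
qed

section \<open>Boundedness of the action\<close>

lemma L_Cc_\<epsilon>: "f \<in> L_Cc \<Longrightarrow> i < n \<Longrightarrow> (\<lambda>x. \<epsilon> i (f x)) \<in> Cc A"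
  by (simp add: L_Cc_def)

lemma L_Cc_hp:
  assumes "f \<in> L_Cc"
  shows "(\<lambda>x. hp (f x) z) \<in> Cc A"
proof -
  have "(\<lambda>x. hp (f x) z) = (\<lambda>x. \<Sum>i<n. \<epsilon> i (f x) o\<^sub>L hp (e i) z)"
    by (rule ext) (rule hp_expand_left)
  also have "\<dots> \<in> Cc A"
    by (rule Cc_sum)
      (auto intro!: Cc_bilinear_left[OF bounded_bilinear_blinfun_compose L_Cc_\<epsilon>[OF assms]]
        A_zero A_add A_compose \<epsilon>_in hp_in)
  finally show ?thesis .
qed

lemma L_Cc_hp2:
  assumes "f \<in> L_Cc" "g \<in> L_Cc"
  shows "(\<lambda>x. hp (f x) (g x)) \<in> Cc A"
proof -
  have "(\<lambda>x. hp (f x) (g x)) = (\<lambda>x. \<Sum>i<n. hp (f x) (e i) o\<^sub>L adj (\<epsilon> i (g x)))"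
    by (rule ext) (rule hp_expand_right)
  also have "\<dots> \<in> Cc A"
  proof (rule Cc_sum)
    fix i assume "i \<in> {..<n}"
    then have i: "i < n" by simp
    have "continuous_on UNIV (\<lambda>x. adj (\<epsilon> i (g x)))"
      using Cc_range[OF L_Cc_\<epsilon>[OF assms(2) i]]
      by (intro continuous_on_compose2[OF continuous_on_adj Cc_continuous[OF L_Cc_\<epsilon>[OF assms(2) i]]]) auto
    then show "(\<lambda>x. hp (f x) (e i) o\<^sub>L adj (\<epsilon> i (g x))) \<in> Cc A"
      by (rule Cc_bilinear_left[OF bounded_bilinear_blinfun_compose L_Cc_hp[OF assms(1)]])
        (simp add: A_compose hp_in A_adj \<epsilon>_in i)
  qed (auto intro: A_zero A_add)
  finally show ?thesis .
qed

lemma continuous_on_\<epsilon>_ra_adj: "i < n \<Longrightarrow> continuous_on A (\<lambda>a. \<epsilon> i (ra x (adj a)))"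
  by (rule continuous_on_compose2[OF continuous_on_\<epsilon>_ra continuous_on_adj]) (auto simp: A_adj)

text \<open>The star of \<open>la a (e j)\<close> is \<open>ra (st (e j)) (adj a)\<close>, whose
  coordinates depend continuously on \<open>a\<close> by the bound \<open>M\<close>.\<close>

lemma L_Cc_st:
  assumes "f \<in> L_Cc"
  shows "(\<lambda>x. st (f x)) \<in> L_Cc"
  unfolding L_Cc_def
proof (intro CollectI allI impI)
  fix i assume i: "i < n"
  have "\<epsilon> i (st (f x)) = (\<Sum>j<n. \<epsilon> i (ra (st (e j)) (adj (\<epsilon> j (f x)))))" for x
  proof -
    have "\<epsilon> i (st (f x)) = \<epsilon> i (st (\<Sum>j<n. la (\<epsilon> j (f x)) (e j)))"
      using expand[of "f x"] by simp
    then show ?thesis by (simp add: st_sum \<epsilon>_sum i st_la \<epsilon>_in)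
  qed
  moreover have "(\<lambda>x. \<Sum>j<n. \<epsilon> i (ra (st (e j)) (adj (\<epsilon> j (f x))))) \<in> Cc A"
  proof (rule Cc_sum)
    fix j assume "j \<in> {..<n}"
    then have "j < n" by simp
    show "(\<lambda>x. \<epsilon> i (ra (st (e j)) (adj (\<epsilon> j (f x))))) \<in> Cc A"
      by (rule Cc_comp[OF L_Cc_\<epsilon>[OF assms \<open>j < n\<close>] continuous_on_\<epsilon>_ra_adj[OF i]])
        (simp_all add: adj_zero ra_zero_right \<epsilon>_zero i \<epsilon>_in)
  qed (auto intro: A_zero A_add)
  ultimately show "(\<lambda>x. \<epsilon> i (st (f x))) \<in> Cc A" by simp
qed

lemma L_Cc_add:
  assumes "f \<in> L_Cc" "g \<in> L_Cc"
  shows "(\<lambda>x. f x + g x) \<in> L_Cc"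
  using Cc_add[OF L_Cc_\<epsilon>[OF assms(1)] L_Cc_\<epsilon>[OF assms(2)] A_add] by (simp add: L_Cc_def \<epsilon>_add)

lemma L_Cc_scale:
  assumes "f \<in> L_Cc"
  shows "(\<lambda>x. c *\<^sub>C f x) \<in> L_Cc"
proof -
  have "(\<lambda>x. c *\<^sub>C \<epsilon> i (f x)) \<in> Cc A" if "i < n" for i
    by (rule Cc_comp[OF L_Cc_\<epsilon>[OF assms that] continuous_on_scaleC]) (auto intro: A_scaleC)
  then show ?thesis by (simp add: L_Cc_def \<epsilon>_scaleC)
qed

lemma L_Cc_la:
  assumes "f \<in> L_Cc" "continuous_on UNIV a" "\<And>x. a x \<in> A"
  shows "(\<lambda>x. la (a x) (f x)) \<in> L_Cc"
proof -
  have "(\<lambda>x. a x o\<^sub>L \<epsilon> i (f x)) \<in> Cc A" if "i < n" for i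
    by (rule Cc_bilinear_right[OF bounded_bilinear_blinfun_compose assms(2) L_Cc_\<epsilon>[OF assms(1) that]])
      (simp add: A_compose assms(3) \<epsilon>_in that)
  then show ?thesis by (simp add: L_Cc_def \<epsilon>_la assms(3))
qed

text \<open>Again through \<open>M\<close>: the coordinates of \<open>ra (e j) (a x)\<close> are
  continuous in \<open>x\<close>, and those of \<open>f\<close> contribute the compact
  support.\<close>

lemma L_Cc_ra:
  assumes "f \<in> L_Cc" "continuous_on UNIV a" "\<And>x. a x \<in> A"
  shows "(\<lambda>x. ra (f x) (a x)) \<in> L_Cc"
  unfolding L_Cc_def
proof (intro CollectI allI impI)
  fix i assume i: "i < n"
  have "(\<lambda>x. \<epsilon> i (ra (f x) (a x))) = (\<lambda>x. \<Sum>j<n. \<epsilon> j (f x) o\<^sub>L \<epsilon> i (ra (e j) (a x)))"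
    by (rule ext) (rule \<epsilon>_ra[OF i assms(3)])
  also have "\<dots> \<in> Cc A"
  proof (rule Cc_sum)
    fix j assume "j \<in> {..<n}"
    then have j: "j < n" by simp
    have "continuous_on UNIV (\<lambda>x. \<epsilon> i (ra (e j) (a x)))"
      using assms(3) by (intro continuous_on_compose2[OF continuous_on_\<epsilon>_ra[OF i] assms(2)]) auto
    then show "(\<lambda>x. \<epsilon> j (f x) o\<^sub>L \<epsilon> i (ra (e j) (a x))) \<in> Cc A"
      by (rule Cc_bilinear_left[OF bounded_bilinear_blinfun_compose L_Cc_\<epsilon>[OF assms(1) j]])
        (simp add: A_compose \<epsilon>_in i j)
  qed (auto intro: A_zero A_add)
  finally show "(\<lambda>x. \<epsilon> i (ra (f x) (a x))) \<in> Cc A" .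
qed

text \<open>Every term of the action except f_0 v_0 contains f_1 or v_1 and so has compact support;
  the limit at infinity of the first component is that of f_0 v_0.\<close>

lemma act_V:
  assumes f0: "fst f \<in> Clim A A" and f1: "snd f \<in> L_Cc" and v: "v \<in> V"
  shows "act f v \<in> V"
proof -
  have fA: "\<And>x. fst f x \<in> A"
    using f0 by (rule Clim_range)
  note coords = act_coords[of f v, OF fA V_tc[OF v]]
  have "(\<lambda>x. \<Sum>j<n. hp (snd f x) (e j) (\<kappa> j (snd v x))) \<in> Cc UNIV"
    by (rule Cc_sum)
      (auto intro!: Cc_bilinear_left[OF bounded_bilinear_blinfun_apply L_Cc_hp[OF f1]]
        Cc_continuous[OF V_\<kappa>[OF v]])
  then have "(\<lambda>x. x\<^sup>2 *\<^sub>R (\<Sum>j<n. hp (snd f x) (e j) (\<kappa> j (snd v x)))) \<in> Cc UNIV" (is "?b \<in> _")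
    by (rule Cc_bilinear_right[OF bounded_bilinear_scaleR, rotated]) (auto intro!: continuous_intros)
  then have b: "?b \<in> Clim UNIV {0}"
    by (rule subsetD[OF Cc_subset_Clim])
  have a: "(\<lambda>x. fst f x (fst v x)) \<in> Clim UNIV UNIV"
    by (rule Clim_bilinear[OF bounded_bilinear_blinfun_apply f0 V_fst[OF v]]) auto
  have "fst (act f v) = (\<lambda>x. fst f x (fst v x) + ?b x)"
    by (rule ext) (rule coords(1))
  then have "fst (act f v) \<in> Clim UNIV UNIV"
    using Clim_add[OF a b, of UNIV UNIV] by simp
  moreover have "(\<lambda>x. \<kappa> i (snd (act f v) x)) \<in> Cc UNIV" if i: "i < n" for i
  proof -
    have "(\<lambda>x. adj (\<epsilon> i (st (snd f x)))) \<in> Cc A"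
      by (rule Cc_comp[OF L_Cc_\<epsilon>[OF L_Cc_st[OF f1] i] continuous_on_adj]) (auto simp: adj_zero A_adj)
    then have "(\<lambda>x. adj (\<epsilon> i (st (snd f x))) (fst v x)) \<in> Cc UNIV"
      by (rule Cc_bilinear_left[OF bounded_bilinear_blinfun_apply _ Clim_continuous[OF V_fst[OF v]]]) simp
    moreover have "(\<lambda>x. \<Sum>j<n. adj (\<epsilon> i (ra (e j) (adj (fst f x)))) (\<kappa> j (snd v x))) \<in> Cc UNIV"
    proof (rule Cc_sum)
      fix j assume "j \<in> {..<n}"
      then have j: "j < n" by simp
      have "continuous_on UNIV (\<lambda>x. \<epsilon> i (ra (e j) (adj (fst f x))))"
        using fA by (intro continuous_on_compose2[OF continuous_on_\<epsilon>_ra_adj[OF i] Clim_continuous[OF f0]]) auto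
      then have "continuous_on UNIV (\<lambda>x. adj (\<epsilon> i (ra (e j) (adj (fst f x)))))"
        by (rule continuous_on_compose2[OF continuous_on_adj]) (auto simp: \<epsilon>_in i)
      then show "(\<lambda>x. adj (\<epsilon> i (ra (e j) (adj (fst f x)))) (\<kappa> j (snd v x))) \<in> Cc UNIV"
        by (rule Cc_bilinear_right[OF bounded_bilinear_blinfun_apply _ V_\<kappa>[OF v j]]) simp
    qed auto
    ultimately show ?thesis
      unfolding coords(3)[OF i] by (rule Cc_add) auto
  qed
  ultimately show ?thesis
    by (simp add: mem_V_iff coords(2))
qed

text \<open>The weight |x| on the tensor coordinates gives both off-diagonal entries of a pair the
  size |x| |f_1|. The sum norm is easy to estimate and equivalent to the Hilbert norm of the
  fibre.\<close>

definition fibre_size :: "('h, 'l) vec \<Rightarrow> real \<Rightarrow> real" where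
  "fibre_size v x = norm (fst v x) + \<bar>x\<bar> * (\<Sum>i<n. norm (\<kappa> i (snd v x)))"

text \<open>In the constant, 1 serves the first component, and the sum of the norms of the
  \<open>r p j\<close> bounds the passage from \<open>\<kappa>\<close> to
  \<open>\<rho>\<close>.\<close>

lemma fibre_norm_le_size: "\<exists>C\<ge>0. \<forall>v x. sqrt (fibre_norm2 v x) \<le> C * fibre_size v x"
proof (intro exI conjI allI)
  let ?R = "\<Sum>p<n. \<Sum>j<n. norm (r p j)"
  have R: "?R \<ge> 0" by (intro sum_nonneg) auto
  then show "max 1 ?R \<ge> 0" by simp
  fix v :: "('h, 'l) vec" and x :: real
  let ?s = "\<Sum>p<n. norm (\<rho> p (snd v x))"
  have "(\<Sum>p<n. (norm (\<rho> p (snd v x)))\<^sup>2) \<le> ?s\<^sup>2"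
    using L2_set_le_sum[of "{..<n}" "\<lambda>p. norm (\<rho> p (snd v x))"]
    unfolding L2_set_def by (rule sqrt_le_D) auto
  then have "x\<^sup>2 * (\<Sum>p<n. (norm (\<rho> p (snd v x)))\<^sup>2) \<le> (\<bar>x\<bar> * ?s)\<^sup>2"
    by (simp add: power_mult_distrib mult_left_mono)
  moreover have "0 \<le> norm (fst v x) * (\<bar>x\<bar> * ?s)"
    by (intro mult_nonneg_nonneg sum_nonneg) auto
  ultimately have "fibre_norm2 v x \<le> (norm (fst v x) + \<bar>x\<bar> * ?s)\<^sup>2"
    unfolding fibre_norm2_def power2_sum by linarith
  then have "sqrt (fibre_norm2 v x) \<le> norm (fst v x) + \<bar>x\<bar> * ?s"
    by (intro real_le_lsqrt) (auto intro!: add_nonneg_nonneg mult_nonneg_nonneg sum_nonneg)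
  also have "?s \<le> ?R * (\<Sum>j<n. norm (\<kappa> j (snd v x)))"
    unfolding \<rho>_def by (rule sum_norm_blinfun_le)
  also have "?R * (\<Sum>j<n. norm (\<kappa> j (snd v x))) \<le> max 1 ?R * (\<Sum>j<n. norm (\<kappa> j (snd v x)))"
    by (intro mult_right_mono sum_nonneg) auto
  also have "norm (fst v x) \<le> max 1 ?R * norm (fst v x)"
    using mult_right_mono[of 1 "max 1 ?R" "norm (fst v x)"] by simp
  finally show "sqrt (fibre_norm2 v x) \<le> max 1 ?R * fibre_size v x"
    by (simp add: fibre_size_def distrib_left mult.left_commute mult_left_mono)
qed

text \<open>Turns \<open>\<kappa>_eq_\<rho>\<close> into an estimate: \<open>?D\<close> bounds the
  matrix recovering \<open>\<kappa>\<close> from \<open>\<rho>\<close>, \<open>n\<close> counts the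
  components of \<open>\<rho>\<close>, each at most \<open>?N\<close> after weighting, and the 1 is
  for the first component.\<close>

lemma fibre_size_le_norm: "\<exists>C\<ge>0. \<forall>v x. (\<forall>x. tc (snd v x)) \<longrightarrow> fibre_size v x \<le> C * sqrt (fibre_norm2 v x)"
proof (intro exI conjI allI impI)
  let ?T = "\<lambda>i p. \<Sum>m<n. \<epsilon> m (dual_rep i) o\<^sub>L r m p"
  let ?D = "\<Sum>i<n. \<Sum>p<n. norm (?T i p)"
  have D: "?D \<ge> 0" by (intro sum_nonneg) auto
  then show "1 + ?D * real n \<ge> 0" by simp
  fix v :: "('h, 'l) vec" and x :: real assume v: "\<forall>x. tc (snd v x)"
  let ?N = "sqrt (fibre_norm2 v x)"
  have "\<kappa> i (snd v x) = (\<Sum>p<n. ?T i p (\<rho> p (snd v x)))" if "i < n" for i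
  proof -
    have "\<kappa> i (snd v x) = (\<Sum>m<n. \<Sum>p<n. \<epsilon> m (dual_rep i) (r m p (\<rho> p (snd v x))))"
      by (rule \<kappa>_eq_\<rho>[OF that]) (simp add: v)
    also have "\<dots> = (\<Sum>p<n. \<Sum>m<n. \<epsilon> m (dual_rep i) (r m p (\<rho> p (snd v x))))"
      by (rule sum.swap)
    finally show ?thesis by (simp add: blinfun.sum_left)
  qed
  then have "(\<Sum>i<n. norm (\<kappa> i (snd v x))) = (\<Sum>i<n. norm (\<Sum>p<n. ?T i p (\<rho> p (snd v x))))"
    by simp
  also have "\<dots> \<le> ?D * (\<Sum>p<n. norm (\<rho> p (snd v x)))"
    by (rule sum_norm_blinfun_le)
  finally have "\<bar>x\<bar> * (\<Sum>i<n. norm (\<kappa> i (snd v x))) \<le> ?D * (\<Sum>p<n. \<bar>x\<bar> * norm (\<rho> p (snd v x)))"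
    by (simp add: sum_distrib_left[symmetric] mult.left_commute mult_left_mono)
  also have "(\<Sum>p<n. \<bar>x\<bar> * norm (\<rho> p (snd v x))) \<le> (\<Sum>p<n. ?N)"
  proof (rule sum_mono)
    fix p assume p: "p \<in> {..<n}"
    have "(norm (\<rho> p (snd v x)))\<^sup>2 \<le> (\<Sum>p<n. (norm (\<rho> p (snd v x)))\<^sup>2)"
      by (rule member_le_sum[OF p]) auto
    then have "x\<^sup>2 * (norm (\<rho> p (snd v x)))\<^sup>2 \<le> x\<^sup>2 * (\<Sum>p<n. (norm (\<rho> p (snd v x)))\<^sup>2)"
      by (rule mult_left_mono) simp
    then have "(\<bar>x\<bar> * norm (\<rho> p (snd v x)))\<^sup>2 \<le> fibre_norm2 v x"
      unfolding fibre_norm2_def power_mult_distrib power2_abs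
      using zero_le_power2[of "norm (fst v x)"] by linarith
    then show "\<bar>x\<bar> * norm (\<rho> p (snd v x)) \<le> ?N"
      by (rule real_le_rsqrt)
  qed
  finally have "\<bar>x\<bar> * (\<Sum>i<n. norm (\<kappa> i (snd v x))) \<le> ?D * real n * ?N"
    using D by (simp add: mult_left_mono mult.assoc)
  moreover have "norm (fst v x) \<le> ?N"
    by (rule real_le_rsqrt) (auto simp: fibre_norm2_def intro!: mult_nonneg_nonneg sum_nonneg)
  ultimately show "fibre_size v x \<le> (1 + ?D * real n) * ?N"
    by (simp add: fibre_size_def distrib_right)
qed

lemma act_fibre_size:
  assumes f0: "fst f \<in> Clim A A" and f1: "snd f \<in> L_Cc"
  shows "\<exists>C\<ge>0. \<forall>v x. (\<forall>x. tc (snd v x)) \<longrightarrow> fibre_size (act f v) x \<le> C * fibre_size v x"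
proof -
  have fA: "\<And>x. fst f x \<in> A"
    using f0 by (rule Clim_range)
  obtain K0 where K0: "K0 \<ge> 0" "\<And>x. norm (fst f x) \<le> K0"
    using Clim_bounded[OF f0] by blast
  obtain K1 where K1: "K1 \<ge> 0" "\<And>j x. j < n \<Longrightarrow> \<bar>x\<bar> * norm (hp (snd f x) (e j)) \<le> K1"
    using Cc_weighted_bound[of n "\<lambda>j x. hp (snd f x) (e j)" A] L_Cc_hp[OF f1] by blast
  obtain K2 where K2: "K2 \<ge> 0" "\<And>i x. i < n \<Longrightarrow> \<bar>x\<bar> * norm (\<epsilon> i (st (snd f x))) \<le> K2"
    using Cc_weighted_bound[of n "\<lambda>i x. \<epsilon> i (st (snd f x))" A] L_Cc_\<epsilon>[OF L_Cc_st[OF f1]] by blast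
  \<comment> \<open>The coefficient of |v_0| plus that of the weighted tensor norm.
    \<open>K0\<close> and \<open>M * K0\<close> come from the diagonal entries, \<open>K1\<close>
    and \<open>K2\<close> from the off-diagonal ones, and \<open>n\<close> from summing over the
    coordinates of the image.\<close>
  define C where "C = (K0 + real n * K2) + (K1 + real n * (M * K0))"
  show ?thesis
  proof (intro exI[of _ C] conjI allI impI)
    show "C \<ge> 0" using K0 K1 K2 M_nonneg by (simp add: C_def)
    fix v :: "('h, 'l) vec" and x :: real assume "\<forall>x. tc (snd v x)"
    then have v: "\<And>x. tc (snd v x)" by blast
    note coords = act_coords[of f v, OF fA v]
    let ?k = "\<Sum>j<n. norm (\<kappa> j (snd v x))" and ?u = "norm (fst v x)"
    have k: "?k \<ge> 0" by (intro sum_nonneg) auto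
    have "norm (\<Sum>j<n. hp (snd f x) (e j) (\<kappa> j (snd v x)))
        \<le> (\<Sum>j<n. norm (hp (snd f x) (e j)) * norm (\<kappa> j (snd v x)))"
      by (rule sum_norm_le) (rule norm_blinfun)
    then have "\<bar>x\<bar> * norm (\<Sum>j<n. hp (snd f x) (e j) (\<kappa> j (snd v x)))
        \<le> (\<Sum>j<n. (\<bar>x\<bar> * norm (hp (snd f x) (e j))) * norm (\<kappa> j (snd v x)))"
      by (simp add: sum_distrib_left[symmetric] mult.assoc mult_left_mono)
    also have "\<dots> \<le> (\<Sum>j<n. K1 * norm (\<kappa> j (snd v x)))"
      by (intro sum_mono mult_right_mono K1) auto
    finally have 1: "\<bar>x\<bar> * norm (\<Sum>j<n. hp (snd f x) (e j) (\<kappa> j (snd v x))) \<le> K1 * ?k"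
      by (simp add: sum_distrib_left)
    have "norm (fst (act f v) x) \<le> norm (fst f x (fst v x))
        + \<bar>x\<bar> * (\<bar>x\<bar> * norm (\<Sum>j<n. hp (snd f x) (e j) (\<kappa> j (snd v x))))"
      unfolding coords(1) by (rule order_trans[OF norm_triangle_ineq]) (simp add: power2_eq_square abs_mult mult.assoc)
    also have "norm (fst f x (fst v x)) \<le> K0 * ?u"
      by (rule order_trans[OF norm_blinfun mult_right_mono[OF K0(2)]]) simp
    also have "\<bar>x\<bar> * (\<bar>x\<bar> * norm (\<Sum>j<n. hp (snd f x) (e j) (\<kappa> j (snd v x)))) \<le> \<bar>x\<bar> * (K1 * ?k)"
      by (intro mult_left_mono 1) auto
    finally have first: "norm (fst (act f v) x) \<le> K0 * ?u + K1 * (\<bar>x\<bar> * ?k)"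
      by (simp add: mult.left_commute)
    have second: "\<bar>x\<bar> * norm (\<kappa> i (snd (act f v) x)) \<le> K2 * ?u + M * K0 * (\<bar>x\<bar> * ?k)" if i: "i < n" for i
    proof -
      have "\<bar>x\<bar> * norm (adj (\<epsilon> i (st (snd f x))) (fst v x)) \<le> \<bar>x\<bar> * (norm (\<epsilon> i (st (snd f x))) * ?u)"
        using norm_blinfun[of "adj (\<epsilon> i (st (snd f x)))" "fst v x"]
        by (intro mult_left_mono) (simp_all add: norm_adj \<epsilon>_in i)
      also have "\<dots> \<le> K2 * ?u"
        unfolding mult.assoc[symmetric] by (intro mult_right_mono K2 i) simp
      finally have a: "\<bar>x\<bar> * norm (adj (\<epsilon> i (st (snd f x))) (fst v x)) \<le> K2 * ?u" .
      have "norm (adj (\<epsilon> i (ra (e j) (adj (fst f x)))) (\<kappa> j (snd v x))) \<le> M * K0 * norm (\<kappa> j (snd v x))"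
        if j: "j < n" for j
      proof -
        have "norm (adj (\<epsilon> i (ra (e j) (adj (fst f x))))) \<le> M * norm (adj (fst f x))"
          unfolding norm_adj[OF \<epsilon>_in[OF i]] using M_bound i j A_adj[OF fA] by blast
        also have "\<dots> \<le> M * K0"
          by (intro mult_left_mono M_nonneg) (simp add: norm_adj fA K0)
        finally show ?thesis
          by (rule order_trans[OF norm_blinfun mult_right_mono]) simp
      qed
      then have "norm (\<Sum>j<n. adj (\<epsilon> i (ra (e j) (adj (fst f x)))) (\<kappa> j (snd v x)))
          \<le> (\<Sum>j<n. M * K0 * norm (\<kappa> j (snd v x)))"
        by (intro sum_norm_le) simp
      then have b: "\<bar>x\<bar> * norm (\<Sum>j<n. adj (\<epsilon> i (ra (e j) (adj (fst f x)))) (\<kappa> j (snd v x)))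
          \<le> M * K0 * (\<bar>x\<bar> * ?k)"
        by (simp add: sum_distrib_left[symmetric] mult.left_commute mult_left_mono)
      have "\<bar>x\<bar> * norm (\<kappa> i (snd (act f v) x)) \<le> \<bar>x\<bar> * (norm (adj (\<epsilon> i (st (snd f x))) (fst v x))
          + norm (\<Sum>j<n. adj (\<epsilon> i (ra (e j) (adj (fst f x)))) (\<kappa> j (snd v x))))"
        unfolding coords(3)[OF i] by (intro mult_left_mono norm_triangle_ineq) simp
      then show ?thesis using a b by (simp add: distrib_left)
    qed
    have "\<bar>x\<bar> * (\<Sum>i<n. norm (\<kappa> i (snd (act f v) x))) \<le> (\<Sum>i<n. K2 * ?u + M * K0 * (\<bar>x\<bar> * ?k))"
      by (subst sum_distrib_left) (intro sum_mono second, simp)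
    then have "fibre_size (act f v) x \<le> (K0 + real n * K2) * ?u + (K1 + real n * (M * K0)) * (\<bar>x\<bar> * ?k)"
      unfolding fibre_size_def using first by (simp add: algebra_simps)
    also have "\<dots> \<le> C * ?u + C * (\<bar>x\<bar> * ?k)"
    proof (rule add_mono; rule mult_right_mono)
      have "0 \<le> K0 + real n * K2" "0 \<le> K1 + real n * (M * K0)"
        using K0 K1 K2 M_nonneg by simp_all
      then show "K0 + real n * K2 \<le> C" "K1 + real n * (M * K0) \<le> C"
        unfolding C_def by linarith+
    qed (use k in auto)
    finally show "fibre_size (act f v) x \<le> C * fibre_size v x"
      by (simp add: fibre_size_def distrib_left)
  qed
qed

text \<open>Squared, so that it can be integrated against the weight. The constant is the product of
  the two comparison constants and that of the action.\<close>

lemma act_bounded: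
  assumes f0: "fst f \<in> Clim A A" and f1: "snd f \<in> L_Cc"
  shows "\<exists>C\<ge>0. \<forall>v\<in>V. \<forall>x. fibre_norm2 (act f v) x \<le> C\<^sup>2 * fibre_norm2 v x"
proof -
  obtain C1 where C1: "C1 \<ge> 0" "\<And>v x. sqrt (fibre_norm2 v x) \<le> C1 * fibre_size v x"
    using fibre_norm_le_size by blast
  obtain C2 where C2: "C2 \<ge> 0"
    "\<And>v x. (\<forall>x. tc (snd v x)) \<Longrightarrow> fibre_size v x \<le> C2 * sqrt (fibre_norm2 v x)"
    using fibre_size_le_norm by blast
  obtain C3 where C3: "C3 \<ge> 0"
    "\<And>v x. (\<forall>x. tc (snd v x)) \<Longrightarrow> fibre_size (act f v) x \<le> C3 * fibre_size v x"
    using act_fibre_size[OF f0 f1] by blast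
  let ?C = "C1 * (C3 * C2)"
  have "fibre_norm2 (act f v) x \<le> ?C\<^sup>2 * fibre_norm2 v x" if v: "v \<in> V" for v x
  proof -
    have tcv: "\<forall>x. tc (snd v x)" using V_tc[OF v] by blast
    have "sqrt (fibre_norm2 (act f v) x) \<le> C1 * (C3 * (C2 * sqrt (fibre_norm2 v x)))"
      by (intro order_trans[OF C1(2)] mult_left_mono order_trans[OF C3(2)[OF tcv]] C1(1) C3(1)
          C2(2)[OF tcv])
    then have "(sqrt (fibre_norm2 (act f v) x))\<^sup>2 \<le> (?C * sqrt (fibre_norm2 v x))\<^sup>2"
      by (intro power_mono) (auto simp: mult.assoc fibre_norm2_nonneg)
    then show ?thesis
      by (simp add: power_mult_distrib fibre_norm2_nonneg)
  qed
  then show ?thesis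
    using C1(1) C2(1) C3(1) by (intro exI[of _ ?C]) simp
qed

lemma inner01_mono:
  assumes "v \<in> V" "w \<in> V" "\<And>x. fibre_norm2 w x \<le> C * fibre_norm2 v x"
  shows "Re (inner01 A L G w w) \<le> C * Re (inner01 A L G v v)"
proof -
  have "fibre_norm2 w x / (1 + x\<^sup>2) \<le> C * (fibre_norm2 v x / (1 + x\<^sup>2))" for x
    using one_plus_square_pos[of x] assms(3)[of x] by (simp add: divide_right_mono less_imp_le)
  then have "(LINT x|lborel. fibre_norm2 w x / (1 + x\<^sup>2)) \<le> (LINT x|lborel. C * (fibre_norm2 v x / (1 + x\<^sup>2)))"
    by (intro integral_mono integrable_mult_right inner01_self(2) assms)
  also have "\<dots> = C * (LINT x|lborel. fibre_norm2 v x / (1 + x\<^sup>2))"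
    by (rule integral_mult_right_zero)
  finally show ?thesis
    by (simp add: inner01_self(1) assms)
qed

section \<open>The represented algebras\<close>

abbreviation pairs where "pairs Z \<equiv> fpairs A L n e (Clim A Z)"

lemma mem_pairs: "f \<in> pairs Z \<longleftrightarrow> fst f \<in> Clim A Z \<and> snd f \<in> L_Cc"
  by (cases f) (simp add: fpairs_eq)

lemma pairs_mono: "Z \<subseteq> A \<Longrightarrow> f \<in> pairs Z \<Longrightarrow> f \<in> pairs A"
  using Clim_mono[of A A Z A] by (auto simp: mem_pairs)

lemma pairs_fst: "f \<in> pairs Z \<Longrightarrow> fst f x \<in> A"
  unfolding mem_pairs by (blast intro: Clim_range)

lemma L_Cc_zero: "(\<lambda>x. 0) \<in> L_Cc"
  by (simp add: L_Cc_def \<epsilon>_zero Cc_zero A_zero)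

section \<open>Star algebras of pairs with prescribed limits\<close>

context
  fixes Z assumes Z: "star_subalgebra A Z"
begin

lemma zero_pair: "(\<lambda>x. 0, \<lambda>x. 0) \<in> pairs Z"
  using Z by (simp add: mem_pairs L_Cc_zero Clim_const A_zero star_subalgebra_def)

lemma pairs_add:
  assumes "f \<in> pairs Z" "g \<in> pairs Z"
  shows "fpair_add f g \<in> pairs Z"
proof -
  have "(\<lambda>x. fst f x + fst g x) \<in> Clim A Z"
    by (rule Clim_add) (use assms Z in \<open>auto simp: mem_pairs A_add star_subalgebra_def\<close>)
  then show ?thesis
    using assms by (simp add: mem_pairs fpair_add_def L_Cc_add)
qed

lemma pairs_scale:
  assumes "f \<in> pairs Z"
  shows "fpair_scale c f \<in> pairs Z"
proof -
  have "(\<lambda>x. c *\<^sub>C fst f x) \<in> Clim A Z"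
    by (rule Clim_comp[OF _ continuous_on_scaleC])
      (use assms Z in \<open>auto simp: mem_pairs A_scaleC star_subalgebra_def\<close>)
  then show ?thesis
    using assms by (simp add: mem_pairs fpair_scale_def L_Cc_scale)
qed

lemma pairs_star:
  assumes "f \<in> pairs Z"
  shows "fpair_star st f \<in> pairs Z"
proof -
  have "(\<lambda>x. adj (fst f x)) \<in> Clim A Z"
    by (rule Clim_comp[OF _ continuous_on_adj])
      (use assms Z in \<open>auto simp: mem_pairs A_adj star_subalgebra_def\<close>)
  then show ?thesis
    using assms by (simp add: mem_pairs fpair_star_def L_Cc_st)
qed

text \<open>The metric term has compact support, so the limit at infinity of the first component is
  the product of the limits, which stays in \<open>Z\<close>.\<close>

lemma pairs_mult:
  assumes f: "f \<in> pairs Z" and g: "g \<in> pairs Z"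
  shows "fpair_mult A L st G f g \<in> pairs Z"
proof -
  have 1: "(\<lambda>x. fst f x o\<^sub>L fst g x) \<in> Clim A Z"
    by (rule Clim_bilinear[OF bounded_bilinear_blinfun_compose])
      (use assms Z in \<open>auto simp: mem_pairs A_compose star_subalgebra_def\<close>)
  have "(\<lambda>x. x\<^sup>2 *\<^sub>R hp (snd f x) (st (snd g x))) \<in> Cc A"
    by (rule Cc_bilinear_right[OF bounded_bilinear_scaleR _ L_Cc_hp2[OF _ L_Cc_st]])
      (use f g in \<open>auto simp: mem_pairs A_scaleR hp_in intro!: continuous_intros\<close>)
  then have 2: "(\<lambda>x. x\<^sup>2 *\<^sub>R hp (snd f x) (st (snd g x))) \<in> Clim A {0}"
    by (rule subsetD[OF Cc_subset_Clim])
  have "(\<lambda>x. (fst f x o\<^sub>L fst g x) + x\<^sup>2 *\<^sub>R hp (snd f x) (st (snd g x))) \<in> Clim A Z"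
    by (rule Clim_add[OF 1 2]) (use A_add in auto)
  moreover have "(\<lambda>x. la (fst f x) (snd g x) + ra (snd f x) (fst g x)) \<in> L_Cc"
    by (rule L_Cc_add[OF L_Cc_la L_Cc_ra])
      (use f g in \<open>auto simp: mem_pairs intro: Clim_continuous Clim_range\<close>)
  ultimately show ?thesis
    by (simp add: mem_pairs fpair_mult_def hip_eq)
qed

end

lemma star_subalgebra_zero: "star_subalgebra A {0}"
  by (simp add: star_subalgebra_def A_zero adj_zero)

lemma star_subalgebra_whole: "star_subalgebra A A"
  by (simp add: star_subalgebra_def A_zero A_add A_scaleC A_compose A_adj)

lemma star_subalgebra_scalars: "star_subalgebra A (range (\<lambda>c. c *\<^sub>C id_blinfun))"
proof -
  have "0 = (0::complex) *\<^sub>C (id_blinfun :: 'h op)" by simp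
  then have "0 \<in> range (\<lambda>c. c *\<^sub>C (id_blinfun :: 'h op))" by blast
  then show ?thesis
    unfolding star_subalgebra_def
    by (auto simp: A_scaleC A_id scaleC_add_left[symmetric] scaleC_scaleC compose_scaleC_left
        adj_scaleC adj_id)
qed

text \<open>The adjoined scalar is recovered as the limit at infinity.\<close>

lemma C0_plus_scalars_eq: "C0_plus_scalars A = Clim A (range (\<lambda>c. c *\<^sub>C id_blinfun))"
proof (intro equalityI subsetI)
  fix f assume "f \<in> C0_plus_scalars A"
  then obtain f0 c where f: "f = (\<lambda>x. f0 x + c *\<^sub>C id_blinfun)" and f0: "f0 \<in> Clim A {0}"
    by (auto simp: C0_plus_scalars_def C0_eq_Clim)
  have "(\<lambda>x. c *\<^sub>C id_blinfun) \<in> Clim A {c *\<^sub>C id_blinfun}"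
    by (intro Clim_const) (auto simp: A_scaleC A_id)
  from Clim_add[OF f0 this] show "f \<in> Clim A (range (\<lambda>c. c *\<^sub>C id_blinfun))"
    unfolding f by (auto simp: A_add)
next
  fix f assume "f \<in> Clim A (range (\<lambda>c. c *\<^sub>C id_blinfun))"
  then obtain c where c: "f \<in> Clim A {c *\<^sub>C id_blinfun}"
    by (auto simp: Clim_def)
  have "(\<lambda>x. f x - c *\<^sub>C id_blinfun) \<in> Clim A {0}"
    by (rule Clim_comp[OF c]) (auto intro!: continuous_intros A_diff A_scaleC A_id)
  then show "f \<in> C0_plus_scalars A"
    unfolding C0_plus_scalars_def C0_eq_Clim
    by (intro CollectI exI[of _ "\<lambda>x. f x - c *\<^sub>C id_blinfun"] exI[of _ c]) auto
qed

section \<open>Operators on the completion\<close>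

context
  fixes \<iota> :: "('h, 'l) vec \<Rightarrow> 'k::complex_hilbert"
  assumes completion: "is_completion A L G n e \<iota>"
begin

lemma
  shows \<iota>_add: "v \<in> V \<Longrightarrow> w \<in> V \<Longrightarrow> \<iota> (vec_add A L v w) = \<iota> v + \<iota> w"
    and \<iota>_scale: "v \<in> V \<Longrightarrow> \<iota> (vec_scale A L c v) = c *\<^sub>C \<iota> v"
    and \<iota>_inner: "v \<in> V \<Longrightarrow> w \<in> V \<Longrightarrow> cinner (\<iota> v) (\<iota> w) = inner01 A L G v w"
    and \<iota>_dense: "closure (\<iota> ` V) = UNIV"
  using completion by (simp_all add: is_completion_def Let_def)

lemma norm_\<iota>: "v \<in> V \<Longrightarrow> (norm (\<iota> v))\<^sup>2 = Re (inner01 A L G v v)"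
  by (simp add: norm_eq_sqrt_cinner \<iota>_inner)

lemma norm_\<iota>_le:
  assumes "v \<in> V" "w \<in> V" "C \<ge> 0" "\<And>x. fibre_norm2 w x \<le> C\<^sup>2 * fibre_norm2 v x"
  shows "norm (\<iota> w) \<le> C * norm (\<iota> v)"
proof -
  have "(norm (\<iota> w))\<^sup>2 \<le> (C * norm (\<iota> v))\<^sup>2"
    using inner01_mono[OF assms(1,2,4)] by (simp add: norm_\<iota> assms power_mult_distrib)
  then show ?thesis
    by (rule power2_le_imp_le) (simp add: assms(3))
qed

abbreviation extends where "extends \<equiv> extends_act A L st G n e \<iota>"
abbreviation \<pi> where "\<pi> \<equiv> rep A L st G n e \<iota>"

lemma pairs_act_V: "f \<in> pairs A \<Longrightarrow> v \<in> V \<Longrightarrow> act f v \<in> V"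
  by (simp add: mem_pairs act_V)

lemma extends_unique: "extends f S \<Longrightarrow> extends f T \<Longrightarrow> S = T"
  by (rule blinfun_eq_on_dense[OF \<iota>_dense]) (auto simp: extends_act_def)

lemma extends_exists:
  assumes f: "f \<in> pairs A"
  shows "\<exists>T. extends f T"
proof -
  obtain C where C: "C \<ge> 0" "\<And>v x. v \<in> V \<Longrightarrow> fibre_norm2 (act f v) x \<le> C\<^sup>2 * fibre_norm2 v x"
    using act_bounded[of f] f unfolding mem_pairs by blast
  have bound: "norm (\<iota> (act f v)) \<le> C * norm (\<iota> v)" if "v \<in> V" for v
    using norm_\<iota>_le[OF that pairs_act_V[OF f that] C(1) C(2)[OF that]] .
  note add = act_vec_add[of f, OF pairs_fst[OF f] V_tc V_tc]
  note scale = act_vec_scale[of f, OF pairs_fst[OF f] V_tc]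
  \<comment> \<open>The operator is first defined through chosen preimages under
    \<open>\<iota>\<close>; the bound applied to v - w shows that the choice does not
    matter.\<close>
  have welldef: "\<iota> (act f v) = \<iota> (act f w)" if v: "v \<in> V" and w: "w \<in> V" and eq: "\<iota> v = \<iota> w" for v w
  proof -
    let ?w = "vec_scale A L (-1) w"
    have "\<iota> (vec_add A L v ?w) = 0"
      using v w eq by (simp add: \<iota>_add \<iota>_scale vec_scale_V scaleC_minus_left scaleC_one)
    then have "\<iota> (act f (vec_add A L v ?w)) = 0"
      using bound[OF vec_add_V[OF v vec_scale_V[OF w]], of "-1"] by simp
    moreover have "\<iota> (act f (vec_add A L v ?w)) = \<iota> (act f v) - \<iota> (act f w)"
      by (simp add: add[OF v vec_scale_V[OF w]] scale[OF w] \<iota>_add \<iota>_scale pairs_act_V f v w vec_scale_V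
          scaleC_minus_left scaleC_one)
    ultimately show ?thesis by simp
  qed
  define T\<^sub>0 where "T\<^sub>0 y = \<iota> (act f (inv_into V \<iota> y))" for y
  have T\<^sub>0: "T\<^sub>0 (\<iota> v) = \<iota> (act f v)" if "v \<in> V" for v
    unfolding T\<^sub>0_def
    by (rule welldef) (use that in \<open>auto intro: inv_into_into f_inv_into_f\<close>)
  have "\<exists>T. clinear_op T \<and> (\<forall>x\<in>\<iota> ` V. blinfun_apply T x = T\<^sub>0 x)"
  proof (rule extend_clinear[OF \<iota>_dense, of _ C])
    fix x y assume "x \<in> \<iota> ` V" "y \<in> \<iota> ` V"
    then obtain v w where v: "v \<in> V" "x = \<iota> v" and w: "w \<in> V" "y = \<iota> w" by blast
    have xy: "x + y = \<iota> (vec_add A L v w)" by (simp add: v w \<iota>_add)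
    then show "x + y \<in> \<iota> ` V" using vec_add_V[OF v(1) w(1)] by blast
    show "T\<^sub>0 (x + y) = T\<^sub>0 x + T\<^sub>0 y"
      unfolding xy T\<^sub>0[OF vec_add_V[OF v(1) w(1)]] add[OF v(1) w(1)]
      by (simp add: v w T\<^sub>0 \<iota>_add pairs_act_V f)
  next
    fix c x assume "x \<in> \<iota> ` V"
    then obtain v where v: "v \<in> V" "x = \<iota> v" by blast
    have cx: "c *\<^sub>C x = \<iota> (vec_scale A L c v)" by (simp add: v \<iota>_scale)
    then show "c *\<^sub>C x \<in> \<iota> ` V" using vec_scale_V[OF v(1)] by blast
    show "T\<^sub>0 (c *\<^sub>C x) = c *\<^sub>C T\<^sub>0 x"
      unfolding cx T\<^sub>0[OF vec_scale_V[OF v(1)]] scale[OF v(1)]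
      by (simp add: v T\<^sub>0 \<iota>_scale pairs_act_V f)
    show "norm (T\<^sub>0 x) \<le> C * norm x"
      using bound v by (simp add: T\<^sub>0)
  qed (rule C(1))
  then show ?thesis
    using T\<^sub>0 by (auto simp: extends_act_def)
qed

lemma \<pi>_eqI:
  assumes "extends f T"
  shows "\<pi> f = T"
  unfolding rep_def using assms extends_unique by (intro the_equality) auto

lemma \<pi>_extends: "f \<in> pairs A \<Longrightarrow> extends f (\<pi> f)"
  using extends_exists \<pi>_eqI by metis

lemma \<pi>_clinear: "f \<in> pairs A \<Longrightarrow> clinear_op (\<pi> f)"
  using \<pi>_extends by (simp add: extends_act_def)

lemma \<pi>_apply: "f \<in> pairs A \<Longrightarrow> v \<in> V \<Longrightarrow> \<pi> f (\<iota> v) = \<iota> (act f v)"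
  using \<pi>_extends by (simp add: extends_act_def)

lemma \<pi>_add:
  assumes "f \<in> pairs A" "g \<in> pairs A"
  shows "\<pi> (fpair_add f g) = \<pi> f + \<pi> g"
proof (rule \<pi>_eqI)
  show "extends (fpair_add f g) (\<pi> f + \<pi> g)"
    using \<pi>_clinear[OF assms(1)] \<pi>_clinear[OF assms(2)]
    by (simp add: extends_act_def clinear_op_def blinfun.add_left scaleC_add_right \<pi>_apply assms
        act_add pairs_fst[OF assms(1)] pairs_fst[OF assms(2)] V_tc \<iota>_add pairs_act_V)
qed

lemma \<pi>_scale:
  assumes "f \<in> pairs A"
  shows "\<pi> (fpair_scale c f) = c *\<^sub>C \<pi> f"
proof (rule \<pi>_eqI)
  show "extends (fpair_scale c f) (c *\<^sub>C \<pi> f)"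
    using \<pi>_clinear[OF assms]
    by (simp add: extends_act_def clinear_op_def scaleC_scaleC mult.commute \<pi>_apply assms
        act_scale pairs_fst[OF assms] V_tc \<iota>_scale pairs_act_V)
qed

lemma \<pi>_mult:
  assumes "f \<in> pairs A" "g \<in> pairs A"
  shows "\<pi> (fpair_mult A L st G f g) = \<pi> f o\<^sub>L \<pi> g"
proof (rule \<pi>_eqI)
  show "extends (fpair_mult A L st G f g) (\<pi> f o\<^sub>L \<pi> g)"
    using \<pi>_clinear[OF assms(1)] \<pi>_clinear[OF assms(2)]
    by (simp add: extends_act_def clinear_op_def \<pi>_apply assms
        act_mult pairs_fst[OF assms(1)] pairs_fst[OF assms(2)] V_tc pairs_act_V)
qed

lemma \<pi>_one: "\<pi> (\<lambda>x. id_blinfun, \<lambda>x. 0) = id_blinfun"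
  by (rule \<pi>_eqI) (simp add: extends_act_def clinear_op_def act_one V_tc)

text \<open>Fibrewise adjointness integrates to adjointness on the image of \<open>\<iota>\<close>,
  and density does the rest.\<close>

lemma \<pi>_star:
  assumes f: "f \<in> pairs A"
  shows "is_adjoint (\<pi> (fpair_star st f)) (\<pi> f)"
proof (rule is_adjoint_on_dense[OF \<iota>_dense])
  note fs = pairs_star[OF star_subalgebra_whole f]
  fix x y assume "x \<in> \<iota> ` V" "y \<in> \<iota> ` V"
  then obtain v w where v: "v \<in> V" "x = \<iota> v" and w: "w \<in> V" "y = \<iota> w" by blast
  have "inner01 A L G (act (fpair_star st f) v) w = inner01 A L G v (act f w)"
    using act_adjoint[of f v w, OF pairs_fst[OF f] V_tc[OF v(1)] V_tc[OF w(1)]]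
    by (simp add: inner01_eq V_tc v w pairs_act_V f fs)
  then show "cinner (\<pi> (fpair_star st f) x) y = cinner x (\<pi> f y)"
    by (simp add: v w \<pi>_apply f fs \<iota>_inner pairs_act_V)
qed

context
  fixes Z assumes Z: "star_subalgebra A Z"
begin

lemma pairs_sub: "f \<in> pairs Z \<Longrightarrow> f \<in> pairs A"
  using pairs_mono Z unfolding star_subalgebra_def by blast

lemma \<pi>_image_zero: "0 \<in> \<pi> ` pairs Z"
proof (rule image_eqI[OF _ pairs_scale[OF Z zero_pair[OF Z]]])
  show "0 = \<pi> (fpair_scale 0 (\<lambda>x. 0, \<lambda>x. 0))"
    by (simp add: \<pi>_scale pairs_sub[OF zero_pair[OF Z]])
qed

lemma \<pi>_image_add:
  assumes "S \<in> \<pi> ` pairs Z" "T \<in> \<pi> ` pairs Z"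
  shows "S + T \<in> \<pi> ` pairs Z"
proof -
  obtain f g where f: "f \<in> pairs Z" "S = \<pi> f" and g: "g \<in> pairs Z" "T = \<pi> g"
    using assms by blast
  show ?thesis
    by (rule image_eqI[OF _ pairs_add[OF Z f(1) g(1)]]) (simp add: \<pi>_add pairs_sub f g)
qed

lemma \<pi>_image_mult:
  assumes "S \<in> \<pi> ` pairs Z" "T \<in> \<pi> ` pairs Z"
  shows "S o\<^sub>L T \<in> \<pi> ` pairs Z"
proof -
  obtain f g where f: "f \<in> pairs Z" "S = \<pi> f" and g: "g \<in> pairs Z" "T = \<pi> g"
    using assms by blast
  show ?thesis
    by (rule image_eqI[OF _ pairs_mult[OF Z f(1) g(1)]]) (simp add: \<pi>_mult pairs_sub f g)
qed

lemma \<pi>_image_scale: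
  assumes "T \<in> \<pi> ` pairs Z"
  shows "c *\<^sub>C T \<in> \<pi> ` pairs Z"
proof -
  obtain f where f: "f \<in> pairs Z" "T = \<pi> f"
    using assms by blast
  show ?thesis
    by (rule image_eqI[OF _ pairs_scale[OF Z f(1)]]) (simp add: \<pi>_scale pairs_sub f)
qed

lemma acts_by_bounded_pairs: "acts_by_bounded A L st G n e \<iota> (pairs Z)"
  unfolding acts_by_bounded_def Let_def
proof (intro conjI ballI allI)
  fix f assume "f \<in> pairs Z"
  then have "f \<in> pairs A" by (rule pairs_sub)
  then show "\<exists>!T. extends f T"
    using extends_exists extends_unique by (meson ex_ex1I)
qed (simp_all add: pairs_sub pairs_act_V pairs_add[OF Z] pairs_scale[OF Z] pairs_mult[OF Z]
    pairs_star[OF Z] \<pi>_add \<pi>_scale \<pi>_mult \<pi>_star)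

lemma \<pi>_cstar_algebra: "op_cstar_algebra (closure (\<pi> ` pairs Z))"
proof (rule op_cstar_algebra_closure)
  fix T assume "T \<in> \<pi> ` pairs Z"
  then obtain f where f: "f \<in> pairs Z" "T = \<pi> f" by blast
  show "clinear_op T"
    by (simp add: f pairs_sub \<pi>_clinear)
  show "\<exists>S\<in>\<pi> ` pairs Z. is_adjoint S T"
    using \<pi>_star[OF pairs_sub[OF f(1)]] pairs_star[OF Z f(1)] f(2) by blast
qed (simp_all add: \<pi>_image_zero \<pi>_image_add \<pi>_image_scale \<pi>_image_mult)

end

lemma one_pair: "id_blinfun \<in> Z \<Longrightarrow> (\<lambda>x. id_blinfun, \<lambda>x. 0) \<in> pairs Z"
  by (simp add: mem_pairs L_Cc_zero Clim_const A_id)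

lemma id_in_closure: "id_blinfun \<in> Z \<Longrightarrow> id_blinfun \<in> closure (\<pi> ` pairs Z)"
  using one_pair \<pi>_one closure_subset by (metis imageI subsetD)

text \<open>A constant scalar pair acts as a multiple of the identity, so adjoining scalars to f_0
  is adjoining them to the operators. Closures are taken later by
  \<open>closure_add_line\<close>.\<close>

lemma scalars_image:
  "\<pi> ` fpairs A L n e (C0_plus_scalars A) = {T + c *\<^sub>C id_blinfun | T c. T \<in> \<pi> ` pairs {0}}"
proof -
  have split: "\<pi> (\<lambda>x. f0 x + c *\<^sub>C id_blinfun, f1) = \<pi> (f0, f1) + c *\<^sub>C id_blinfun"
    if "(f0, f1) \<in> pairs {0}" for f0 f1 c
  proof -
    have "(\<lambda>x. f0 x + c *\<^sub>C id_blinfun, f1)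
        = fpair_add (f0, f1) (fpair_scale c (\<lambda>x. id_blinfun, \<lambda>x. 0))"
      by (simp add: fpair_add_def fpair_scale_def)
    moreover have "(f0, f1) \<in> pairs A"
      using pairs_mono[of "{0}"] that A_zero by simp
    ultimately show ?thesis
      using one_pair[OF A_id] pairs_scale[OF star_subalgebra_whole] by (simp add: \<pi>_add \<pi>_scale \<pi>_one)
  qed
  show ?thesis
  proof (intro equalityI subsetI)
    fix S assume "S \<in> \<pi> ` fpairs A L n e (C0_plus_scalars A)"
    then obtain f0 c f1 where "f0 \<in> Clim A {0}" "f1 \<in> L_Cc" "S = \<pi> (\<lambda>x. f0 x + c *\<^sub>C id_blinfun, f1)"
      by (auto simp: fpairs_eq C0_plus_scalars_def C0_eq_Clim)
    then show "S \<in> {T + c *\<^sub>C id_blinfun | T c. T \<in> \<pi> ` pairs {0}}"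
      using split[of f0 f1 c] by (auto simp: fpairs_eq)
  next
    fix S assume "S \<in> {T + c *\<^sub>C id_blinfun | T c. T \<in> \<pi> ` pairs {0}}"
    then obtain f0 f1 c where f: "(f0, f1) \<in> pairs {0}" "S = \<pi> (f0, f1) + c *\<^sub>C id_blinfun"
      by auto
    have "(\<lambda>x. f0 x + c *\<^sub>C id_blinfun, f1) \<in> fpairs A L n e (C0_plus_scalars A)"
      using f(1) by (auto simp: fpairs_eq C0_plus_scalars_def C0_eq_Clim)
    then show "S \<in> \<pi> ` fpairs A L n e (C0_plus_scalars A)"
      using split[OF f(1), of c] f(2) by (metis imageI)
  qed
qed

section \<open>Absence of a unit in case (a)\<close>

definition bump :: "real \<Rightarrow> 'h \<Rightarrow> ('h, 'l) vec" where
  "bump c u = (\<lambda>x. tent c x *\<^sub>R u, \<lambda>x. \<one>\<^bsub>TG\<^esub>)"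

lemma bump_coords:
  "fst (bump c u) x = tent c x *\<^sub>R u" "tc (snd (bump c u) x)" "i < n \<Longrightarrow> \<kappa> i (snd (bump c u) x) = 0"
  by (simp_all add: bump_def CT.tensor_one_closed \<kappa>_one)

lemma bump_V: "bump c u \<in> V"
proof -
  have "(\<lambda>x. tent c x *\<^sub>R u) \<in> Cc UNIV"
    by (rule Cc_bilinear_left[OF bounded_bilinear_scaleR tent_Cc]) auto
  then have "(\<lambda>x. tent c x *\<^sub>R u) \<in> Clim UNIV UNIV"
    using Cc_subset_Clim Clim_mono[of UNIV UNIV "{0}" UNIV] by blast
  then show ?thesis
    by (simp add: mem_V_iff bump_coords CT.tensor_one_closed \<kappa>_one Cc_zero)
      (simp add: bump_def)
qed

lemma bump_nonzero: "u \<noteq> 0 \<Longrightarrow> \<iota> (bump c u) \<noteq> 0"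
proof
  assume u: "u \<noteq> 0" and "\<iota> (bump c u) = 0"
  then have "Re (inner01 A L G (bump c u) (bump c u)) = 0"
    using norm_\<iota>[OF bump_V, of c u] by simp
  then have "bump c u = vec_zero A L"
    using inner01_pos[OF bump_V, of c u] by fastforce
  then have "fst (bump c u) c = 0"
    by (simp add: vec_zero_coords)
  then show False
    using u by (simp add: bump_coords tent_center)
qed

lemma fibre_norm2_no_tensor:
  "(\<And>i. i < n \<Longrightarrow> \<kappa> i (snd v x) = 0) \<Longrightarrow> fibre_norm2 v x = (norm (fst v x))\<^sup>2"
  by (simp add: fibre_norm2_def \<rho>_def)

text \<open>An approximant within 1/2 of a unit shrinks a far bump to at most a quarter of its norm,
  while the unit fixes the bump; but 1/2 + 1/4 < 1. The nonzero \<open>u\<close> makes the bump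
  nonzero.\<close>

lemma not_unital:
  assumes u: "(u::'h) \<noteq> 0"
  shows "\<not> has_unit (closure (\<pi> ` pairs {0}))"
proof
  note sub = pairs_sub[OF star_subalgebra_zero]
  assume "has_unit (closure (\<pi> ` pairs {0}))"
  then obtain P where P: "P \<in> closure (\<pi> ` pairs {0})"
    "\<And>T. T \<in> closure (\<pi> ` pairs {0}) \<Longrightarrow> P o\<^sub>L T = T"
    by (auto simp: has_unit_def)
  then obtain f where f: "f \<in> pairs {0}" and close: "dist (\<pi> f) P < 1/2"
    unfolding closure_approachable using half_gt_zero[OF zero_less_one] by blast
  have "(fst f \<longlongrightarrow> 0) at_infinity"
    using f unfolding mem_pairs by (simp add: Clim_def)
  then have "eventually (\<lambda>x. dist (fst f x) 0 < 1/4) at_infinity"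
    by (rule tendstoD) simp
  then obtain R0 where R0: "\<And>x. R0 \<le> norm x \<Longrightarrow> dist (fst f x) 0 < 1/4"
    by (auto simp: eventually_at_infinity)
  have "\<exists>R. \<forall>x. R \<le> \<bar>x\<bar> \<longrightarrow> \<epsilon> i (snd f x) = 0" if "i < n" for i
    using L_Cc_\<epsilon>[of "snd f" i] f that by (simp add: mem_pairs Cc_iff)
  then obtain R1 where R1: "\<And>i x. i < n \<Longrightarrow> R1 i \<le> \<bar>x\<bar> \<Longrightarrow> \<epsilon> i (snd f x) = 0"
    by metis
  \<comment> \<open>Inserting \<open>R0\<close> keeps the set nonempty for \<open>n = 0\<close>, and
    the 0 makes |x| equal to x beyond \<open>R\<close>.\<close>
  define R where "R = max 0 (Max (insert R0 (R1 ` {..<n})))"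
  have R: "R \<ge> 0" "R \<ge> R0" "\<And>i. i < n \<Longrightarrow> R \<ge> R1 i"
    by (auto simp: R_def intro!: max.coboundedI2)
  have f0: "norm (fst f x) \<le> 1/4" if "R \<le> x" for x
    using R0[of x] R that by (simp add: less_imp_le)
  have f1: "snd f x = 0" if "R \<le> x" for x
  proof -
    have "\<epsilon> i (snd f x) = 0" if "i < n" for i
      using R1[OF that, of x] R(1) R(3)[OF that] \<open>R \<le> x\<close> by simp
    then show ?thesis
      using expand[of "snd f x"] la_scaleC_left[OF A_zero, of 0] by simp
  qed
  \<comment> \<open>The tent has radius 1, so it lives where the \<open>L\<close>-part of
    \<open>f\<close> vanishes and f_0 has norm at most 1/4.\<close>
  define c where "c = R + 1"
  let ?t = "bump c u"
  have far: "R \<le> x" if "tent c x \<noteq> 0" for x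
    using tent_eq_0[of x c] that by (auto simp: c_def intro: ccontr)
  note act_t = act_coords[of _ ?t, OF _ bump_coords(2)]
  \<comment> \<open>Multiplication by the plateau belongs to the algebra and fixes the bump, so a
    left unit of the closure fixes the bump as well.\<close>
  let ?\<phi> = "(\<lambda>x. plateau c x *\<^sub>R id_blinfun, \<lambda>x. 0)"
  have "(\<lambda>x. plateau c x *\<^sub>R id_blinfun) \<in> Cc A"
    by (rule Cc_bilinear_left[OF bounded_bilinear_scaleR plateau_Cc]) (auto simp: A_scaleR A_id)
  then have \<phi>: "?\<phi> \<in> pairs {0}"
    using Cc_subset_Clim by (auto simp: mem_pairs L_Cc_zero)
  have "act ?\<phi> ?t = ?t"
    by (rule vec_eqI)
      (simp_all add: act_t bump_coords pairs_fst[OF \<phi>, simplified] blinfun.scaleR_left plateau_tent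
        st_zero \<epsilon>_zero adj_zero)
  then have "\<pi> ?\<phi> (\<iota> ?t) = \<iota> ?t"
    by (simp add: \<pi>_apply sub[OF \<phi>] bump_V)
  moreover have "P o\<^sub>L \<pi> ?\<phi> = \<pi> ?\<phi>"
    by (rule P(2)[OF subsetD[OF closure_subset imageI[OF \<phi>]]])
  ultimately have Pt: "P (\<iota> ?t) = \<iota> ?t"
    by (metis blinfun_apply_blinfun_compose)
  have "norm (\<iota> (act f ?t)) \<le> 1/4 * norm (\<iota> ?t)"
  proof (rule norm_\<iota>_le[OF bump_V pairs_act_V[OF sub[OF f] bump_V]])
    fix x
    have "\<kappa> i (snd (act f ?t) x) = 0" if "i < n" for i
    proof (cases "tent c x = 0")
      case False
      then show ?thesis
        using that by (simp add: act_t pairs_fst[OF f] bump_coords f1[OF far] st_zero \<epsilon>_zero adj_zero)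
    qed (use that in \<open>simp add: act_t pairs_fst[OF f] bump_coords\<close>)
    then have 1: "fibre_norm2 (act f ?t) x = (norm (fst (act f ?t) x))\<^sup>2"
      by (rule fibre_norm2_no_tensor)
    have 2: "fibre_norm2 ?t x = (norm (fst ?t x))\<^sup>2"
      by (rule fibre_norm2_no_tensor) (rule bump_coords)
    have "norm (fst f x (tent c x *\<^sub>R u)) \<le> 1/4 * norm (tent c x *\<^sub>R u)"
    proof (cases "tent c x = 0")
      case False
      show ?thesis
        by (rule order_trans[OF norm_blinfun mult_right_mono[OF f0[OF far[OF False]]]]) simp
    qed simp
    then have "norm (fst (act f ?t) x) \<le> 1/4 * norm (fst ?t x)"
      by (simp add: act_t pairs_fst[OF f] bump_coords)
    then have "(norm (fst (act f ?t) x))\<^sup>2 \<le> (1/4 * norm (fst ?t x))\<^sup>2"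
      by (rule power_mono) simp
    then show "fibre_norm2 (act f ?t) x \<le> (1/4)\<^sup>2 * fibre_norm2 ?t x"
      unfolding 1 2 power_mult_distrib .
  qed simp
  then have small: "norm (\<pi> f (\<iota> ?t)) \<le> 1/4 * norm (\<iota> ?t)"
    by (simp add: \<pi>_apply sub[OF f] bump_V)
  have "norm ((P - \<pi> f) (\<iota> ?t)) \<le> 1/2 * norm (\<iota> ?t)"
    using close by (intro order_trans[OF norm_blinfun mult_right_mono]) (auto simp: dist_norm norm_minus_commute)
  moreover have "norm (\<iota> ?t) \<le> norm ((P - \<pi> f) (\<iota> ?t)) + norm (\<pi> f (\<iota> ?t))"
    using norm_triangle_ineq[of "(P - \<pi> f) (\<iota> ?t)" "\<pi> f (\<iota> ?t)"] by (simp add: blinfun.diff_left Pt)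
  moreover have "norm (\<iota> ?t) > 0"
    using bump_nonzero[OF u, of c] by simp
  ultimately show False
    using small by linarith
qed

end

end

theorem theorem14p7:
  fixes A :: "'h::complex_hilbert op set"
    and L :: "('h op, 'l::complex_vector) bimodule"
    and st :: "'l \<Rightarrow> 'l"
    and G :: "'l conj \<Rightarrow> 'l \<Rightarrow> 'h op"
    and n :: nat
    and e :: "nat \<Rightarrow> 'l"
    and \<epsilon> :: "nat \<Rightarrow> 'l \<Rightarrow> 'h op"
    and r :: "nat \<Rightarrow> nat \<Rightarrow> 'h op"
    and M :: real
  assumes "op_cstar_algebra A" and "id_blinfun \<in> A"
    and "mcar L = UNIV" and "left_line_module A L n e \<epsilon>"
    and "star_operation A L st"
    and "hermitian_metric A L G" and "star_compatible A L n e \<epsilon> st G"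
    and "hilbert_cstar_module A L G"
    and "\<forall>i<n. \<forall>j<n. r i j \<in> A \<and> adj (r i j) = r j i"
    and "\<forall>i<n. \<forall>j<n. (\<Sum>p<n. r i p o\<^sub>L r p j) = hip A L G (e i) (Conj (e j))"
    and "M \<ge> 0"
    and "\<forall>i<n. \<forall>j<n. \<forall>a\<in>A. norm (\<epsilon> i (ract L (e j) a)) \<le> M * norm a"
  shows "pre_hilbert_H01 A L G n e \<and>
    (\<forall>\<iota> :: ('h, 'l) vec \<Rightarrow> 'k::complex_hilbert. is_completion A L G n e \<iota> \<longrightarrow>
      (let Pa = fpairs A L n e (C0 A);
           Pb = fpairs A L n e (C0_plus_scalars A);
           Pc = fpairs A L n e (C_inf A);
           Ba = cstar_completion A L st G n e \<iota> Pa;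
           Bb = cstar_completion A L st G n e \<iota> Pb;
           Bc = cstar_completion A L st G n e \<iota> Pc
       in
         acts_by_bounded A L st G n e \<iota> Pa \<and>
         acts_by_bounded A L st G n e \<iota> Pb \<and>
         acts_by_bounded A L st G n e \<iota> Pc \<and>
         op_cstar_algebra Ba \<and> ((\<exists>u::'h. u \<noteq> 0) \<longrightarrow> \<not> has_unit Ba) \<and>
         op_cstar_algebra Bb \<and> id_blinfun \<in> Bb \<and>
         Bb = {T + c *\<^sub>C id_blinfun | T c. T \<in> Ba} \<and>
         op_cstar_algebra Bc \<and> id_blinfun \<in> Bc))"
proof -
  interpret hermitian_line_module A L st G n e \<epsilon> r M
    using assms by unfold_locales
  show ?thesis
  proof (intro conjI allI impI pre_hilbert)
    fix \<iota> :: "('h, 'l) vec \<Rightarrow> 'k"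
    assume \<iota>: "is_completion A L G n e \<iota>"
    let ?\<pi> = "rep A L st G n e \<iota>"
    note za = star_subalgebra_zero and zb = star_subalgebra_scalars and zc = star_subalgebra_whole
    have idb: "id_blinfun \<in> range (\<lambda>c. c *\<^sub>C (id_blinfun :: 'h op))"
      by (metis rangeI scaleC_one)
    \<comment> \<open>Closure commutes with adjoining the scalars, which turns the description of
      the represented pairs into that of the Thom algebra.\<close>
    have eq: "closure (?\<pi> ` fpairs A L n e (C0_plus_scalars A))
        = {T + c *\<^sub>C id_blinfun | T c. T \<in> closure (?\<pi> ` pairs {0})}"
      unfolding scalars_image[OF \<iota>]
      by (rule closure_add_line)
        (simp_all add: \<pi>_image_zero[OF \<iota> za] \<pi>_image_add[OF \<iota> za] \<pi>_image_scale[OF \<iota> za])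
    show "let Pa = fpairs A L n e (C0 A);
           Pb = fpairs A L n e (C0_plus_scalars A);
           Pc = fpairs A L n e (C_inf A);
           Ba = cstar_completion A L st G n e \<iota> Pa;
           Bb = cstar_completion A L st G n e \<iota> Pb;
           Bc = cstar_completion A L st G n e \<iota> Pc
       in
         acts_by_bounded A L st G n e \<iota> Pa \<and>
         acts_by_bounded A L st G n e \<iota> Pb \<and>
         acts_by_bounded A L st G n e \<iota> Pc \<and>
         op_cstar_algebra Ba \<and> ((\<exists>u::'h. u \<noteq> 0) \<longrightarrow> \<not> has_unit Ba) \<and>
         op_cstar_algebra Bb \<and> id_blinfun \<in> Bb \<and>
         Bb = {T + c *\<^sub>C id_blinfun | T c. T \<in> Ba} \<and>
         op_cstar_algebra Bc \<and> id_blinfun \<in> Bc"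
      unfolding Let_def cstar_completion_def C0_eq_Clim C0_plus_scalars_eq C_inf_eq_Clim
      by (intro conjI impI acts_by_bounded_pairs[OF \<iota> za] acts_by_bounded_pairs[OF \<iota> zb] acts_by_bounded_pairs[OF \<iota> zc]
          \<pi>_cstar_algebra[OF \<iota> za] \<pi>_cstar_algebra[OF \<iota> zb] \<pi>_cstar_algebra[OF \<iota> zc]
          id_in_closure[OF \<iota> idb] id_in_closure[OF \<iota> A_id] eq[unfolded C0_plus_scalars_eq])
        (elim exE, rule not_unital[OF \<iota>])
  qed
qed

end
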